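(* Suppose that, for each $\eta$, $\Phi_\eta$ is a stochastic diffeomorphism, i.e. $\Phi_\eta(\cdot,\omega)$ is almost surely a diffeomorphism of $\mathbb{R}^d$, $\operatorname{ess\,inf}_{x\in\mathbb{R}^d,\omega\in\Omega}\det(\nabla\Phi_\eta(x,\omega))=\nu>0$, $\operatorname{ess\,sup}_{x\in\mathbb{R}^d,\omega\in\Omega}|\nabla\Phi_\eta(x,\omega)|=M'<\infty$, and $\nabla\Phi_\eta$ is stationary. Suppose that $\Phi_\eta$ is a perturbation of the identity in the following sense: $\Phi_\eta(x,\omega)=x+\eta\Psi(x,\omega)+\Theta_\eta(x,\omega)$, where $\nabla\Psi$ is stationary and $\operatorname{ess\,sup}_{x,\omega}|\nabla\Psi(x,\omega)|<\infty$, with $$\lim_{\eta\to0}\|\Phi_\eta-\mathrm{Id}\|_{C^1(\mathbb{R}^d,L^\infty(\Omega))^d}=0,\qquad \lim_{\eta\to0}\|\eta^{-1}(\Phi_\eta-\mathrm{Id})-\Psi\|_{C^1(\mathbb{R}^d,L^\infty(\Omega))^d}=0,$$ and such that there is a deterministic constant $C_\Theta$ independent of $\eta$ with $\|\eta^{-2}\Theta_\eta\|_{C^1(\mathbb{R}^d,L^\infty(\Omega))^d}\le C_\Theta$ when $|\eta|\le1$. Suppose in addition that $A_{\mathrm{per}}$ is a symmetric $\mathbb{Z}^d$-periodic matrix field for which there exist $\gamma>0$ and $M>0$ with $\xi^TA_{\mathrm{per}}(x)\xi\ge\gamma|\xi|^2$ for all $\xi\in\mathbb{R}^d$ and almost every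 $x$, and $\|A_{\mathrm{per}}\|_{(L^\infty(Q))^{d\times d}}\le M$. Let $p\in\mathbb{R}^d$ with $|p|=1$. Then there exists a constant $C$ independent of $\eta$, $\omega$, $N$ and $h$ such that, for sufficiently small values of $\eta$ ($\eta\neq0$), $$\eta^{-2}\left\|\nabla w_p^{\eta,h,N}(\cdot,\omega)-\nabla w_p^{0,h}-\eta\nabla w_p^{1,h,N}(\cdot,\omega)\right\|_{(L^2(Q_N))^d}\le C\sqrt{|Q_N|}\quad\text{almost surely},$$ and $$\eta^{-2}\left|A_\eta^{\star,h,N}(\omega)-A_{\mathrm{per}}^{\star,h}-\eta A_1^{\star,h,N}(\omega)\right|\le C\quad\text{almost surely}.$$
   Context: Probabilistic setting: $(\Omega,\mathcal{F},\mathbb{P})$ is a probability space on which the group $(\mathbb{Z}^d,+)$ acts by $(\tau_k)_{k\in\mathbb{Z}^d}$; the action preserves $\mathbb{P}$ and is ergodic (if $\tau_kA=A$ for all $k$ then $\mathbb{P}(A)\in\{0,1\}$). A function $F\in L^1_{\mathrm{loc}}(\mathbb{R}^d,L^1(\Omega))$ is called stationary if for all $k\in\mathbb{Z}^d$, $F(x+k,\omega)=F(x,\tau_k\omega)$ almost everywhere and almost surely. The underlying random coefficient is $A_\eta(x,\omega)=A_{\mathrm{per}}(\Phi_\eta^{-1}(x,\omega))$. For a vector field $\Phi$, $\nabla\Phi$ denotes its matrix of first derivatives in $x$, with the gradient convention $(\nabla\Phi)_{kl}=\partial_k\Phi_l$; $\mathrm{Id}$ is the identity map, $\mathbb{I}_d$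 the identity matrix. The $C^1(\mathbb{R}^d,L^\infty(\Omega))$ norm is the supremum over $x\in\mathbb{R}^d$ of the $L^\infty(\Omega)$ norms of the function and of its first derivatives in $x$. The parameter $\eta$ is a real number. $Q=[-\frac12,\frac12]^d$ and, for $N\in\mathbb{N}$, $Q_N=[-N-\frac12,N+\frac12]^d$. Finite elements: $\mathcal{T}_h^{(Q)}$ is a periodic triangulation of $Q$ of mesh size $h$, $\mathcal{T}_h=\bigcup_{k\in\mathbb{Z}^d}(k+\mathcal{T}_h^{(Q)})$ and $\mathcal{T}_h^N=\mathcal{T}_h\cap Q_N$. $V_h^{\mathrm{per}}(Q_N)$ is the space of functions $\varphi_h$ on $\mathbb{R}^d$ that are $Q_N$-periodic, whose restriction to $Q_N$ belongs to the $\mathbb{P}_1$-Lagrange finite element space built from $\mathcal{T}_h^N$, and with $\int_{Q_N}\varphi_h=0$. $V_h^{\mathrm{per}}(Q)$ is the same space with $Q$ in place of $Q_N$. Correctors, for $p\in\mathbb{R}^d$: (i) $w_p^{\eta,h,N}(\cdot,\omega)\in V_h^{\mathrm{per}}(Q_N)$ is the solution of $$\int_{Q_N}\det(\nabla\Phi_\eta(\cdot,\omega))(\nabla\Phi_\eta(\cdot,\omega))^{-T}A_{\mathrm{per}}\left(p+(\nabla\Phi_\eta(\cdot,\omega))^{-1}\nabla w_p^{\eta,h,N}(\cdot,\omega)\right)\cdot\nabla\varphi_h=0$$ for all $\varphi_h\in V_h^{\mathrm{per}}(Q_N)$, almost surely. (ii) $w_p^{0,h}\in V_h^{\mathrm{per}}(Q)$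 is the solution of $\int_QA_{\mathrm{per}}(p+\nabla w_p^{0,h})\cdot\nabla\varphi_h=0$ for all $\varphi_h\in V_h^{\mathrm{per}}(Q)$. (iii) $w_p^{1,h,N}(\cdot,\omega)\in V_h^{\mathrm{per}}(Q_N)$ is the solution of $$\int_{Q_N}A_{\mathrm{per}}\nabla w_p^{1,h,N}(\cdot,\omega)\cdot\nabla\varphi_h-\int_{Q_N}A_{\mathrm{per}}\nabla\Psi(\cdot,\omega)\nabla w_p^{0,h}\cdot\nabla\varphi_h+\int_{Q_N}\left(\operatorname{div}\Psi(\cdot,\omega)\,\mathbb{I}_d-\nabla\Psi(\cdot,\omega)^T\right)A_{\mathrm{per}}(p+\nabla w_p^{0,h})\cdot\nabla\varphi_h=0$$ for all $\varphi_h\in V_h^{\mathrm{per}}(Q_N)$, almost surely. Matrices, for $1\le i,j\le d$, with $(e_i)$ the canonical basis of $\mathbb{R}^d$: $$[A_\eta^{\star,h,N}]_{ij}(\omega)=\det\left(\frac1{|Q_N|}\int_{Q_N}\nabla\Phi_\eta(\cdot,\omega)\right)^{-1}\frac1{|Q_N|}\int_{Q_N}\det(\nabla\Phi_\eta(\cdot,\omega))\left(e_i+(\nabla\Phi_\eta(\cdot,\omega))^{-1}\nabla w_{e_i}^{\eta,h,N}(\cdot,\omega)\right)^TA_{\mathrm{per}}e_j,$$ $$[A_{\mathrm{per}}^{\star,h}]_{ij}=\int_Qe_i^TA_{\mathrm{per}}(e_j+\nabla w_{e_j}^{0,h}),$$ $$[A_1^{\star,h,N}]_{ij}(\omega)=-[A_{\mathrm{per}}^{\star,h}]_{ij}\frac1{|Q_N|}\int_{Q_N}\operatorname{div}\Psi(\cdot,\omega)+\frac1{|Q_N|}\int_{Q_N}\operatorname{div}\Psi(\cdot,\omega)(e_i+\nabla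 w_{e_i}^{0,h})^TA_{\mathrm{per}}e_j+\frac1{|Q_N|}\int_{Q_N}\left(\nabla w_{e_i}^{1,h,N}(\cdot,\omega)-\nabla\Psi(\cdot,\omega)\nabla w_{e_i}^{0,h}\right)^TA_{\mathrm{per}}e_j.$$ *)

theory Defs
  imports "HOL-Probability.Probability"
begin

section \<open>Differential operators\<close>

text \<open>The gradient of a vector field follows the convention that the entry in row k and
  column l is the k-th partial derivative of the l-th component; it is the transpose of the
  Jacobian matrix of the library.  Where the function is not differentiable (for a finite
  element function: on the skeleton of the mesh, a null set) the values of these operators are
  unspecified.\<close>

definition grad :: "(real^'n \<Rightarrow> real) \<Rightarrow> real^'n \<Rightarrow> real^'n" where
  "grad f x = (\<chi> k. frechet_derivative f (at x) (axis k 1))"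

definition gradm :: "(real^'n \<Rightarrow> real^'n) \<Rightarrow> real^'n \<Rightarrow> real^'n^'n" where
  "gradm F x = transpose (jacobian F (at x))"

definition divergence :: "(real^'n \<Rightarrow> real^'n) \<Rightarrow> real^'n \<Rightarrow> real" where
  "divergence F x = trace (gradm F x)"

definition C1_map :: "(real^'n \<Rightarrow> real^'n) \<Rightarrow> bool" where
  "C1_map F \<longleftrightarrow> (\<forall>x. F differentiable at x) \<and> continuous_on UNIV (gradm F)"

definition diffeomorphism :: "(real^'n \<Rightarrow> real^'n) \<Rightarrow> bool" where
  "diffeomorphism F \<longleftrightarrow> bij F \<and> C1_map F \<and> C1_map (inv F)"


section \<open>Probabilistic setting\<close>

definition lattice_vec :: "int^'n \<Rightarrow> real^'n" where
  "lattice_vec k = (\<chi> i. real_of_int (k $ i))"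

definition ergodic_action :: "'w measure \<Rightarrow> (int^'n \<Rightarrow> 'w \<Rightarrow> 'w) \<Rightarrow> bool" where
  "ergodic_action P \<tau> \<longleftrightarrow>
     (\<forall>k. \<tau> k \<in> measurable P P \<and> distr P P (\<tau> k) = P) \<and>
     (\<forall>\<omega>\<in>space P. \<tau> 0 \<omega> = \<omega>) \<and>
     (\<forall>k l. \<forall>\<omega>\<in>space P. \<tau> (k + l) \<omega> = \<tau> k (\<tau> l \<omega>)) \<and>
     (\<forall>A\<in>sets P. (\<forall>k. \<tau> k ` A = A) \<longrightarrow> measure P A \<in> {0, 1})"

text \<open>The measure that "almost every x, almost surely" refers to.  It is completed, so that the
  values of a field at the exceptional events never affect measurability.\<close>

abbreviation space_prob :: "'w measure \<Rightarrow> ((real^'n) \<times> 'w) measure" where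
  "space_prob P \<equiv> completion (lborel \<Otimes>\<^sub>M P)"

text \<open>The first conjunct is membership in the space of locally integrable functions with values
  in the integrable random variables.\<close>

definition stationary ::
    "'w measure \<Rightarrow> (int^'n \<Rightarrow> 'w \<Rightarrow> 'w) \<Rightarrow>
     (real^'n \<Rightarrow> 'w \<Rightarrow> 'b::{banach, second_countable_topology}) \<Rightarrow> bool" where
  "stationary P \<tau> F \<longleftrightarrow>
     (\<forall>K. compact K \<longrightarrow> set_integrable (space_prob P) (K \<times> space P) (\<lambda>(x, \<omega>). F x \<omega>)) \<and>
     (\<forall>k. AE (x, \<omega>) in space_prob P. F (x + lattice_vec k) \<omega> = F x (\<tau> k \<omega>))"

definition essinf :: "'a measure \<Rightarrow> ('a \<Rightarrow> ereal) \<Rightarrow> ereal" where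
  "essinf M f = - esssup M (\<lambda>x. - f x)"

definition Linf_norm :: "'a measure \<Rightarrow> ('a \<Rightarrow> 'b::real_normed_vector) \<Rightarrow> ereal" where
  "Linf_norm M f =
     (if f \<in> borel_measurable M then esssup M (\<lambda>x. ereal (norm (f x))) else \<infinity>)"

text \<open>Random fields of class C1 with values in the bounded random variables.  The elements are
  represented by versions with C1 paths, so that the pathwise gradient is also the derivative of
  the map into the space of bounded random variables.  The norm is infinite for a field that is
  not of this class.\<close>

definition C1_Linf :: "'w measure \<Rightarrow> (real^'n \<Rightarrow> 'w \<Rightarrow> real^'n) \<Rightarrow> bool" where
  "C1_Linf P F \<longleftrightarrow>
     (AE \<omega> in P. C1_map (\<lambda>x. F x \<omega>)) \<and>
     (\<forall>x. ((\<lambda>y. Linf_norm (completion P) (\<lambda>\<omega>. F y \<omega> - F x \<omega>)) \<longlongrightarrow> 0) (at x)) \<and>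
     (\<forall>x. ((\<lambda>y. Linf_norm (completion P)
                   (\<lambda>\<omega>. gradm (\<lambda>z. F z \<omega>) y - gradm (\<lambda>z. F z \<omega>) x)) \<longlongrightarrow> 0) (at x))"

definition C1_Linf_norm :: "'w measure \<Rightarrow> (real^'n \<Rightarrow> 'w \<Rightarrow> real^'n) \<Rightarrow> ereal" where
  "C1_Linf_norm P F =
     (if C1_Linf P F
      then SUP x. max (Linf_norm (completion P) (F x))
                      (Linf_norm (completion P) (\<lambda>\<omega>. gradm (\<lambda>y. F y \<omega>) x))
      else \<infinity>)"

definition stochastic_diffeomorphism ::
    "'w measure \<Rightarrow> (int^'n \<Rightarrow> 'w \<Rightarrow> 'w) \<Rightarrow> (real^'n \<Rightarrow> 'w \<Rightarrow> real^'n) \<Rightarrow> bool" where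
  "stochastic_diffeomorphism P \<tau> \<Phi> \<longleftrightarrow>
     (AE \<omega> in P. diffeomorphism (\<lambda>x. \<Phi> x \<omega>)) \<and>
     (\<exists>\<nu>>0. essinf (space_prob P) (\<lambda>(x, \<omega>). ereal (det (gradm (\<lambda>y. \<Phi> y \<omega>) x))) = ereal \<nu>) \<and>
     (\<exists>M'. esssup (space_prob P) (\<lambda>(x, \<omega>). ereal (norm (gradm (\<lambda>y. \<Phi> y \<omega>) x))) = ereal M') \<and>
     stationary P \<tau> (\<lambda>x \<omega>. gradm (\<lambda>y. \<Phi> y \<omega>) x)"


section \<open>Cubes and finite elements\<close>

text \<open>The unit cube Q is \<open>cube 0\<close>.\<close>

definition cube :: "nat \<Rightarrow> (real^'n) set" where
  "cube N = cbox (vec (- real N - 1/2)) (vec (real N + 1/2))"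

definition cube_avg :: "nat \<Rightarrow> (real^'n \<Rightarrow> 'b::{banach, second_countable_topology}) \<Rightarrow> 'b" where
  "cube_avg N f = (1 / measure lebesgue (cube N :: (real^'n) set)) *\<^sub>R (LINT x:cube N|lebesgue. f x)"

definition cube_L2_norm :: "nat \<Rightarrow> (real^'n \<Rightarrow> real^'n) \<Rightarrow> real" where
  "cube_L2_norm N f = sqrt (LINT x:cube N|lebesgue. (norm (f x))\<^sup>2)"

text \<open>A mesh is given by its set of closed simplices of full dimension.\<close>

definition periodic_mesh :: "(real^'n) set set \<Rightarrow> (real^'n) set set" where
  "periodic_mesh T = {(\<lambda>x. lattice_vec k + x) ` K | k K. K \<in> T}"

text \<open>Periodicity of a triangulation of Q means that opposite faces carry matching traces, that
  is, that the translated copies fit together to a conforming mesh of the whole space.\<close>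

definition periodic_triangulation :: "(real^'n) set set \<Rightarrow> bool" where
  "periodic_triangulation T \<longleftrightarrow>
     triangulation T \<and> (\<forall>K\<in>T. int CARD('n) simplex K) \<and> \<Union>T = cube 0 \<and>
     (\<forall>K\<in>periodic_mesh T. \<forall>L\<in>periodic_mesh T. (K \<inter> L) face_of K)"

definition mesh_size :: "(real^'n) set set \<Rightarrow> real" where
  "mesh_size T = Max (diameter ` T)"

definition mesh_N :: "(real^'n) set set \<Rightarrow> nat \<Rightarrow> (real^'n) set set" where
  "mesh_N T N = {K \<in> periodic_mesh T. K \<subseteq> cube N}"

text \<open>\<open>V_per T 0\<close> is the space attached to Q itself.\<close>

definition V_per :: "(real^'n) set set \<Rightarrow> nat \<Rightarrow> (real^'n \<Rightarrow> real) set" where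
  "V_per T N = {\<phi>.
     (\<forall>x k. \<phi> (x + (2 * real N + 1) *\<^sub>R lattice_vec k) = \<phi> x) \<and>
     continuous_on (cube N) \<phi> \<and>
     (\<forall>K\<in>mesh_N T N. \<exists>a b. \<forall>x\<in>K. \<phi> x = a \<bullet> x + b) \<and>
     (LINT x:cube N|lebesgue. \<phi> x) = 0}"


section \<open>Correctors\<close>

text \<open>In this section and the next, \<open>\<Phi>\<close> and \<open>\<Psi>\<close> stand for the fields at a fixed event.\<close>

definition corrector_eta ::
    "(real^'n) set set \<Rightarrow> nat \<Rightarrow> (real^'n \<Rightarrow> real^'n^'n) \<Rightarrow> (real^'n \<Rightarrow> real^'n) \<Rightarrow> real^'n \<Rightarrow>
     (real^'n \<Rightarrow> real) \<Rightarrow> bool" where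
  "corrector_eta T N A \<Phi> p w \<longleftrightarrow> w \<in> V_per T N \<and>
     (\<forall>\<phi>\<in>V_per T N.
        (LINT x:cube N|lebesgue.
           (det (gradm \<Phi> x) *\<^sub>R
             (transpose (matrix_inv (gradm \<Phi> x)) *v
               (A x *v (p + matrix_inv (gradm \<Phi> x) *v grad w x)))) \<bullet> grad \<phi> x) = 0)"

definition corrector_0 ::
    "(real^'n) set set \<Rightarrow> (real^'n \<Rightarrow> real^'n^'n) \<Rightarrow> real^'n \<Rightarrow> (real^'n \<Rightarrow> real) \<Rightarrow> bool" where
  "corrector_0 T A p w \<longleftrightarrow> w \<in> V_per T 0 \<and>
     (\<forall>\<phi>\<in>V_per T 0. (LINT x:cube 0|lebesgue. (A x *v (p + grad w x)) \<bullet> grad \<phi> x) = 0)"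

definition corrector_1 ::
    "(real^'n) set set \<Rightarrow> nat \<Rightarrow> (real^'n \<Rightarrow> real^'n^'n) \<Rightarrow> (real^'n \<Rightarrow> real^'n) \<Rightarrow> real^'n \<Rightarrow>
     (real^'n \<Rightarrow> real) \<Rightarrow> (real^'n \<Rightarrow> real) \<Rightarrow> bool" where
  "corrector_1 T N A \<Psi> p w0 w \<longleftrightarrow> w \<in> V_per T N \<and>
     (\<forall>\<phi>\<in>V_per T N.
        (LINT x:cube N|lebesgue. (A x *v grad w x) \<bullet> grad \<phi> x)
        - (LINT x:cube N|lebesgue. (A x *v (gradm \<Psi> x *v grad w0 x)) \<bullet> grad \<phi> x)
        + (LINT x:cube N|lebesgue.
             ((mat (divergence \<Psi> x) - transpose (gradm \<Psi> x)) *v (A x *v (p + grad w0 x)))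
               \<bullet> grad \<phi> x) = 0)"


section \<open>Homogenized matrices\<close>

text \<open>The last argument(s) of these functions map a direction p to the corrector for p.\<close>

definition Astar_eta ::
    "nat \<Rightarrow> (real^'n \<Rightarrow> real^'n^'n) \<Rightarrow> (real^'n \<Rightarrow> real^'n) \<Rightarrow> (real^'n \<Rightarrow> real^'n \<Rightarrow> real) \<Rightarrow>
     real^'n^'n" where
  "Astar_eta N A \<Phi> w = (\<chi> i j.
     inverse (det (cube_avg N (gradm \<Phi>))) *
     cube_avg N (\<lambda>x. det (gradm \<Phi> x) *
       ((axis i 1 + matrix_inv (gradm \<Phi> x) *v grad (w (axis i 1)) x) \<bullet> (A x *v axis j 1))))"

definition Astar_per ::
    "(real^'n \<Rightarrow> real^'n^'n) \<Rightarrow> (real^'n \<Rightarrow> real^'n \<Rightarrow> real) \<Rightarrow> real^'n^'n" where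
  "Astar_per A w0 = (\<chi> i j.
     LINT x:cube 0|lebesgue. axis i 1 \<bullet> (A x *v (axis j 1 + grad (w0 (axis j 1)) x)))"

definition Astar_1 ::
    "nat \<Rightarrow> (real^'n \<Rightarrow> real^'n^'n) \<Rightarrow> (real^'n \<Rightarrow> real^'n) \<Rightarrow> (real^'n \<Rightarrow> real^'n \<Rightarrow> real) \<Rightarrow>
     (real^'n \<Rightarrow> real^'n \<Rightarrow> real) \<Rightarrow> real^'n^'n" where
  "Astar_1 N A \<Psi> w0 w1 = (\<chi> i j.
     - (Astar_per A w0 $ i $ j) * cube_avg N (divergence \<Psi>)
     + cube_avg N (\<lambda>x. divergence \<Psi> x * ((axis i 1 + grad (w0 (axis i 1)) x) \<bullet> (A x *v axis j 1)))
     + cube_avg N (\<lambda>x. (grad (w1 (axis i 1)) x - gradm \<Psi> x *v grad (w0 (axis i 1)) x)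
                         \<bullet> (A x *v axis j 1)))"

end

theory Submission
  imports Defs
begin

text \<open>The estimate is deterministic: it holds for every event at which the fields are of class C1 and
  their gradients are bounded by deterministic constants. At such an event the gradient of the
  diffeomorphism has an expansion \<open>Id + \<eta> \<nabla>\<Psi> + O(\<eta>\<^sup>2)\<close>, uniformly in space. The determinant and the
  inverse then have expansions of the same kind (\<open>expansion_det\<close>, \<open>expansion_matrix_inv\<close>), and the
  product rule \<open>expansion_bilinear\<close> yields the expansion of the flux in the perturbed cell problem,
  evaluated at \<open>\<nabla>w\<^sup>0 + \<eta> \<nabla>w\<^sup>1\<close>. Its zeroth and first coefficients are the fluxes in the equations of
  \<open>w\<^sup>0\<close> and \<open>w\<^sup>1\<close>, so they vanish against all test functions. What is left says that the flux of the
  remainder \<open>w\<^sup>\<eta> - w\<^sup>0 - \<eta> w\<^sup>1\<close> is balanced by a field of size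
  \<open>\<eta>\<^sup>2 (1 + \<bar>\<nabla>w\<^sup>0\<bar> + \<bar>\<nabla>w\<^sup>1\<bar>)\<close>, and coercivity gives the bound for the remainder
  (\<open>corrector_remainder_bound\<close>). The gradients of \<open>w\<^sup>0\<close> and \<open>w\<^sup>1\<close> are bounded in mean square by the
  same energy estimate, with constants that depend on the dimension, the ellipticity constant and
  the bounds of the coefficient and the fields only.

  The expansion of the homogenized matrix follows by averaging the expansion of its integrand, by
  multiplying with that of the inverse determinant, and by the bound for the corrector remainder
  (\<open>entry_remainder_bound\<close>). Symmetry of the coefficient is used here, to identify the zeroth
  coefficient with the periodic homogenized matrix.

  Two points depend on the discretization. The corrector \<open>w\<^sup>0\<close> lives on the unit cube, while the other
  two live on a large cube; summing a test function over the translates in a period cell transfers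
  its equation to the large cube (\<open>corrector_0_on_cube\<close>). The gradient of a finite element function
  is constant in the interior of every simplex, hence defined and bounded almost everywhere.\<close>

section \<open>Matrices and second-order expansions\<close>

lemma matrix_diff_ldistrib: "A ** (B - C) = A ** B - A ** (C :: real^'k^'n)"
  for A :: "real^'n^'m"
  by (simp add: vec_eq_iff matrix_matrix_mult_def right_diff_distrib sum_subtractf)

lemma matrix_diff_rdistrib: "(A - B) ** C = A ** C - B ** (C :: real^'k^'n)"
  for A :: "real^'n^'m"
  by (simp add: vec_eq_iff matrix_matrix_mult_def left_diff_distrib sum_subtractf)

lemma norm_matrix_vector_mult_le:
  fixes A :: "real^'n^'m"
  shows "norm (A *v x) \<le> norm A * norm x"
proof -
  have "norm (A *v x) \<le> L2_set (\<lambda>i. norm (A $ i) * norm x) UNIV"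
    unfolding norm_vec_def[of "A *v x"]
    by (intro L2_set_mono)
      (auto simp: Cauchy_Schwarz_ineq2 matrix_vector_mul_component)
  also have "\<dots> = norm A * norm x"
    by (simp add: L2_set_left_distrib norm_vec_def)
  finally show ?thesis .
qed

lemma norm_transpose: "norm (transpose A) = norm (A :: real^'n^'m)"
proof -
  have "(\<Sum>i\<in>UNIV. \<Sum>j\<in>UNIV. (A $ j $ i)\<^sup>2) = (\<Sum>j\<in>UNIV. \<Sum>i\<in>UNIV. (A $ j $ i)\<^sup>2)"
    by (rule sum.swap)
  then show ?thesis
    by (simp add: norm_vec_def L2_set_def transpose_def sum_nonneg)
qed

lemma norm_matrix_matrix_mult_le:
  fixes A :: "real^'n^'m" and B :: "real^'k^'n"
  shows "norm (A ** B) \<le> norm A * norm B"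
proof -
  have row: "(A ** B) $ i = transpose B *v (A $ i)" for i
    by (simp add: vec_eq_iff matrix_matrix_mult_def matrix_vector_mult_def transpose_def
        mult.commute)
  have le: "norm (transpose B *v (A $ i)) \<le> norm (A $ i) * norm B" for i
    using norm_matrix_vector_mult_le[of "transpose B" "A $ i"]
    by (simp only: norm_transpose mult.commute)
  have "norm (A ** B) \<le> L2_set (\<lambda>i. norm (A $ i) * norm B) UNIV"
    unfolding norm_vec_def[of "A ** B"] row
    by (intro L2_set_mono le norm_ge_zero)
  also have "\<dots> = norm A * norm B"
    by (simp add: L2_set_left_distrib norm_vec_def)
  finally show ?thesis .
qed

lemma bounded_bilinear_matrix_vector_mult:
  "bounded_bilinear ((*v) :: real^'n^'m \<Rightarrow> real^'n \<Rightarrow> real^'m)"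
proof
  show "\<exists>K. \<forall>(A :: real^'n^'m) x. norm (A *v x) \<le> norm A * norm x * K"
    by (rule exI[of _ 1]) (simp add: norm_matrix_vector_mult_le)
qed (simp_all add: matrix_vector_mult_add_rdistrib matrix_vector_right_distrib
    matrix_vector_mult_scaleR scaleR_matrix_vector_assoc)

lemma norm_mat_1_ge_1: "1 \<le> norm (mat 1 :: real^'n^'n)"
proof -
  fix i :: 'n
  have "1 = \<bar>(mat 1 :: real^'n^'n) $ i $ i\<bar>"
    by (simp add: mat_def)
  also have "\<dots> \<le> norm ((mat 1 :: real^'n^'n) $ i)"
    by (rule component_le_norm_cart)
  also have "\<dots> \<le> norm (mat 1 :: real^'n^'n)"
    by (rule Finite_Cartesian_Product.norm_nth_le)
  finally show ?thesis .
qed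

lemma abs_matrix_entry_le_norm: "\<bar>A $ i $ j\<bar> \<le> norm (A :: real^'n^'m)"
  by (meson component_le_norm_cart Finite_Cartesian_Product.norm_nth_le order_trans)

lemma norm_matrix_le_sum_abs: "norm (A :: real^'n^'m) \<le> (\<Sum>i\<in>UNIV. \<Sum>j\<in>UNIV. \<bar>A $ i $ j\<bar>)"
proof -
  have "norm A \<le> (\<Sum>i\<in>UNIV. norm (A $ i))"
    unfolding norm_vec_def[of A] by (rule L2_set_le_sum) auto
  also have "\<dots> \<le> (\<Sum>i\<in>UNIV. \<Sum>j\<in>UNIV. \<bar>A $ i $ j\<bar>)"
    by (intro sum_mono norm_le_l1_cart)
  finally show ?thesis .
qed

text \<open>Near the identity a matrix is invertible, because the norm of a vector in its kernel
  is at most half of itself.\<close>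

lemma matrix_inv_mult:
  fixes M :: "real^'n^'n"
  assumes "norm (M - mat 1) \<le> 1 / 2"
  shows "M ** matrix_inv M = mat 1" and "matrix_inv M ** M = mat 1"
proof -
  have "x = 0" if "M *v x = 0" for x
  proof -
    have "x = - ((M - mat 1) *v x)"
      using that by (simp add: matrix_vector_mult_diff_rdistrib)
    then have "norm x \<le> 1 / 2 * norm x"
      using norm_matrix_vector_mult_le[of "M - mat 1" x] assms
      by (metis mult_right_mono norm_ge_zero norm_minus_cancel order_trans)
    then show ?thesis by simp
  qed
  then obtain B where "B ** M = mat 1"
    using matrix_left_invertible_ker by blast
  then have "invertible M"
    using invertible_def matrix_left_right_inverse by blast
  then have "M ** matrix_inv M = mat 1 \<and> matrix_inv M ** M = mat 1"
    unfolding invertible_def matrix_inv_def by (rule someI_ex)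
  then show "M ** matrix_inv M = mat 1" "matrix_inv M ** M = mat 1"
    by auto
qed

lemma norm_matrix_inv_le:
  fixes M :: "real^'n^'n"
  assumes "norm (M - mat 1) \<le> 1 / 2"
  shows "norm (matrix_inv M) \<le> 2 * norm (mat 1 :: real^'n^'n)"
proof -
  let ?B = "matrix_inv M"
  have "?B = mat 1 - ?B ** (M - mat 1)"
    using matrix_inv_mult(2)[OF assms] by (simp add: matrix_diff_ldistrib)
  then have "norm ?B \<le> norm (mat 1 :: real^'n^'n) + norm (?B ** (M - mat 1))"
    by (metis norm_triangle_ineq4)
  also have "norm (?B ** (M - mat 1)) \<le> norm ?B * (1 / 2)"
    using norm_matrix_matrix_mult_le mult_left_mono[OF assms norm_ge_zero] order_trans by blast
  finally show ?thesis by simp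
qed

lemma continuous_on_matrix_inv:
  fixes F :: "'a::topological_space \<Rightarrow> real^'n^'n"
  assumes "continuous_on S F" and near: "\<And>x. x \<in> S \<Longrightarrow> norm (F x - mat 1) \<le> 1 / 2"
  shows "continuous_on S (\<lambda>x. matrix_inv (F x))"
proof -
  define D where "D = {M :: real^'n^'n. norm (M - mat 1) \<le> 1 / 2}"
  define c where "c = 2 * norm (mat 1 :: real^'n^'n)"
  have lip: "norm (matrix_inv M - matrix_inv N) \<le> c * c * norm (M - N)" if "M \<in> D" "N \<in> D" for M N
  proof -
    have MN: "norm (M - mat 1) \<le> 1 / 2" "norm (N - mat 1) \<le> 1 / 2"
      using that by (auto simp: D_def)
    have "matrix_inv M - matrix_inv N = matrix_inv M ** (N - M) ** matrix_inv N"
      using matrix_inv_mult[OF MN(1)] matrix_inv_mult[OF MN(2)]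
      by (simp add: matrix_diff_ldistrib matrix_diff_rdistrib matrix_mul_assoc[symmetric])
    then have "norm (matrix_inv M - matrix_inv N)
        \<le> norm (matrix_inv M) * norm (N - M) * norm (matrix_inv N)"
      using norm_matrix_matrix_mult_le[of "matrix_inv M ** (N - M)" "matrix_inv N"]
        norm_matrix_matrix_mult_le[of "matrix_inv M" "N - M"]
      by (smt (verit) mult_right_mono norm_ge_zero)
    also have "\<dots> \<le> c * norm (N - M) * c"
      using norm_matrix_inv_le[OF MN(1)] norm_matrix_inv_le[OF MN(2)]
      by (intro mult_mono) (auto simp: c_def)
    finally show ?thesis by (simp add: norm_minus_commute mult_ac)
  qed
  have "(c * c)-lipschitz_on D (matrix_inv :: real^'n^'n \<Rightarrow> _)"
    using lip by (intro lipschitz_onI) (auto simp: dist_norm)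
  then have "continuous_on D (matrix_inv :: real^'n^'n \<Rightarrow> _)"
    by (rule lipschitz_on_continuous_on)
  then show ?thesis
    by (rule continuous_on_compose2[OF _ assms(1)]) (use near in \<open>auto simp: D_def\<close>)
qed

text \<open>The number \<open>a\<close>, vector or matrix, has the second-order expansion
  \<open>a = a\<^sub>0 + \<eta> a\<^sub>1 + O(\<eta>\<^sup>2)\<close>. One constant \<open>c\<close> bounds both coefficients and the remainder, so that
  the rule for products needs the constants of the factors only.\<close>

definition expansion :: "real \<Rightarrow> real \<Rightarrow> 'a::real_normed_vector \<Rightarrow> 'a \<Rightarrow> 'a \<Rightarrow> bool" where
  "expansion \<eta> c a a\<^sub>0 a\<^sub>1 \<longleftrightarrow>
     norm a\<^sub>0 \<le> c \<and> norm a\<^sub>1 \<le> c \<and> norm (a - a\<^sub>0 - \<eta> *\<^sub>R a\<^sub>1) \<le> c * \<eta>\<^sup>2"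

lemma expansion_mono: "expansion \<eta> c a a\<^sub>0 a\<^sub>1 \<Longrightarrow> c \<le> c' \<Longrightarrow> expansion \<eta> c' a a\<^sub>0 a\<^sub>1"
  unfolding expansion_def
  by (meson mult_right_mono order_trans zero_le_power2)

lemma expansion_nonneg: "expansion \<eta> c a a\<^sub>0 a\<^sub>1 \<Longrightarrow> 0 \<le> c"
  unfolding expansion_def by (meson norm_ge_zero order_trans)

lemma expansion_const: "norm a \<le> c \<Longrightarrow> expansion \<eta> c a a 0"
  using order_trans[OF norm_ge_zero, of a c] by (simp add: expansion_def)

lemma expansion_add:
  assumes "expansion \<eta> c a a\<^sub>0 a\<^sub>1" "expansion \<eta> c' b b\<^sub>0 b\<^sub>1"
  shows "expansion \<eta> (c + c') (a + b) (a\<^sub>0 + b\<^sub>0) (a\<^sub>1 + b\<^sub>1)"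
proof -
  have "a + b - (a\<^sub>0 + b\<^sub>0) - \<eta> *\<^sub>R (a\<^sub>1 + b\<^sub>1) = (a - a\<^sub>0 - \<eta> *\<^sub>R a\<^sub>1) + (b - b\<^sub>0 - \<eta> *\<^sub>R b\<^sub>1)"
    by (simp add: algebra_simps)
  then show ?thesis
    using assms unfolding expansion_def
    by (simp only: distrib_right) (blast intro: norm_triangle_mono)
qed

lemma expansion_linear:
  assumes "expansion \<eta> c a a\<^sub>0 a\<^sub>1" "linear f" "\<And>x. norm (f x) \<le> k * norm x" "k \<ge> 0"
  shows "expansion \<eta> (k * c) (f a) (f a\<^sub>0) (f a\<^sub>1)"
proof -
  have "f a - f a\<^sub>0 - \<eta> *\<^sub>R f a\<^sub>1 = f (a - a\<^sub>0 - \<eta> *\<^sub>R a\<^sub>1)"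
    by (simp add: assms(2) linear_diff linear_scale)
  then show ?thesis
    using assms unfolding expansion_def
    by (auto intro!: order_trans[OF assms(3)] mult_left_mono simp: mult.assoc)
qed

lemma expansion_norm_le:
  assumes "expansion \<eta> c a a\<^sub>0 a\<^sub>1" "\<bar>\<eta>\<bar> \<le> 1"
  shows "norm a \<le> 3 * c" "norm (a - a\<^sub>0) \<le> 2 * c * \<bar>\<eta>\<bar>"
proof -
  have c: "c \<ge> 0" by (rule expansion_nonneg[OF assms(1)])
  have "\<eta>\<^sup>2 \<le> \<bar>\<eta>\<bar>"
    using assms(2) power2_le_iff_abs_le[of 1 "\<eta>"] by (metis abs_ge_zero mult_left_le power2_abs power2_eq_square)
  then have *: "c * \<eta>\<^sup>2 \<le> c * \<bar>\<eta>\<bar>" using c by (rule mult_left_mono)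
  have "norm (\<eta> *\<^sub>R a\<^sub>1) \<le> c * \<bar>\<eta>\<bar>"
    using assms(1) unfolding expansion_def by (simp add: mult.commute[of c] mult_left_mono)
  moreover have "norm (a - a\<^sub>0) \<le> norm (a - a\<^sub>0 - \<eta> *\<^sub>R a\<^sub>1) + norm (\<eta> *\<^sub>R a\<^sub>1)"
    by (metis diff_add_cancel norm_triangle_ineq)
  ultimately show 2: "norm (a - a\<^sub>0) \<le> 2 * c * \<bar>\<eta>\<bar>"
    using assms(1) * unfolding expansion_def by linarith
  have "2 * c * \<bar>\<eta>\<bar> \<le> 2 * c"
    using assms(2) c by (simp add: mult_left_le)
  then show "norm a \<le> 3 * c"
    using 2 assms(1) norm_triangle_sub[of a a\<^sub>0] unfolding expansion_def by linarith
qed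

text \<open>The product rule: the terms of order two and higher are absorbed into the factor 6
  because \<open>\<bar>\<eta>\<bar> \<le> 1\<close>.\<close>

lemma expansion_bilinear:
  assumes f: "bounded_bilinear f" "\<And>x y. norm (f x y) \<le> norm x * norm y"
    and \<eta>: "\<bar>\<eta>\<bar> \<le> 1"
    and a: "expansion \<eta> c a a\<^sub>0 a\<^sub>1" and b: "expansion \<eta> c' b b\<^sub>0 b\<^sub>1"
  shows "expansion \<eta> (6 * c * c') (f a b) (f a\<^sub>0 b\<^sub>0) (f a\<^sub>1 b\<^sub>0 + f a\<^sub>0 b\<^sub>1)"
proof -
  interpret bounded_bilinear f by (rule f)
  have nn: "c \<ge> 0" "c' \<ge> 0"
    by (rule expansion_nonneg[OF a], rule expansion_nonneg[OF b])
  have le: "norm (f x y) \<le> k * k'" if "norm x \<le> k" "norm y \<le> k'" for x y k k'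
    using f(2)[of x y] mult_mono'[OF that] by (meson norm_ge_zero order_trans)
  define r where "r = a - a\<^sub>0 - \<eta> *\<^sub>R a\<^sub>1"
  define s where "s = b - b\<^sub>0 - \<eta> *\<^sub>R b\<^sub>1"
  have bs: "norm a\<^sub>0 \<le> c" "norm a\<^sub>1 \<le> c" "norm r \<le> c * \<eta>\<^sup>2" "norm a \<le> 3 * c"
    "norm b\<^sub>0 \<le> c'" "norm b\<^sub>1 \<le> c'" "norm s \<le> c' * \<eta>\<^sup>2"
    using a b expansion_norm_le[OF a \<eta>] by (auto simp: expansion_def r_def s_def)
  have "norm (\<eta> *\<^sub>R b\<^sub>1) \<le> 1 * c'"
    using \<eta> bs(6) by (simp only: norm_scaleR) (intro mult_mono; auto)
  then have b': "norm (b\<^sub>0 + \<eta> *\<^sub>R b\<^sub>1) \<le> 2 * c'"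
    using bs(5) norm_triangle_ineq[of b\<^sub>0 "\<eta> *\<^sub>R b\<^sub>1"] by linarith
  have ab: "a = a\<^sub>0 + \<eta> *\<^sub>R a\<^sub>1 + r" "b = b\<^sub>0 + \<eta> *\<^sub>R b\<^sub>1 + s"
    by (simp_all add: r_def s_def)
  have "f a b - f a\<^sub>0 b\<^sub>0 - \<eta> *\<^sub>R (f a\<^sub>1 b\<^sub>0 + f a\<^sub>0 b\<^sub>1)
      = \<eta>\<^sup>2 *\<^sub>R f a\<^sub>1 b\<^sub>1 + (f r (b\<^sub>0 + \<eta> *\<^sub>R b\<^sub>1) + f a s)"
  proof -
    have "f a b = f a (b\<^sub>0 + \<eta> *\<^sub>R b\<^sub>1) + f a s"
      by (subst ab(2)) (simp add: add_right)
    also have "f a (b\<^sub>0 + \<eta> *\<^sub>R b\<^sub>1) = f (a\<^sub>0 + \<eta> *\<^sub>R a\<^sub>1) (b\<^sub>0 + \<eta> *\<^sub>R b\<^sub>1) + f r (b\<^sub>0 + \<eta> *\<^sub>R b\<^sub>1)"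
      by (subst ab(1)) (simp add: add_left)
    finally show ?thesis
      by (simp add: add_left add_right scaleR_left scaleR_right power2_eq_square algebra_simps)
  qed
  also have "norm \<dots> \<le> \<eta>\<^sup>2 * (c * c') + (c * \<eta>\<^sup>2 * (2 * c') + 3 * c * (c' * \<eta>\<^sup>2))"
    using bs b' by (intro norm_triangle_mono le) (auto intro!: mult_left_mono le)
  also have "\<dots> = 6 * c * c' * \<eta>\<^sup>2"
    by (simp add: algebra_simps)
  finally have 2: "norm (f a b - f a\<^sub>0 b\<^sub>0 - \<eta> *\<^sub>R (f a\<^sub>1 b\<^sub>0 + f a\<^sub>0 b\<^sub>1)) \<le> 6 * c * c' * \<eta>\<^sup>2" .
  have "norm (f a\<^sub>0 b\<^sub>0) \<le> c * c'" "norm (f a\<^sub>1 b\<^sub>0 + f a\<^sub>0 b\<^sub>1) \<le> c * c' + c * c'"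
    using bs by (blast intro: norm_triangle_mono le)+
  moreover have "c * c' \<ge> 0" using nn by simp
  ultimately show ?thesis
    using 2 unfolding expansion_def by linarith
qed

lemmas expansion_matrix_vector_mult =
  expansion_bilinear[OF bounded_bilinear_matrix_vector_mult norm_matrix_vector_mult_le]

lemma expansion_scaleR:
  fixes b :: "'a::real_normed_vector"
  shows "\<bar>\<eta>\<bar> \<le> 1 \<Longrightarrow> expansion \<eta> c a a\<^sub>0 a\<^sub>1 \<Longrightarrow> expansion \<eta> c' b b\<^sub>0 b\<^sub>1 \<Longrightarrow>
    expansion \<eta> (6 * c * c') (a *\<^sub>R b) (a\<^sub>0 *\<^sub>R b\<^sub>0) (a\<^sub>1 *\<^sub>R b\<^sub>0 + a\<^sub>0 *\<^sub>R b\<^sub>1)"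
  by (rule expansion_bilinear[OF bounded_bilinear_scaleR]) auto

lemma expansion_inner:
  fixes b :: "'a::real_inner"
  shows "\<bar>\<eta>\<bar> \<le> 1 \<Longrightarrow> expansion \<eta> c a a\<^sub>0 a\<^sub>1 \<Longrightarrow> expansion \<eta> c' b b\<^sub>0 b\<^sub>1 \<Longrightarrow>
    expansion \<eta> (6 * c * c') (a \<bullet> b) (a\<^sub>0 \<bullet> b\<^sub>0) (a\<^sub>1 \<bullet> b\<^sub>0 + a\<^sub>0 \<bullet> b\<^sub>1)"
  by (rule expansion_bilinear[OF bounded_bilinear_inner]) (auto simp: norm_cauchy_schwarz Cauchy_Schwarz_ineq2)

lemma expansion_transpose:
  fixes a :: "real^'n^'m"
  shows "expansion \<eta> c a a\<^sub>0 a\<^sub>1 \<Longrightarrow> expansion \<eta> c (transpose a) (transpose a\<^sub>0) (transpose a\<^sub>1)"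
  using expansion_linear[of \<eta> c a a\<^sub>0 a\<^sub>1 transpose 1]
  by (simp add: norm_transpose linear_iff) (simp add: transpose_def vec_eq_iff)

lemma expansion_prod:
  fixes f :: "'i \<Rightarrow> real"
  assumes \<eta>: "\<bar>\<eta>\<bar> \<le> 1" and "finite I" and "1 \<le> c"
    and "\<And>i. i \<in> I \<Longrightarrow> expansion \<eta> c (f i) (f\<^sub>0 i) (f\<^sub>1 i)"
  shows "expansion \<eta> ((6 * c) ^ card I) (prod f I) (prod f\<^sub>0 I)
    (\<Sum>i\<in>I. f\<^sub>1 i * prod f\<^sub>0 (I - {i}))"
  using assms(2,4)
proof (induction I)
  case empty
  then show ?case by (simp add: expansion_const)
next
  case (insert i I)
  have "expansion \<eta> (6 * c * (6 * c) ^ card I) (f i * prod f I) (f\<^sub>0 i * prod f\<^sub>0 I)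
     (f\<^sub>1 i * prod f\<^sub>0 I + f\<^sub>0 i * (\<Sum>j\<in>I. f\<^sub>1 j * prod f\<^sub>0 (I - {j})))"
    using expansion_scaleR[OF \<eta> insert.prems[OF insertI1] insert.IH] insert.prems
    by (simp only: real_scaleR_def) blast
  moreover have "f\<^sub>1 i * prod f\<^sub>0 I + f\<^sub>0 i * (\<Sum>j\<in>I. f\<^sub>1 j * prod f\<^sub>0 (I - {j}))
      = (\<Sum>j\<in>insert i I. f\<^sub>1 j * prod f\<^sub>0 (insert i I - {j}))"
  proof -
    have "f\<^sub>0 i * (\<Sum>j\<in>I. f\<^sub>1 j * prod f\<^sub>0 (I - {j}))
        = (\<Sum>j\<in>I. f\<^sub>1 j * prod f\<^sub>0 (insert i I - {j}))"
      unfolding sum_distrib_left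
    proof (rule sum.cong[OF refl])
      fix j assume "j \<in> I"
      then have "insert i I - {j} = insert i (I - {j})" using insert by auto
      then show "f\<^sub>0 i * (f\<^sub>1 j * prod f\<^sub>0 (I - {j})) = f\<^sub>1 j * prod f\<^sub>0 (insert i I - {j})"
        using insert by simp
    qed
    then show ?thesis using insert by simp
  qed
  ultimately show ?case using insert by simp
qed

lemma expansion_sum:
  assumes "finite I" "\<And>i. i \<in> I \<Longrightarrow> expansion \<eta> (c i) (f i) (f\<^sub>0 i) (f\<^sub>1 i)"
  shows "expansion \<eta> (sum c I) (sum f I) (sum f\<^sub>0 I) (sum f\<^sub>1 I)"
  using assms by (induction I) (auto simp: expansion_add expansion_const)

text \<open>By the Leibniz formula: the identity permutation contributes \<open>1 + \<eta> tr G\<close> up to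
  terms of order two, and every other permutation contributes only such terms.\<close>

lemma expansion_det:
  fixes M G :: "real^'n^'n"
  assumes \<eta>: "\<bar>\<eta>\<bar> \<le> 1" and M: "expansion \<eta> c M (mat 1) G"
  shows "expansion \<eta> (fact CARD('n) * (6 * c) ^ CARD('n)) (det M) 1 (trace G)"
proof -
  let ?U = "UNIV :: 'n set"
  let ?\<delta> = "\<lambda>i j. (mat 1 :: real^'n^'n) $ i $ j"
  let ?first = "\<lambda>\<pi>. \<Sum>i\<in>?U. G $ i $ \<pi> i * (\<Prod>j\<in>?U - {i}. ?\<delta> j (\<pi> j))"
  have c: "1 \<le> c"
    using M norm_mat_1_ge_1 unfolding expansion_def by (meson order_trans)
  have entry: "expansion \<eta> c (M $ i $ j) (?\<delta> i j) (G $ i $ j)" for i j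
    using expansion_linear[OF M, of "\<lambda>A. A $ i $ j" 1]
    by (simp add: linear_iff abs_matrix_entry_le_norm)
  have sgn: "\<bar>of_int (sign \<pi>)\<bar> = (1 :: real)" for \<pi> :: "'n \<Rightarrow> 'n"
    by (simp add: sign_def)
  have "expansion \<eta> ((6 * c) ^ CARD('n)) (of_int (sign \<pi>) * (\<Prod>i\<in>?U. M $ i $ \<pi> i))
      (of_int (sign \<pi>) * (\<Prod>i\<in>?U. ?\<delta> i (\<pi> i))) (of_int (sign \<pi>) * ?first \<pi>)" for \<pi>
    using expansion_linear[OF expansion_prod[OF \<eta> finite c entry, of UNIV "\<lambda>i. i" \<pi>],
        of "\<lambda>x. of_int (sign \<pi>) * x" 1]
    by (simp add: linear_iff distrib_left mult.left_commute abs_mult sgn)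
  then have "expansion \<eta> (\<Sum>\<pi> | \<pi> permutes ?U. (6 * c) ^ CARD('n)) (det M)
      (\<Sum>\<pi> | \<pi> permutes ?U. of_int (sign \<pi>) * (\<Prod>i\<in>?U. ?\<delta> i (\<pi> i)))
      (\<Sum>\<pi> | \<pi> permutes ?U. of_int (sign \<pi>) * ?first \<pi>)"
    unfolding det_def by (intro expansion_sum) (auto simp: finite_permutations)
  moreover have "(\<Sum>\<pi> | \<pi> permutes ?U. of_int (sign \<pi>) * (\<Prod>i\<in>?U. ?\<delta> i (\<pi> i))) = 1"
    using det_I[where 'a=real and 'n='n] unfolding det_def .
  moreover have "(\<Sum>\<pi> | \<pi> permutes ?U. of_int (sign \<pi>) * ?first \<pi>) = trace G"
  proof -
    have "?first \<pi> = 0" if perm: "\<pi> permutes ?U" and ne: "\<pi> \<noteq> id" for \<pi>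
    proof (rule sum.neutral, intro ballI)
      fix i
      \<comment> \<open>A permutation other than the identity moves at least two points.\<close>
      obtain a where a: "\<pi> a \<noteq> a"
        using ne by fastforce
      have "\<pi> (\<pi> a) \<noteq> \<pi> a"
        using a permutes_inj[OF perm] by (simp add: inj_eq)
      then obtain j where "j \<noteq> i" "j \<noteq> \<pi> j"
        using a by metis
      then have "(\<Prod>j\<in>?U - {i}. ?\<delta> j (\<pi> j)) = 0"
        by (intro prod_zero) (auto simp: mat_def intro!: bexI[of _ j])
      then show "G $ i $ \<pi> i * (\<Prod>j\<in>?U - {i}. ?\<delta> j (\<pi> j)) = 0" by simp
    qed
    then have "(\<Sum>\<pi> | \<pi> permutes ?U. of_int (sign \<pi>) * ?first \<pi>)
        = (\<Sum>\<pi>\<in>{id}. of_int (sign \<pi>) * ?first \<pi>)"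
      by (intro sum.mono_neutral_right) (auto simp: finite_permutations permutes_id)
    then show ?thesis by (simp add: mat_def trace_def)
  qed
  ultimately show ?thesis
    by (simp add: card_permutations)
qed

text \<open>With \<open>M = 1 + E\<close> one has \<open>M\<^sup>-\<^sup>1 = 1 - E + M\<^sup>-\<^sup>1 E E\<close>, and \<open>E\<close> is of order \<open>\<eta>\<close>.\<close>

lemma expansion_matrix_inv:
  fixes M G :: "real^'n^'n"
  assumes \<eta>: "\<bar>\<eta>\<bar> \<le> 1" and M: "expansion \<eta> c M (mat 1) G" and small: "4 * c * \<bar>\<eta>\<bar> \<le> 1"
  shows "norm (M - mat 1) \<le> 1 / 2" and "expansion \<eta> (9 * c ^ 3) (matrix_inv M) (mat 1) (- G)"
proof -
  let ?B = "matrix_inv M"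
  define E where "E = M - mat 1"
  have cI: "norm (mat 1 :: real^'n^'n) \<le> c" and cG: "norm G \<le> c"
    and cE: "norm (E - \<eta> *\<^sub>R G) \<le> c * \<eta>\<^sup>2"
    using M by (auto simp: expansion_def E_def)
  have c: "1 \<le> c" using cI norm_mat_1_ge_1 order_trans by blast
  have E: "norm E \<le> 2 * c * \<bar>\<eta>\<bar>"
    using expansion_norm_le(2)[OF M \<eta>] by (simp add: E_def)
  then show near: "norm (M - mat 1) \<le> 1 / 2" using small by (simp add: E_def)
  have B: "norm ?B \<le> 2 * c" using norm_matrix_inv_le[OF near] cI by linarith
  have "?B - mat 1 + ?B ** E = 0"
    using matrix_inv_mult(2)[OF near] by (simp add: E_def matrix_diff_ldistrib)
  then have eq: "?B - mat 1 = - (?B ** E)" by (simp add: eq_neg_iff_add_eq_0)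
  have "?B ** E - E = (?B - mat 1) ** E"
    by (simp add: matrix_diff_rdistrib)
  also have "\<dots> = - (?B ** E ** E)"
    unfolding eq using matrix_diff_rdistrib[of 0 "?B ** E" E] by simp
  finally have "?B ** E - E = - (?B ** E ** E)" .
  then have "?B ** E ** E = E - ?B ** E"
    by (metis minus_diff_eq minus_minus)
  moreover have "b - mat 1 - \<eta> *\<^sub>R (- G) = Y - (E - \<eta> *\<^sub>R G)"
    if "b - mat 1 = - X" "Y = E - X" for b X Y :: "real^'n^'n"
    unfolding that by simp
  ultimately have "norm (?B - mat 1 - \<eta> *\<^sub>R (- G)) = norm (?B ** E ** E - (E - \<eta> *\<^sub>R G))"
    using eq by metis
  also have "\<dots> \<le> norm (?B ** E ** E) + c * \<eta>\<^sup>2"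
    using norm_triangle_ineq4[of "?B ** E ** E" "E - \<eta> *\<^sub>R G"] cE by linarith
  also have "norm (?B ** E ** E) \<le> norm ?B * norm E * norm E"
    by (meson mult_right_mono norm_ge_zero norm_matrix_matrix_mult_le order_trans)
  also have "\<dots> \<le> (2 * c) * (2 * c * \<bar>\<eta>\<bar>) * (2 * c * \<bar>\<eta>\<bar>)"
    using c B E by (intro mult_mono) auto
  also have "\<dots> = 8 * c ^ 3 * \<eta>\<^sup>2"
    by (simp add: power2_eq_square power3_eq_cube)
  also have "c * \<eta>\<^sup>2 \<le> c ^ 3 * \<eta>\<^sup>2"
    using c by (intro mult_right_mono) (auto simp: self_le_power)
  finally have "norm (?B - mat 1 - \<eta> *\<^sub>R (- G)) \<le> 9 * c ^ 3 * \<eta>\<^sup>2" by (simp add: algebra_simps)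
  moreover have "c \<le> 9 * c ^ 3" using c self_le_power[of c 3] by linarith
  ultimately show "expansion \<eta> (9 * c ^ 3) ?B (mat 1) (- G)"
    using cI cG unfolding expansion_def by auto
qed

lemma expansion_inverse:
  fixes x t :: real
  assumes \<eta>: "\<bar>\<eta>\<bar> \<le> 1" and x: "expansion \<eta> c x 1 t" and small: "4 * c * \<bar>\<eta>\<bar> \<le> 1"
  shows "1 / 2 \<le> x" and "expansion \<eta> (9 * c ^ 3) (inverse x) 1 (- t)"
proof -
  define e where "e = x - 1"
  have c: "1 \<le> c" and ct: "\<bar>t\<bar> \<le> c" and ce: "\<bar>e - \<eta> * t\<bar> \<le> c * \<eta>\<^sup>2"
    using x by (auto simp: expansion_def e_def)
  have e: "\<bar>e\<bar> \<le> 2 * c * \<bar>\<eta>\<bar>"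
    using expansion_norm_le(2)[OF x \<eta>] by (simp add: e_def)
  then show x2: "1 / 2 \<le> x" using small unfolding e_def by linarith
  then have "inverse x \<le> 2" using le_imp_inverse_le[of "1/2" x] by simp
  moreover have "inverse x - 1 - \<eta> * (- t) = inverse x * (e * e) - (e - \<eta> * t)"
    using x2 by (simp add: e_def field_simps)
  moreover have "\<bar>inverse x * (e * e)\<bar> \<le> 2 * ((2 * c * \<bar>\<eta>\<bar>) * (2 * c * \<bar>\<eta>\<bar>))"
    unfolding abs_mult using calculation(1) x2 e c by (intro mult_mono) auto
  moreover have "2 * ((2 * c * \<bar>\<eta>\<bar>) * (2 * c * \<bar>\<eta>\<bar>)) = 8 * c\<^sup>2 * \<eta>\<^sup>2"
    by (simp add: power2_eq_square)
  ultimately have "\<bar>inverse x - 1 - \<eta> * (- t)\<bar> \<le> 8 * c\<^sup>2 * \<eta>\<^sup>2 + c * \<eta>\<^sup>2"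
    using ce by linarith
  also have "\<dots> \<le> 8 * c ^ 3 * \<eta>\<^sup>2 + c ^ 3 * \<eta>\<^sup>2"
    using c by (intro add_mono mult_right_mono mult_left_mono) (auto simp: self_le_power power_increasing)
  finally have "\<bar>inverse x - 1 - \<eta> * (- t)\<bar> \<le> 9 * c ^ 3 * \<eta>\<^sup>2" by (simp add: algebra_simps)
  moreover have "c \<le> 9 * c ^ 3" using c self_le_power[of c 3] by linarith
  ultimately show "expansion \<eta> (9 * c ^ 3) (inverse x) 1 (- t)"
    using c ct unfolding expansion_def by auto
qed

section \<open>Essentially bounded fields\<close>

text \<open>Essentially bounded measurable fields. All coefficients and gradients that occur are of
  this kind, so that over a finite measure every integrand built from them is integrable.\<close>

definition ess_bounded :: "'a measure \<Rightarrow> ('a \<Rightarrow> 'b::real_normed_vector) \<Rightarrow> bool" where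
  "ess_bounded \<mu> f \<longleftrightarrow> f \<in> borel_measurable \<mu> \<and> (\<exists>C. AE x in \<mu>. norm (f x) \<le> C)"

lemma ess_boundedI: "f \<in> borel_measurable \<mu> \<Longrightarrow> AE x in \<mu>. norm (f x) \<le> C \<Longrightarrow> ess_bounded \<mu> f"
  unfolding ess_bounded_def by blast

named_theorems ess_bounded_intros

lemma ess_bounded_const [ess_bounded_intros]: "ess_bounded \<mu> (\<lambda>x. a)"
  by (rule ess_boundedI[of _ _ "norm a"]) auto

lemma ess_bounded_linear:
  fixes g :: "'b::real_normed_vector \<Rightarrow> 'c::real_normed_vector"
  assumes "bounded_linear g" "ess_bounded \<mu> f"
  shows "ess_bounded \<mu> (\<lambda>x. g (f x))"
proof -
  interpret bounded_linear g by (rule assms(1))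
  obtain K where K: "\<And>x. norm (g x) \<le> norm x * K" "K \<ge> 0"
    using nonneg_bounded by blast
  obtain C where "AE x in \<mu>. norm (f x) \<le> C"
    using assms(2) unfolding ess_bounded_def by blast
  then have "AE x in \<mu>. norm (g (f x)) \<le> C * K"
    by eventually_elim (meson K mult_right_mono order_trans)
  moreover have "(\<lambda>x. g (f x)) \<in> borel_measurable \<mu>"
    using assms(2) borel_measurable_continuous_on[OF continuous_on_id[THEN continuous_on, of UNIV]]
    unfolding ess_bounded_def by blast
  ultimately show ?thesis by (rule ess_boundedI[rotated])
qed

lemma ess_bounded_bilinear:
  fixes g :: "'b::{real_normed_vector, second_countable_topology} \<Rightarrow>
    'c::{real_normed_vector, second_countable_topology} \<Rightarrow> 'd::real_normed_vector"
  assumes "bounded_bilinear g" "ess_bounded \<mu> f" "ess_bounded \<mu> f'"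
  shows "ess_bounded \<mu> (\<lambda>x. g (f x) (f' x))"
proof -
  interpret bounded_bilinear g by (rule assms(1))
  obtain K where K: "\<And>x y. norm (g x y) \<le> norm x * norm y * K" "K \<ge> 0"
    using nonneg_bounded by blast
  obtain C C' where "AE x in \<mu>. norm (f x) \<le> C" "AE x in \<mu>. norm (f' x) \<le> C'"
    using assms(2,3) unfolding ess_bounded_def by blast
  then have "AE x in \<mu>. norm (g (f x) (f' x)) \<le> C * C' * K"
  proof eventually_elim
    case (elim x)
    have "norm (f x) * norm (f' x) * K \<le> C * C' * K"
      using elim K(2) by (intro mult_mono mult_right_mono) (auto intro: order_trans[OF norm_ge_zero])
    then show ?case using K(1) order_trans by blast
  qed
  moreover have "(\<lambda>x. g (f x) (f' x)) \<in> borel_measurable \<mu>"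
    using assms(2,3) unfolding ess_bounded_def
    by (intro borel_measurable_continuous_Pair[OF _ _
          continuous_on[OF continuous_on_fst[OF continuous_on_id] continuous_on_snd[OF continuous_on_id]]])
      simp_all
  ultimately show ?thesis by (rule ess_boundedI[rotated])
qed

lemma ess_bounded_add [ess_bounded_intros]:
  fixes f g :: "'a \<Rightarrow> 'b::{real_normed_vector, second_countable_topology}"
  assumes "ess_bounded \<mu> f" "ess_bounded \<mu> g"
  shows "ess_bounded \<mu> (\<lambda>x. f x + g x)"
proof -
  obtain C C' where "AE x in \<mu>. norm (f x) \<le> C" "AE x in \<mu>. norm (g x) \<le> C'"
    using assms unfolding ess_bounded_def by blast
  then have "AE x in \<mu>. norm (f x + g x) \<le> C + C'"
    by eventually_elim (rule norm_triangle_mono)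
  then show ?thesis
    using assms unfolding ess_bounded_def by (auto intro: borel_measurable_add)
qed

lemmas [ess_bounded_intros] =
  ess_bounded_bilinear[OF bounded_bilinear_matrix_vector_mult]
  ess_bounded_bilinear[OF bounded_bilinear_inner]
  ess_bounded_bilinear[OF bounded_bilinear_scaleR]
  ess_bounded_bilinear[OF bounded_bilinear_mult]

lemma ess_bounded_minus [ess_bounded_intros]: "ess_bounded \<mu> f \<Longrightarrow> ess_bounded \<mu> (\<lambda>x. - f x)"
  by (rule ess_bounded_linear[OF bounded_linear_minus[OF bounded_linear_ident]])

lemma ess_bounded_diff [ess_bounded_intros]:
  fixes f g :: "'a \<Rightarrow> 'b::{real_normed_vector, second_countable_topology}"
  shows "ess_bounded \<mu> f \<Longrightarrow> ess_bounded \<mu> g \<Longrightarrow> ess_bounded \<mu> (\<lambda>x. f x - g x)"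
  using ess_bounded_add[OF _ ess_bounded_minus, of \<mu> f g] by simp

lemma ess_bounded_norm [ess_bounded_intros]: "ess_bounded \<mu> f \<Longrightarrow> ess_bounded \<mu> (\<lambda>x. norm (f x))"
  unfolding ess_bounded_def by auto

lemma ess_bounded_power2 [ess_bounded_intros]:
  "ess_bounded \<mu> f \<Longrightarrow> ess_bounded \<mu> (\<lambda>x. (f x :: real)\<^sup>2)"
  unfolding power2_eq_square by (intro ess_bounded_intros)

lemma ess_bounded_transpose [ess_bounded_intros]:
  fixes f :: "'a \<Rightarrow> real^'n^'m"
  shows "ess_bounded \<mu> f \<Longrightarrow> ess_bounded \<mu> (\<lambda>x. transpose (f x))"
  by (rule ess_bounded_linear)
    (simp_all add: linear_conv_bounded_linear[symmetric] linear_iff transpose_def vec_eq_iff)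

lemma linear_trace: "linear (trace :: real^'n^'n \<Rightarrow> real)"
  by (simp add: linear_iff trace_def sum.distrib sum_distrib_left)

lemma ess_bounded_trace [ess_bounded_intros]:
  fixes f :: "'a \<Rightarrow> real^'n^'n"
  shows "ess_bounded \<mu> f \<Longrightarrow> ess_bounded \<mu> (\<lambda>x. trace (f x))"
  by (rule ess_bounded_linear) (simp_all add: linear_conv_bounded_linear[symmetric] linear_trace)

lemma mat_eq_scaleR: "mat t = t *\<^sub>R (mat 1 :: real^'n^'n)"
  by (simp add: mat_def vec_eq_iff)

lemma ess_bounded_mat [ess_bounded_intros]:
  fixes f :: "'a \<Rightarrow> real"
  shows "ess_bounded \<mu> f \<Longrightarrow> ess_bounded \<mu> (\<lambda>x. mat (f x) :: real^'n^'n)"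
proof -
  have "(\<lambda>x. mat (f x) :: real^'n^'n) = (\<lambda>x. f x *\<^sub>R mat 1)"
    by (rule ext, rule mat_eq_scaleR)
  moreover assume "ess_bounded \<mu> f"
  ultimately show "ess_bounded \<mu> (\<lambda>x. mat (f x) :: real^'n^'n)"
    by (simp only:) (intro ess_bounded_intros)
qed

lemma (in finite_measure) integrable_ess_bounded:
  fixes f :: "'a \<Rightarrow> 'b::{banach, second_countable_topology}"
  shows "ess_bounded M f \<Longrightarrow> integrable M f"
  unfolding ess_bounded_def using integrable_const_bound by blast

text \<open>Averaging preserves expansions; here \<open>V\<close> stands for the reciprocal of the volume.\<close>

lemma (in finite_measure) expansion_average:
  fixes f :: "'a \<Rightarrow> 'b::{banach, second_countable_topology}"
  assumes ex: "AE x in M. expansion \<eta> (k x) (f x) (f\<^sub>0 x) (f\<^sub>1 x)"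
    and [simp]: "integrable M k" "integrable M f" "integrable M f\<^sub>0" "integrable M f\<^sub>1"
    and V: "V \<ge> 0"
  shows "expansion \<eta> (V * (\<integral>x. k x \<partial>M)) (V *\<^sub>R (\<integral>x. f x \<partial>M)) (V *\<^sub>R (\<integral>x. f\<^sub>0 x \<partial>M)) (V *\<^sub>R (\<integral>x. f\<^sub>1 x \<partial>M))"
proof -
  have le: "norm (V *\<^sub>R (\<integral>x. g x \<partial>M)) \<le> V * (\<integral>x. h x \<partial>M)"
    if "integrable M g" "integrable M h" "AE x in M. norm (g x) \<le> h x" for g :: "'a \<Rightarrow> 'b" and h
  proof -
    have "norm (\<integral>x. g x \<partial>M) \<le> (\<integral>x. norm (g x) \<partial>M)" by simp
    also have "\<dots> \<le> (\<integral>x. h x \<partial>M)" using that by (intro integral_mono_AE) auto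
    finally show ?thesis using V by (simp add: mult_left_mono)
  qed
  have "norm (V *\<^sub>R (\<integral>x. f x - f\<^sub>0 x - \<eta> *\<^sub>R f\<^sub>1 x \<partial>M)) \<le> V * (\<integral>x. k x * \<eta>\<^sup>2 \<partial>M)"
    using ex by (intro le) (auto simp: expansion_def)
  moreover have "V *\<^sub>R (\<integral>x. f x - f\<^sub>0 x - \<eta> *\<^sub>R f\<^sub>1 x \<partial>M)
      = V *\<^sub>R (\<integral>x. f x \<partial>M) - V *\<^sub>R (\<integral>x. f\<^sub>0 x \<partial>M) - \<eta> *\<^sub>R (V *\<^sub>R (\<integral>x. f\<^sub>1 x \<partial>M))"
    by (simp add: scaleR_diff_right)
  moreover have "norm (V *\<^sub>R (\<integral>x. f\<^sub>0 x \<partial>M)) \<le> V * (\<integral>x. k x \<partial>M)"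
    using ex by (intro le) (auto simp: expansion_def)
  moreover have "norm (V *\<^sub>R (\<integral>x. f\<^sub>1 x \<partial>M)) \<le> V * (\<integral>x. k x \<partial>M)"
    using ex by (intro le) (auto simp: expansion_def)
  moreover have "V * (\<integral>x. k x * \<eta>\<^sup>2 \<partial>M) = V * (\<integral>x. k x \<partial>M) * \<eta>\<^sup>2"
    by simp
  ultimately show ?thesis unfolding expansion_def by metis
qed

text \<open>The basic energy estimate. The field \<open>X\<close> stands for the flux of \<open>v\<close> and \<open>Z\<close> for the data;
  Young's inequality absorbs half of the energy of \<open>v\<close>.\<close>

lemma (in finite_measure) energy_estimate:
  fixes X Z v :: "'a \<Rightarrow> real^'n"
  assumes b: "ess_bounded M X" "ess_bounded M Z" "ess_bounded M v"
    and coercive: "AE x in M. k * (norm (v x))\<^sup>2 \<le> X x \<bullet> v x" and k: "k > 0"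
    and eq: "(\<integral>x. X x \<bullet> v x \<partial>M) + (\<integral>x. Z x \<bullet> v x \<partial>M) = 0"
  shows "(\<integral>x. (norm (v x))\<^sup>2 \<partial>M) \<le> (\<integral>x. (norm (Z x))\<^sup>2 \<partial>M) / k\<^sup>2"
proof -
  note I = integrable_ess_bounded and bI = ess_bounded_intros b
  have "k * (\<integral>x. (norm (v x))\<^sup>2 \<partial>M) = (\<integral>x. k * (norm (v x))\<^sup>2 \<partial>M)" by simp
  also have "\<dots> \<le> (\<integral>x. X x \<bullet> v x \<partial>M)"
    by (intro integral_mono_AE coercive I bI)
  also have "\<dots> = (\<integral>x. - (Z x \<bullet> v x) \<partial>M)" using eq by simp
  also have "\<dots> \<le> (\<integral>x. (norm (Z x))\<^sup>2 * inverse (2 * k) + k / 2 * (norm (v x))\<^sup>2 \<partial>M)"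
  proof (intro integral_mono I bI)
    fix x
    have "- (Z x \<bullet> v x) \<le> norm (Z x) * norm (v x)"
      using Cauchy_Schwarz_ineq2[of "Z x" "v x"] by linarith
    also have "\<dots> \<le> (norm (Z x))\<^sup>2 * inverse (2 * k) + k / 2 * (norm (v x))\<^sup>2"
      using k zero_le_power2[of "norm (Z x) - k * norm (v x)"]
      by (simp add: field_simps power2_eq_square)
    finally show "- (Z x \<bullet> v x) \<le> \<dots>" .
  qed
  also have "\<dots> = (\<integral>x. (norm (Z x))\<^sup>2 \<partial>M) * inverse (2 * k) + k / 2 * (\<integral>x. (norm (v x))\<^sup>2 \<partial>M)"
  proof -
    have "integrable M (\<lambda>x. (norm (Z x))\<^sup>2)" "integrable M (\<lambda>x. (norm (v x))\<^sup>2)"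
      by (intro I bI)+
    then show ?thesis by simp
  qed
  finally show ?thesis using k by (simp add: field_simps power2_eq_square)
qed

section \<open>The perturbed cell problem\<close>

lemma inner_matrix_vector_mult: "x \<bullet> (A *v y) = (transpose A *v x) \<bullet> y"
  for A :: "real^'n^'m"
  by (simp add: dot_lmul_matrix transpose_matrix_vector)

text \<open>The expansion of the transported flux at the gradient \<open>u\<^sub>0 + \<eta> u\<^sub>1\<close>. Its coefficients are
  exactly the fluxes in the equations of the unperturbed and of the first-order corrector. Here
  \<open>D\<close> and \<open>B\<close> stand for the determinant and the inverse of the gradient of the
  diffeomorphism, and \<open>G\<close> for the gradient of its first-order part.\<close>

lemma expansion_flux:
  fixes A B G :: "real^'n^'n"
  assumes \<eta>: "\<bar>\<eta>\<bar> \<le> 1" and c: "1 \<le> c" and A: "norm A \<le> c" and p: "norm p \<le> 1"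
    and D: "expansion \<eta> c D 1 t" and B: "expansion \<eta> c B (mat 1) (- G)"
  shows "expansion \<eta> (1296 * c ^ 4 * (1 + norm u\<^sub>0 + norm u\<^sub>1))
    (D *\<^sub>R (transpose B *v (A *v (p + B *v (u\<^sub>0 + \<eta> *\<^sub>R u\<^sub>1)))))
    (A *v (p + u\<^sub>0))
    ((mat t - transpose G) *v (A *v (p + u\<^sub>0)) + A *v (u\<^sub>1 - G *v u\<^sub>0))"
proof -
  define g where "g = 1 + norm u\<^sub>0 + norm u\<^sub>1"
  have "expansion \<eta> (norm u\<^sub>0 + norm u\<^sub>1) (u\<^sub>0 + \<eta> *\<^sub>R u\<^sub>1) u\<^sub>0 u\<^sub>1"
    by (simp add: expansion_def)
  note expansion_matrix_vector_mult[OF \<eta> B this]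
  then have "expansion \<eta> (6 * c * g) (p + B *v (u\<^sub>0 + \<eta> *\<^sub>R u\<^sub>1))
      (p + mat 1 *v u\<^sub>0) (0 + (- G *v u\<^sub>0 + mat 1 *v u\<^sub>1))"
  proof (rule expansion_mono[OF expansion_add[OF expansion_const[OF p]]])
    show "1 + 6 * c * (norm u\<^sub>0 + norm u\<^sub>1) \<le> 6 * c * g"
      using c unfolding g_def by (simp add: algebra_simps)
  qed
  note expansion_matrix_vector_mult[OF \<eta> expansion_const[OF A] this]
  note expansion_matrix_vector_mult[OF \<eta> expansion_transpose[OF B] this]
  note expansion_scaleR[OF \<eta> D this]
  moreover have "mat t *v y = t *\<^sub>R y" for y :: "real^'n"
    by (simp add: mat_eq_scaleR[of t] scaleR_matrix_vector_assoc[symmetric])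
  moreover have "transpose (- G) *v y = - (transpose G *v y)" "- G *v y = - (G *v y)" for y
    by (simp_all add: vec_eq_iff matrix_vector_mult_def transpose_def sum_negf)
  ultimately show ?thesis
    unfolding g_def
    by (simp add: transpose_mat matrix_vector_mult_diff_rdistrib matrix_vector_mult_diff_distrib
        algebra_simps power4_eq_xxxx)
qed

text \<open>The same expansion for the integrand that defines an entry of the homogenized matrix.\<close>

lemma expansion_energy:
  fixes A B G :: "real^'n^'n"
  assumes \<eta>: "\<bar>\<eta>\<bar> \<le> 1" and c: "1 \<le> c"
    and D: "expansion \<eta> c D 1 t" and B: "expansion \<eta> c B (mat 1) (- G)"
    and e: "norm e \<le> 1" and a: "norm a \<le> c"
  shows "expansion \<eta> (216 * c ^ 3 * (1 + norm u\<^sub>0 + norm u\<^sub>1))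
     (D * ((e + B *v (u\<^sub>0 + \<eta> *\<^sub>R u\<^sub>1)) \<bullet> a))
     ((e + u\<^sub>0) \<bullet> a)
     (t * ((e + u\<^sub>0) \<bullet> a) + (u\<^sub>1 - G *v u\<^sub>0) \<bullet> a)"
proof -
  define g where "g = 1 + norm u\<^sub>0 + norm u\<^sub>1"
  have "expansion \<eta> (norm u\<^sub>0 + norm u\<^sub>1) (u\<^sub>0 + \<eta> *\<^sub>R u\<^sub>1) u\<^sub>0 u\<^sub>1"
    by (simp add: expansion_def)
  note expansion_matrix_vector_mult[OF \<eta> B this]
  then have "expansion \<eta> (6 * c * g) (e + B *v (u\<^sub>0 + \<eta> *\<^sub>R u\<^sub>1))
      (e + mat 1 *v u\<^sub>0) (0 + (- G *v u\<^sub>0 + mat 1 *v u\<^sub>1))"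
  proof (rule expansion_mono[OF expansion_add[OF expansion_const[OF e]]])
    show "1 + 6 * c * (norm u\<^sub>0 + norm u\<^sub>1) \<le> 6 * c * g"
      using c unfolding g_def by (simp add: algebra_simps)
  qed
  note expansion_inner[OF \<eta> this expansion_const[OF a]]
  note expansion_scaleR[OF \<eta> D this]
  moreover have "- G *v y = - (G *v y)" for y
    by (simp add: vec_eq_iff matrix_vector_mult_def sum_negf)
  ultimately show ?thesis
    unfolding g_def by (simp add: algebra_simps power3_eq_cube)
qed

text \<open>A common constant for the expansions of the determinant of an \<open>n \<times> n\<close> matrix and of the
  inverses of the matrix and of its determinant, where \<open>b\<close> is the constant in the expansion of
  the matrix itself. The four constants below are explicit functions of the bound \<open>c\<close> and of the
  ellipticity constant \<open>\<gamma>\<close>; this is what makes them independent of the mesh, the cube, the event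
  and \<open>\<eta>\<close>.\<close>

definition coeff_bound :: "nat \<Rightarrow> real \<Rightarrow> real" where
  "coeff_bound n b = 9 * (fact n * (6 * b) ^ n) ^ 3"

lemma coeff_bound_ge:
  assumes "1 \<le> b" "0 < n"
  shows "b \<le> fact n * (6 * b) ^ n" "1 \<le> fact n * (6 * b) ^ n"
    "fact n * (6 * b) ^ n \<le> coeff_bound n b" "9 * b ^ 3 \<le> coeff_bound n b"
proof -
  have "6 * b \<le> (6 * b) ^ n" using assms by (intro self_le_power) auto
  moreover have "(6 * b) ^ n \<le> fact n * (6 * b) ^ n"
    using mult_right_mono[OF fact_ge_1[of n], of "(6 * b) ^ n"] assms by simp
  ultimately show b: "b \<le> fact n * (6 * b) ^ n" using assms by linarith
  then show 1: "1 \<le> fact n * (6 * b) ^ n" using assms by linarith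
  then show "fact n * (6 * b) ^ n \<le> coeff_bound n b"
    using self_le_power[OF 1, of 3] unfolding coeff_bound_def by linarith
  show "9 * b ^ 3 \<le> coeff_bound n b"
    using power_mono[OF b, of 3] assms unfolding coeff_bound_def by linarith
qed

text \<open>Bound for the mean square of the gradient of the unperturbed corrector.\<close>

definition energy_bound_0 :: "real \<Rightarrow> real \<Rightarrow> real" where
  "energy_bound_0 c \<gamma> = (c / \<gamma>)\<^sup>2"

text \<open>Bound for the mean square of the gradient of the first-order corrector.\<close>

definition energy_bound_1 :: "real \<Rightarrow> real \<Rightarrow> real" where
  "energy_bound_1 c \<gamma> = 18 * c ^ 4 * (1 + energy_bound_0 c \<gamma>) / \<gamma>\<^sup>2"

text \<open>Bound for the mean square of the corrector remainder, divided by \<open>\<eta> ^ 4\<close>.\<close>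

definition remainder_bound :: "real \<Rightarrow> real \<Rightarrow> real" where
  "remainder_bound c \<gamma> =
     3 * (1296 * c ^ 4)\<^sup>2 * (1 + energy_bound_0 c \<gamma> + energy_bound_1 c \<gamma>) / (\<gamma> / (18 * c\<^sup>2))\<^sup>2"

text \<open>Bound for the remainder of one entry of the homogenized matrix, divided by \<open>\<eta>\<^sup>2\<close>.\<close>

definition entry_bound :: "real \<Rightarrow> real \<Rightarrow> real" where
  "entry_bound c \<gamma> = 6 * c * (216 * c ^ 3 * (3 + energy_bound_0 c \<gamma> + energy_bound_1 c \<gamma>)
     + 9 * c ^ 3 * (1 + remainder_bound c \<gamma>))"

text \<open>The cell problem at a fixed event, over an arbitrary finite measure. The field \<open>F\<close> is the
  gradient of the diffeomorphism, \<open>G\<close> that of its first-order part, and \<open>W\<close> is the set of gradients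
  of test functions. No linear structure of \<open>W\<close> is required: the equations are tested with the
  correctors themselves and the results are combined linearly.\<close>

locale perturbed_cell = finite_measure \<mu> for \<mu> :: "'a measure" +
  fixes A F G :: "'a \<Rightarrow> real^'n^'n" and W :: "('a \<Rightarrow> real^'n) set" and \<eta> b c \<gamma> :: real
  assumes nontrivial: "measure \<mu> (space \<mu>) > 0"
    and bdd: "ess_bounded \<mu> A" "ess_bounded \<mu> F" "ess_bounded \<mu> G"
      "ess_bounded \<mu> (\<lambda>x. det (F x))" "ess_bounded \<mu> (\<lambda>x. matrix_inv (F x))"
    and W_bdd: "\<And>\<phi>. \<phi> \<in> W \<Longrightarrow> ess_bounded \<mu> \<phi>"
    and A_sym: "AE x in \<mu>. transpose (A x) = A x"
    and A_coercive: "AE x in \<mu>. \<forall>\<xi>. \<gamma> * (norm \<xi>)\<^sup>2 \<le> \<xi> \<bullet> (A x *v \<xi>)"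
    and A_le: "AE x in \<mu>. norm (A x) \<le> b"
    and F_expansion: "AE x in \<mu>. expansion \<eta> b (F x) (mat 1) (G x)"
    and \<gamma>: "\<gamma> > 0" and b: "1 \<le> b" and \<eta>: "\<eta> \<noteq> 0" "\<bar>\<eta>\<bar> \<le> 1"
    and small: "4 * c * \<bar>\<eta>\<bar> \<le> 1"
    and c_def: "c = coeff_bound CARD('n) b"
begin

abbreviation "D x \<equiv> det (F x)"
abbreviation "B x \<equiv> matrix_inv (F x)"
abbreviation "vol \<equiv> measure \<mu> (space \<mu>)"

text \<open>Mean values, the transported flux, and the weak equations of the three correctors,
  expressed through the gradients of the correctors.\<close>

definition avg :: "('a \<Rightarrow> 'b::{banach, second_countable_topology}) \<Rightarrow> 'b" where
  "avg f = (1 / vol) *\<^sub>R (\<integral>x. f x \<partial>\<mu>)"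

definition flux :: "real^'n \<Rightarrow> ('a \<Rightarrow> real^'n) \<Rightarrow> 'a \<Rightarrow> real^'n" where
  "flux p u x = D x *\<^sub>R (transpose (B x) *v (A x *v (p + B x *v u x)))"

definition solves_\<eta> :: "real^'n \<Rightarrow> ('a \<Rightarrow> real^'n) \<Rightarrow> bool" where
  "solves_\<eta> p u \<longleftrightarrow> u \<in> W \<and> (\<forall>\<phi>\<in>W. (\<integral>x. flux p u x \<bullet> \<phi> x \<partial>\<mu>) = 0)"

definition solves_0 :: "real^'n \<Rightarrow> ('a \<Rightarrow> real^'n) \<Rightarrow> bool" where
  "solves_0 p u\<^sub>0 \<longleftrightarrow> u\<^sub>0 \<in> W \<and> (\<forall>\<phi>\<in>W. (\<integral>x. (A x *v (p + u\<^sub>0 x)) \<bullet> \<phi> x \<partial>\<mu>) = 0)"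

definition solves_1 :: "real^'n \<Rightarrow> ('a \<Rightarrow> real^'n) \<Rightarrow> ('a \<Rightarrow> real^'n) \<Rightarrow> bool" where
  "solves_1 p u\<^sub>0 u\<^sub>1 \<longleftrightarrow> u\<^sub>1 \<in> W \<and>
     (\<forall>\<phi>\<in>W. (\<integral>x. (A x *v u\<^sub>1 x) \<bullet> \<phi> x \<partial>\<mu>) - (\<integral>x. (A x *v (G x *v u\<^sub>0 x)) \<bullet> \<phi> x \<partial>\<mu>)
        + (\<integral>x. ((mat (trace (G x)) - transpose (G x)) *v (A x *v (p + u\<^sub>0 x))) \<bullet> \<phi> x \<partial>\<mu>) = 0)"

lemmas integrableI = integrable_ess_bounded
declare bdd [ess_bounded_intros]

lemma c_ge: "b \<le> c" "1 \<le> c" "fact CARD('n) * (6 * b) ^ CARD('n) \<le> c" "9 * b ^ 3 \<le> c"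
  using coeff_bound_ge[OF b, of "CARD('n)"] b by (auto simp: c_def)

lemma b_small: "4 * b * \<bar>\<eta>\<bar> \<le> 1"
proof -
  have "4 * b * \<bar>\<eta>\<bar> \<le> 4 * c * \<bar>\<eta>\<bar>" using c_ge(1) by (intro mult_right_mono mult_left_mono) auto
  then show ?thesis using small by linarith
qed

lemma AE_D: "AE x in \<mu>. expansion \<eta> c (D x) 1 (trace (G x))"
  using F_expansion by eventually_elim (rule expansion_mono[OF expansion_det[OF \<eta>(2)] c_ge(3)])

lemma AE_D_ge: "AE x in \<mu>. 1 / 2 \<le> D x"
  using AE_D by eventually_elim (rule expansion_inverse(1)[OF \<eta>(2) _ small])

lemma AE_B: "AE x in \<mu>. expansion \<eta> c (B x) (mat 1) (- G x)"
  using F_expansion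
  by eventually_elim (rule expansion_mono[OF expansion_matrix_inv(2)[OF \<eta>(2) _ b_small] c_ge(4)])

lemma AE_A: "AE x in \<mu>. norm (A x) \<le> c"
  using A_le by eventually_elim (use c_ge(1) in linarith)

lemma bdd_flux: "ess_bounded \<mu> u \<Longrightarrow> ess_bounded \<mu> (\<lambda>x. flux p u x)"
  unfolding flux_def by (intro ess_bounded_intros)

text \<open>Since \<open>v = F (B v)\<close>, the norm of \<open>v\<close> is at most \<open>3 c\<close> times that of \<open>B v\<close>; together with the lower
  bound one half for the determinant this gives the factor 18.\<close>

lemma flux_coercive:
  "AE x in \<mu>. \<gamma> / (18 * c\<^sup>2) * (norm (v x))\<^sup>2 \<le> flux 0 v x \<bullet> v x"
  using F_expansion AE_D_ge A_coercive
proof eventually_elim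
  case (elim x)
  define y where "y = B x *v v x"
  have near: "norm (F x - mat 1) \<le> 1 / 2"
    by (rule expansion_matrix_inv(1)[OF \<eta>(2) elim(1) b_small])
  have "F x *v y = v x"
    using matrix_inv_mult(1)[OF near] by (simp add: y_def matrix_vector_mul_assoc)
  then have "norm (v x) \<le> norm (F x) * norm y"
    using norm_matrix_vector_mult_le[of "F x" y] by simp
  also have "\<dots> \<le> 3 * c * norm y"
    using expansion_norm_le(1)[OF elim(1) \<eta>(2)] c_ge(1) by (intro mult_right_mono) auto
  finally have "(norm (v x))\<^sup>2 \<le> (3 * c * norm y)\<^sup>2" by (intro power_mono) auto
  then have "\<gamma> / (18 * c\<^sup>2) * (norm (v x))\<^sup>2 \<le> \<gamma> / (18 * c\<^sup>2) * (3 * c * norm y)\<^sup>2"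
    using \<gamma> by (intro mult_left_mono) auto
  also have "\<dots> = 1 / 2 * (\<gamma> * (norm y)\<^sup>2)"
    using c_ge(2) by (simp add: power_mult_distrib)
  also have "\<dots> \<le> D x * (y \<bullet> (A x *v y))"
    using elim(2,3) \<gamma> by (intro mult_mono) auto
  also have "\<dots> = flux 0 v x \<bullet> v x"
    by (simp only: flux_def inner_scaleR_left add_0 y_def[symmetric] inner_commute[of y]
        inner_matrix_vector_mult[of "A x *v y" "B x" "v x", symmetric])
  finally show ?case .
qed

lemma solves_0_bound:
  assumes u\<^sub>0: "solves_0 p u\<^sub>0" and p: "norm p \<le> 1"
  shows "(\<integral>x. (norm (u\<^sub>0 x))\<^sup>2 \<partial>\<mu>) \<le> energy_bound_0 c \<gamma> * vol"
proof -
  have [ess_bounded_intros]: "ess_bounded \<mu> u\<^sub>0"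
    using u\<^sub>0 W_bdd by (auto simp: solves_0_def)
  have "(\<integral>x. (A x *v (p + u\<^sub>0 x)) \<bullet> u\<^sub>0 x \<partial>\<mu>) = 0"
    using u\<^sub>0 by (auto simp: solves_0_def)
  moreover have "(\<integral>x. (A x *v (p + u\<^sub>0 x)) \<bullet> u\<^sub>0 x \<partial>\<mu>)
      = (\<integral>x. (A x *v u\<^sub>0 x) \<bullet> u\<^sub>0 x \<partial>\<mu>) + (\<integral>x. (A x *v p) \<bullet> u\<^sub>0 x \<partial>\<mu>)"
    unfolding matrix_vector_right_distrib inner_add_left add.commute[of "(A _ *v p) \<bullet> _"]
    by (intro Bochner_Integration.integral_add integrableI ess_bounded_intros)
  moreover have "AE x in \<mu>. \<gamma> * (norm (u\<^sub>0 x))\<^sup>2 \<le> (A x *v u\<^sub>0 x) \<bullet> u\<^sub>0 x"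
    using A_coercive by eventually_elim (simp add: inner_commute)
  ultimately have "(\<integral>x. (norm (u\<^sub>0 x))\<^sup>2 \<partial>\<mu>) \<le> (\<integral>x. (norm (A x *v p))\<^sup>2 \<partial>\<mu>) / \<gamma>\<^sup>2"
    by (intro energy_estimate[where X = "\<lambda>x. A x *v u\<^sub>0 x"] \<gamma> ess_bounded_intros) auto
  also have "(\<integral>x. (norm (A x *v p))\<^sup>2 \<partial>\<mu>) \<le> (\<integral>x. c\<^sup>2 \<partial>\<mu>)"
  proof (intro integral_mono_AE integrableI ess_bounded_intros)
    show "AE x in \<mu>. (norm (A x *v p))\<^sup>2 \<le> c\<^sup>2"
      using AE_A
    proof eventually_elim
      case (elim x)
      have "norm (A x) * norm p \<le> c * 1" using elim p c_ge(2) by (intro mult_mono) auto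
      then show ?case
        using norm_matrix_vector_mult_le[of "A x" p] by (intro power_mono) auto
    qed
  qed
  finally show ?thesis
    using \<gamma> by (simp add: energy_bound_0_def power_divide divide_right_mono mult.commute)
qed

lemma solves_1_bound:
  assumes u\<^sub>0: "solves_0 p u\<^sub>0" and u\<^sub>1: "solves_1 p u\<^sub>0 u\<^sub>1" and p: "norm p \<le> 1"
  shows "(\<integral>x. (norm (u\<^sub>1 x))\<^sup>2 \<partial>\<mu>) \<le> energy_bound_1 c \<gamma> * vol"
proof -
  have [ess_bounded_intros]: "ess_bounded \<mu> u\<^sub>0" "ess_bounded \<mu> u\<^sub>1"
    using u\<^sub>0 u\<^sub>1 W_bdd by (auto simp: solves_0_def solves_1_def)
  define Z where "Z x = (mat (trace (G x)) - transpose (G x)) *v (A x *v (p + u\<^sub>0 x))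
    - A x *v (G x *v u\<^sub>0 x)" for x
  have bZ: "ess_bounded \<mu> (\<lambda>x. Z x)" unfolding Z_def by (intro ess_bounded_intros)
  have "(\<integral>x. Z x \<bullet> u\<^sub>1 x \<partial>\<mu>)
      = (\<integral>x. ((mat (trace (G x)) - transpose (G x)) *v (A x *v (p + u\<^sub>0 x))) \<bullet> u\<^sub>1 x \<partial>\<mu>)
        - (\<integral>x. (A x *v (G x *v u\<^sub>0 x)) \<bullet> u\<^sub>1 x \<partial>\<mu>)"
    unfolding Z_def inner_diff_left by (intro Bochner_Integration.integral_diff integrableI ess_bounded_intros)
  then have "(\<integral>x. (A x *v u\<^sub>1 x) \<bullet> u\<^sub>1 x \<partial>\<mu>) + (\<integral>x. Z x \<bullet> u\<^sub>1 x \<partial>\<mu>) = 0"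
    using u\<^sub>1 by (auto simp: solves_1_def)
  moreover have "AE x in \<mu>. \<gamma> * (norm (u\<^sub>1 x))\<^sup>2 \<le> (A x *v u\<^sub>1 x) \<bullet> u\<^sub>1 x"
    using A_coercive by eventually_elim (simp add: inner_commute)
  ultimately have "(\<integral>x. (norm (u\<^sub>1 x))\<^sup>2 \<partial>\<mu>) \<le> (\<integral>x. (norm (Z x))\<^sup>2 \<partial>\<mu>) / \<gamma>\<^sup>2"
    by (intro energy_estimate[where X = "\<lambda>x. A x *v u\<^sub>1 x"] \<gamma> ess_bounded_intros bZ) auto
  also have "(\<integral>x. (norm (Z x))\<^sup>2 \<partial>\<mu>) \<le> (\<integral>x. 18 * c ^ 4 * (1 + (norm (u\<^sub>0 x))\<^sup>2) \<partial>\<mu>)"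
  proof (intro integral_mono_AE integrableI ess_bounded_intros bZ)
    show "AE x in \<mu>. (norm (Z x))\<^sup>2 \<le> 18 * c ^ 4 * (1 + (norm (u\<^sub>0 x))\<^sup>2)"
      using AE_A AE_D AE_B
    proof eventually_elim
      case (elim x)
      have tG: "\<bar>trace (G x)\<bar> \<le> c" "norm (G x) \<le> c"
        using elim by (auto simp: expansion_def)
      have le: "norm (X *v y) \<le> c * k" if "norm X \<le> c" "norm y \<le> k" for X :: "real^'n^'n" and y k
        using norm_matrix_vector_mult_le[of X y] mult_mono'[OF that] by force
      let ?f = "A x *v (p + u\<^sub>0 x)"
      have f: "norm ?f \<le> c * (1 + norm (u\<^sub>0 x))"
        using p elim by (intro le norm_triangle_mono) auto
      have "Z x = trace (G x) *\<^sub>R ?f - transpose (G x) *v ?f - A x *v (G x *v u\<^sub>0 x)"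
        unfolding Z_def mat_eq_scaleR[of "trace _"] matrix_vector_mult_diff_rdistrib
          scaleR_matrix_vector_assoc[symmetric] by simp
      moreover have "norm (trace (G x) *\<^sub>R ?f) \<le> c * (c * (1 + norm (u\<^sub>0 x)))"
        unfolding norm_scaleR using tG f c_ge(2) by (intro mult_mono) auto
      moreover have "norm (transpose (G x) *v ?f) \<le> c * (c * (1 + norm (u\<^sub>0 x)))"
        by (rule le) (use tG f in \<open>auto simp: norm_transpose\<close>)
      moreover have "norm (A x *v (G x *v u\<^sub>0 x)) \<le> c * (c * (1 + norm (u\<^sub>0 x)))"
        using tG elim by (intro le) auto
      moreover have "norm (a - b' - d) \<le> norm a + norm b' + norm d" for a b' d :: "real^'n"
        by (meson add_mono norm_triangle_ineq4 order_refl order_trans)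
      ultimately have "norm (Z x) \<le> 3 * (c * (c * (1 + norm (u\<^sub>0 x))))"
        by (smt (verit))
      then have "(norm (Z x))\<^sup>2 \<le> (3 * (c * (c * (1 + norm (u\<^sub>0 x)))))\<^sup>2"
        by (intro power_mono) auto
      also have "\<dots> = 9 * c ^ 4 * (1 + norm (u\<^sub>0 x))\<^sup>2"
        by (simp add: power2_eq_square power4_eq_xxxx)
      also have "\<dots> \<le> 9 * c ^ 4 * (2 * (1 + (norm (u\<^sub>0 x))\<^sup>2))"
      proof (rule mult_left_mono)
        show "(1 + norm (u\<^sub>0 x))\<^sup>2 \<le> 2 * (1 + (norm (u\<^sub>0 x))\<^sup>2)"
          using zero_le_power2[of "1 - norm (u\<^sub>0 x)"] by (simp add: power2_eq_square algebra_simps)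
      qed simp
      finally show ?case by (simp add: algebra_simps)
    qed
  qed
  also have "(\<integral>x. 18 * c ^ 4 * (1 + (norm (u\<^sub>0 x))\<^sup>2) \<partial>\<mu>)
      = 18 * c ^ 4 * (vol + (\<integral>x. (norm (u\<^sub>0 x))\<^sup>2 \<partial>\<mu>))"
  proof -
    have "integrable \<mu> (\<lambda>x. (norm (u\<^sub>0 x))\<^sup>2)" by (intro integrableI ess_bounded_intros)
    then show ?thesis by simp
  qed
  also have "\<dots> \<le> 18 * c ^ 4 * (vol + energy_bound_0 c \<gamma> * vol)"
    using solves_0_bound[OF u\<^sub>0 p] by (intro mult_left_mono) auto
  finally show ?thesis
    by (simp add: energy_bound_1_def divide_right_mono algebra_simps)
qed

text \<open>The difference of the equations shows that the flux of the remainder \<open>v\<close> balances the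
  second-order remainder \<open>Z\<close> of the expanded flux; the energy estimate concludes.\<close>

lemma corrector_remainder_bound:
  assumes u: "solves_\<eta> p u" and u\<^sub>0: "solves_0 p u\<^sub>0" and u\<^sub>1: "solves_1 p u\<^sub>0 u\<^sub>1"
    and p: "norm p \<le> 1"
  shows "(\<integral>x. (norm (u x - u\<^sub>0 x - \<eta> *\<^sub>R u\<^sub>1 x))\<^sup>2 \<partial>\<mu>) \<le> \<eta> ^ 4 * (remainder_bound c \<gamma> * vol)"
proof -
  have W: "u \<in> W" "u\<^sub>0 \<in> W" "u\<^sub>1 \<in> W"
    using u u\<^sub>0 u\<^sub>1 by (auto simp: solves_0_def solves_1_def solves_\<eta>_def)
  have [ess_bounded_intros]: "ess_bounded \<mu> u" "ess_bounded \<mu> u\<^sub>0" "ess_bounded \<mu> u\<^sub>1"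
    using W W_bdd by auto
  define v where "v x = u x - u\<^sub>0 x - \<eta> *\<^sub>R u\<^sub>1 x" for x
  have bv [ess_bounded_intros]: "ess_bounded \<mu> (\<lambda>x. v x)" unfolding v_def by (intro ess_bounded_intros)
  define f\<^sub>0 where "f\<^sub>0 x = A x *v (p + u\<^sub>0 x)" for x
  define f\<^sub>1 where "f\<^sub>1 x = (mat (trace (G x)) - transpose (G x)) *v (A x *v (p + u\<^sub>0 x))
    + A x *v (u\<^sub>1 x - G x *v u\<^sub>0 x)" for x
  define f where "f x = flux p (\<lambda>x. u\<^sub>0 x + \<eta> *\<^sub>R u\<^sub>1 x) x" for x
  define Z where "Z x = f x - f\<^sub>0 x - \<eta> *\<^sub>R f\<^sub>1 x" for x
  have bf [ess_bounded_intros]: "ess_bounded \<mu> (\<lambda>x. f\<^sub>0 x)" "ess_bounded \<mu> (\<lambda>x. f\<^sub>1 x)"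
    "ess_bounded \<mu> (\<lambda>x. f x)"
    unfolding f_def f\<^sub>0_def f\<^sub>1_def by (intro ess_bounded_intros bdd_flux)+
  have bZ [ess_bounded_intros]: "ess_bounded \<mu> (\<lambda>x. Z x)" unfolding Z_def by (intro ess_bounded_intros)
  \<comment> \<open>The expansion coefficients of the flux are orthogonal to all test gradients.\<close>
  have orth_0: "(\<integral>x. f\<^sub>0 x \<bullet> \<phi> x \<partial>\<mu>) = 0" if "\<phi> \<in> W" for \<phi>
    using u\<^sub>0 that by (auto simp: solves_0_def f\<^sub>0_def)
  have orth_1: "(\<integral>x. f\<^sub>1 x \<bullet> \<phi> x \<partial>\<mu>) = 0" if "\<phi> \<in> W" for \<phi>
  proof -
    have [ess_bounded_intros]: "ess_bounded \<mu> \<phi>" using that W_bdd by auto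
    have "integrable \<mu> (\<lambda>x. (A x *v u\<^sub>1 x) \<bullet> \<phi> x)" "integrable \<mu> (\<lambda>x. (A x *v (G x *v u\<^sub>0 x)) \<bullet> \<phi> x)"
      "integrable \<mu> (\<lambda>x. ((mat (trace (G x)) - transpose (G x)) *v (A x *v (p + u\<^sub>0 x))) \<bullet> \<phi> x)"
      by (intro integrableI ess_bounded_intros)+
    then have "(\<integral>x. f\<^sub>1 x \<bullet> \<phi> x \<partial>\<mu>) = (\<integral>x. (A x *v u\<^sub>1 x) \<bullet> \<phi> x \<partial>\<mu>)
        - (\<integral>x. (A x *v (G x *v u\<^sub>0 x)) \<bullet> \<phi> x \<partial>\<mu>)
        + (\<integral>x. ((mat (trace (G x)) - transpose (G x)) *v (A x *v (p + u\<^sub>0 x))) \<bullet> \<phi> x \<partial>\<mu>)"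
      unfolding f\<^sub>1_def matrix_vector_mult_diff_distrib inner_add_left inner_diff_left by simp
    then show ?thesis using u\<^sub>1 that by (auto simp: solves_1_def)
  qed
  have orth: "(\<integral>x. f' x \<bullet> v x \<partial>\<mu>) = 0"
    if "ess_bounded \<mu> f'" "\<And>\<phi>. \<phi> \<in> W \<Longrightarrow> (\<integral>x. f' x \<bullet> \<phi> x \<partial>\<mu>) = 0" for f'
  proof -
    have "integrable \<mu> (\<lambda>x. f' x \<bullet> u x)" "integrable \<mu> (\<lambda>x. f' x \<bullet> u\<^sub>0 x)"
      "integrable \<mu> (\<lambda>x. f' x \<bullet> u\<^sub>1 x)"
      by (intro integrableI ess_bounded_intros that(1))+
    then show ?thesis
      using that(2) W by (simp add: v_def inner_diff_right)
  qed
  \<comment> \<open>The flux is affine in the gradient.\<close>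
  have split: "flux p u x = flux 0 v x + f x" for x
    unfolding f_def flux_def v_def
    by (simp add: matrix_vector_right_distrib matrix_vector_mult_diff_distrib algebra_simps)
  have "(\<integral>x. flux p u x \<bullet> v x \<partial>\<mu>) = 0"
    using u by (intro orth bdd_flux) (auto simp: solves_\<eta>_def intro: ess_bounded_intros)
  moreover have "(\<integral>x. f\<^sub>0 x \<bullet> v x \<partial>\<mu>) = 0" "(\<integral>x. f\<^sub>1 x \<bullet> v x \<partial>\<mu>) = 0"
    by (intro orth bf orth_0 orth_1; assumption)+
  moreover have "integrable \<mu> (\<lambda>x. flux 0 v x \<bullet> v x)" "integrable \<mu> (\<lambda>x. f x \<bullet> v x)"
    "integrable \<mu> (\<lambda>x. f\<^sub>0 x \<bullet> v x)" "integrable \<mu> (\<lambda>x. f\<^sub>1 x \<bullet> v x)"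
    by (intro integrableI ess_bounded_intros bdd_flux bv)+
  ultimately have "(\<integral>x. flux 0 v x \<bullet> v x \<partial>\<mu>) + (\<integral>x. Z x \<bullet> v x \<partial>\<mu>) = 0"
    by (simp add: split Z_def inner_add_left inner_diff_left)
  then have "(\<integral>x. (norm (v x))\<^sup>2 \<partial>\<mu>) \<le> (\<integral>x. (norm (Z x))\<^sup>2 \<partial>\<mu>) / (\<gamma> / (18 * c\<^sup>2))\<^sup>2"
    using \<gamma> c_ge(2) flux_coercive by (intro energy_estimate[OF bdd_flux[OF bv] bZ bv]) auto
  also have "(\<integral>x. (norm (Z x))\<^sup>2 \<partial>\<mu>)
      \<le> (\<integral>x. \<eta> ^ 4 * (3 * (1296 * c ^ 4)\<^sup>2) * (1 + (norm (u\<^sub>0 x))\<^sup>2 + (norm (u\<^sub>1 x))\<^sup>2) \<partial>\<mu>)"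
  proof (intro integral_mono_AE integrableI ess_bounded_intros bZ)
    show "AE x in \<mu>. (norm (Z x))\<^sup>2
        \<le> \<eta> ^ 4 * (3 * (1296 * c ^ 4)\<^sup>2) * (1 + (norm (u\<^sub>0 x))\<^sup>2 + (norm (u\<^sub>1 x))\<^sup>2)"
      using AE_A AE_D AE_B
    proof eventually_elim
      case (elim x)
      have "norm (Z x) \<le> 1296 * c ^ 4 * (1 + norm (u\<^sub>0 x) + norm (u\<^sub>1 x)) * \<eta>\<^sup>2"
        using expansion_flux[OF \<eta>(2) c_ge(2) elim(1) p elim(2,3)]
        unfolding expansion_def Z_def f_def f\<^sub>0_def f\<^sub>1_def flux_def by blast
      then have "(norm (Z x))\<^sup>2 \<le> (1296 * c ^ 4 * (1 + norm (u\<^sub>0 x) + norm (u\<^sub>1 x)) * \<eta>\<^sup>2)\<^sup>2"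
        by (intro power_mono) auto
      also have "\<dots> = \<eta> ^ 4 * (1296 * c ^ 4)\<^sup>2 * (1 + norm (u\<^sub>0 x) + norm (u\<^sub>1 x))\<^sup>2"
        by (simp add: power_mult_distrib flip: power_mult)
      also have "\<dots> \<le> \<eta> ^ 4 * (1296 * c ^ 4)\<^sup>2 * (3 * (1 + (norm (u\<^sub>0 x))\<^sup>2 + (norm (u\<^sub>1 x))\<^sup>2))"
      proof (rule mult_left_mono)
        have "(1 + a + b')\<^sup>2 \<le> 3 * (1 + a\<^sup>2 + b'\<^sup>2)" for a b' :: real
          using zero_le_power2[of "1 - a"] zero_le_power2[of "1 - b'"] zero_le_power2[of "a - b'"]
          by (simp add: power2_eq_square algebra_simps)
        then show "(1 + norm (u\<^sub>0 x) + norm (u\<^sub>1 x))\<^sup>2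
            \<le> 3 * (1 + (norm (u\<^sub>0 x))\<^sup>2 + (norm (u\<^sub>1 x))\<^sup>2)" .
      qed simp
      finally show ?case by (simp add: mult_ac)
    qed
  qed
  also have "\<dots> = \<eta> ^ 4 * (3 * (1296 * c ^ 4)\<^sup>2)
      * (vol + (\<integral>x. (norm (u\<^sub>0 x))\<^sup>2 \<partial>\<mu>) + (\<integral>x. (norm (u\<^sub>1 x))\<^sup>2 \<partial>\<mu>))"
  proof -
    have "integrable \<mu> (\<lambda>x. (norm (u\<^sub>0 x))\<^sup>2)" "integrable \<mu> (\<lambda>x. (norm (u\<^sub>1 x))\<^sup>2)"
      by (intro integrableI ess_bounded_intros)+
    then show ?thesis by simp
  qed
  also have "\<dots> \<le> \<eta> ^ 4 * (3 * (1296 * c ^ 4)\<^sup>2)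
      * (vol + energy_bound_0 c \<gamma> * vol + energy_bound_1 c \<gamma> * vol)"
    using solves_0_bound[OF u\<^sub>0 p] solves_1_bound[OF u\<^sub>0 u\<^sub>1 p] by (intro mult_left_mono) auto
  also have "\<dots> / (\<gamma> / (18 * c\<^sup>2))\<^sup>2 = \<eta> ^ 4 * (remainder_bound c \<gamma> * vol)"
    unfolding remainder_bound_def times_divide_eq_left times_divide_eq_right
    by (rule arg_cong[where f = "\<lambda>y. y / _"]) (simp add: algebra_simps)
  finally show ?thesis
    by (simp add: v_def divide_right_mono)
qed

text \<open>From \<open>\<bar>u\<bar> \<le> s + \<bar>u\<bar>\<^sup>2 / s\<close>. The scale \<open>s\<close> is one for the two correctors and \<open>\<eta>\<^sup>2\<close> for the remainder.\<close>

lemma avg_norm_le: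
  assumes [simp]: "ess_bounded \<mu> u" and le: "(\<integral>x. (norm (u x))\<^sup>2 \<partial>\<mu>) \<le> s\<^sup>2 * (K * vol)" and s: "s > 0"
  shows "avg (\<lambda>x. norm (u x)) \<le> s * (1 + K)"
proof -
  have I: "integrable \<mu> (\<lambda>x. norm (u x))" "integrable \<mu> (\<lambda>x. (norm (u x))\<^sup>2)"
    by (intro integrableI ess_bounded_intros assms(1))+
  have "(\<integral>x. norm (u x) \<partial>\<mu>) \<le> (\<integral>x. s + (norm (u x))\<^sup>2 / s \<partial>\<mu>)"
  proof (rule integral_mono)
    fix x
    have "s * norm (u x) \<le> s * s + (norm (u x))\<^sup>2"
      using zero_le_power2[of "s - norm (u x)"] mult_nonneg_nonneg[OF less_imp_le[OF s] norm_ge_zero[of "u x"]]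
      by (simp add: power2_eq_square algebra_simps)
    then show "norm (u x) \<le> s + (norm (u x))\<^sup>2 / s"
      using s by (simp add: field_simps)
  qed (use I in auto)
  also have "\<dots> = s * vol + (\<integral>x. (norm (u x))\<^sup>2 \<partial>\<mu>) / s"
    using I by simp
  also have "\<dots> \<le> s * vol + s\<^sup>2 * (K * vol) / s"
    using le s by (intro add_left_mono divide_right_mono) auto
  also have "\<dots> = (s * (1 + K)) * vol"
    using s by (simp add: power2_eq_square algebra_simps)
  finally show ?thesis
    using nontrivial by (simp add: avg_def field_simps)
qed

text \<open>The entries of the homogenized matrices. The unperturbed entry is written with the
  corrector of the first direction; symmetry of the coefficient turns it into the usual form.\<close>

definition entry_\<eta> :: "('a \<Rightarrow> real^'n) \<Rightarrow> real^'n \<Rightarrow> real^'n \<Rightarrow> real" where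
  "entry_\<eta> u e e' = inverse (det (avg F)) * avg (\<lambda>x. D x * ((e + B x *v u x) \<bullet> (A x *v e')))"

definition entry_0 :: "('a \<Rightarrow> real^'n) \<Rightarrow> real^'n \<Rightarrow> real^'n \<Rightarrow> real" where
  "entry_0 u\<^sub>0 e e' = avg (\<lambda>x. (e + u\<^sub>0 x) \<bullet> (A x *v e'))"

definition entry_1 :: "('a \<Rightarrow> real^'n) \<Rightarrow> ('a \<Rightarrow> real^'n) \<Rightarrow> real^'n \<Rightarrow> real^'n \<Rightarrow> real" where
  "entry_1 u\<^sub>0 u\<^sub>1 e e' = - entry_0 u\<^sub>0 e e' * avg (\<lambda>x. trace (G x))
     + avg (\<lambda>x. trace (G x) * ((e + u\<^sub>0 x) \<bullet> (A x *v e')))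
     + avg (\<lambda>x. (u\<^sub>1 x - G x *v u\<^sub>0 x) \<bullet> (A x *v e'))"

text \<open>Both sides equal the energy product of the two corrected directions.\<close>

lemma entry_0_symmetric:
  assumes "solves_0 e u" "solves_0 e' u'"
  shows "entry_0 u e e' = avg (\<lambda>x. e \<bullet> (A x *v (e' + u' x)))"
proof -
  have W: "u \<in> W" "u' \<in> W" using assms by (auto simp: solves_0_def)
  have [ess_bounded_intros]: "ess_bounded \<mu> u" "ess_bounded \<mu> u'"
    using W W_bdd by auto
  have I: "integrable \<mu> (\<lambda>x. (e + u x) \<bullet> (A x *v e'))" "integrable \<mu> (\<lambda>x. (e + u x) \<bullet> (A x *v u' x))"
    "integrable \<mu> (\<lambda>x. e \<bullet> (A x *v (e' + u' x)))" "integrable \<mu> (\<lambda>x. u x \<bullet> (A x *v (e' + u' x)))"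
    by (intro integrableI ess_bounded_intros)+
  have "(\<integral>x. (e + u x) \<bullet> (A x *v u' x) \<partial>\<mu>) = (\<integral>x. (A x *v (e + u x)) \<bullet> u' x \<partial>\<mu>)"
  proof (intro integral_cong_AE)
    show "AE x in \<mu>. (e + u x) \<bullet> (A x *v u' x) = (A x *v (e + u x)) \<bullet> u' x"
      using A_sym
      by eventually_elim (simp only: inner_matrix_vector_mult)
  qed (use I(2) in \<open>auto intro!: borel_measurable_integrable integrableI ess_bounded_intros\<close>)
  also have "\<dots> = 0" using assms(1) W by (auto simp: solves_0_def)
  finally have 1: "(\<integral>x. (e + u x) \<bullet> (A x *v u' x) \<partial>\<mu>) = 0" .
  have 2: "(\<integral>x. u x \<bullet> (A x *v (e' + u' x)) \<partial>\<mu>) = 0"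
    using assms(2) W by (auto simp: solves_0_def inner_commute)
  have "(\<integral>x. (e + u x) \<bullet> (A x *v e') \<partial>\<mu>) = (\<integral>x. (e + u x) \<bullet> (A x *v e') + (e + u x) \<bullet> (A x *v u' x) \<partial>\<mu>)"
    using I 1 by simp
  also have "\<dots> = (\<integral>x. e \<bullet> (A x *v (e' + u' x)) + u x \<bullet> (A x *v (e' + u' x)) \<partial>\<mu>)"
    by (simp add: matrix_vector_right_distrib inner_add_left inner_add_right add_ac)
  also have "\<dots> = (\<integral>x. e \<bullet> (A x *v (e' + u' x)) \<partial>\<mu>)"
    using I 2 by simp
  finally show ?thesis by (simp add: entry_0_def avg_def)
qed

lemma entry_remainder_bound:
  assumes u: "solves_\<eta> e u" and u\<^sub>0: "solves_0 e u\<^sub>0" and u\<^sub>1: "solves_1 e u\<^sub>0 u\<^sub>1"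
    and e: "norm e \<le> 1" and e': "norm e' \<le> 1"
  shows "\<bar>entry_\<eta> u e e' - entry_0 u\<^sub>0 e e' - \<eta> * entry_1 u\<^sub>0 u\<^sub>1 e e'\<bar> \<le> entry_bound c \<gamma> * \<eta>\<^sup>2"
proof -
  have W: "u \<in> W" "u\<^sub>0 \<in> W" "u\<^sub>1 \<in> W"
    using u u\<^sub>0 u\<^sub>1 by (auto simp: solves_0_def solves_1_def solves_\<eta>_def)
  have [ess_bounded_intros]: "ess_bounded \<mu> u" "ess_bounded \<mu> u\<^sub>0" "ess_bounded \<mu> u\<^sub>1"
    using W W_bdd by auto
  define v where "v x = u x - u\<^sub>0 x - \<eta> *\<^sub>R u\<^sub>1 x" for x
  have bv [ess_bounded_intros]: "ess_bounded \<mu> (\<lambda>x. v x)" unfolding v_def by (intro ess_bounded_intros)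
  define f\<^sub>0 where "f\<^sub>0 x = (e + u\<^sub>0 x) \<bullet> (A x *v e')" for x
  define f\<^sub>1 where "f\<^sub>1 x = trace (G x) * ((e + u\<^sub>0 x) \<bullet> (A x *v e'))
    + (u\<^sub>1 x - G x *v u\<^sub>0 x) \<bullet> (A x *v e')" for x
  define f where "f x = D x * ((e + B x *v (u\<^sub>0 x + \<eta> *\<^sub>R u\<^sub>1 x)) \<bullet> (A x *v e'))" for x
  define r where "r x = D x * ((B x *v v x) \<bullet> (A x *v e'))" for x
  define k where "k x = 216 * c ^ 3 * (1 + norm (u\<^sub>0 x) + norm (u\<^sub>1 x))" for x
  have I: "integrable \<mu> (\<lambda>x. f x)" "integrable \<mu> (\<lambda>x. f\<^sub>0 x)" "integrable \<mu> (\<lambda>x. f\<^sub>1 x)"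
    "integrable \<mu> (\<lambda>x. r x)" "integrable \<mu> (\<lambda>x. k x)" "integrable \<mu> (\<lambda>x. norm (v x))"
    "integrable \<mu> (\<lambda>x. norm (u\<^sub>0 x))" "integrable \<mu> (\<lambda>x. norm (u\<^sub>1 x))"
    "integrable \<mu> (\<lambda>x. trace (G x) * ((e + u\<^sub>0 x) \<bullet> (A x *v e')))"
    "integrable \<mu> (\<lambda>x. (u\<^sub>1 x - G x *v u\<^sub>0 x) \<bullet> (A x *v e'))"
    "integrable \<mu> F" "integrable \<mu> G"
    unfolding f_def f\<^sub>0_def f\<^sub>1_def r_def k_def by (intro integrableI ess_bounded_intros)+
  have Ae': "AE x in \<mu>. norm (A x *v e') \<le> c"
    using AE_A
  proof eventually_elim
    case (elim x)
    have "norm (A x) * norm e' \<le> c * 1" using elim e' c_ge(2) by (intro mult_mono) auto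
    then show ?case using norm_matrix_vector_mult_le[of "A x" e'] by simp
  qed
  have "AE x in \<mu>. expansion \<eta> (k x) (f x) (f\<^sub>0 x) (f\<^sub>1 x)"
    using Ae' AE_D AE_B unfolding k_def f_def f\<^sub>0_def f\<^sub>1_def
    by eventually_elim (rule expansion_energy[OF \<eta>(2) c_ge(2) _ _ e])
  then have "expansion \<eta> (avg k) (avg f) (avg f\<^sub>0) (avg f\<^sub>1)"
    using expansion_average[of \<eta> k f f\<^sub>0 f\<^sub>1 "1 / vol"] I by (simp add: avg_def)
  moreover have "avg k \<le> 216 * c ^ 3 * (3 + energy_bound_0 c \<gamma> + energy_bound_1 c \<gamma>)"
  proof -
    have "avg (\<lambda>x. norm (u\<^sub>0 x)) \<le> 1 + energy_bound_0 c \<gamma>" "avg (\<lambda>x. norm (u\<^sub>1 x)) \<le> 1 + energy_bound_1 c \<gamma>"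
      using avg_norm_le[of u\<^sub>0 1 "energy_bound_0 c \<gamma>"] solves_0_bound[OF u\<^sub>0 e]
        avg_norm_le[of u\<^sub>1 1 "energy_bound_1 c \<gamma>"] solves_1_bound[OF u\<^sub>0 u\<^sub>1 e]
      by (auto intro: ess_bounded_intros)
    moreover have "avg k = 216 * c ^ 3 * (1 + avg (\<lambda>x. norm (u\<^sub>0 x)) + avg (\<lambda>x. norm (u\<^sub>1 x)))"
      using I nontrivial unfolding avg_def k_def by (simp add: field_simps)
    ultimately show ?thesis using c_ge(2) by simp
  qed
  ultimately have f: "expansion \<eta> (216 * c ^ 3 * (3 + energy_bound_0 c \<gamma> + energy_bound_1 c \<gamma>))
      (avg f) (avg f\<^sub>0) (avg f\<^sub>1)"
    by (rule expansion_mono)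
  have r: "\<bar>avg r\<bar> \<le> 9 * c ^ 3 * (1 + remainder_bound c \<gamma>) * \<eta>\<^sup>2"
  proof -
    have "\<bar>avg r\<bar> = 1 / vol * \<bar>\<integral>x. r x \<partial>\<mu>\<bar>"
      using nontrivial by (simp add: avg_def abs_mult)
    also have "\<dots> \<le> 1 / vol * (\<integral>x. 9 * c ^ 3 * norm (v x) \<partial>\<mu>)"
    proof (rule mult_left_mono)
      have "\<bar>\<integral>x. r x \<partial>\<mu>\<bar> \<le> (\<integral>x. \<bar>r x\<bar> \<partial>\<mu>)" by simp
      also have "\<dots> \<le> (\<integral>x. 9 * c ^ 3 * norm (v x) \<partial>\<mu>)"
      proof (intro integral_mono_AE)
        show "AE x in \<mu>. \<bar>r x\<bar> \<le> 9 * c ^ 3 * norm (v x)"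
          using Ae' AE_D AE_B
        proof eventually_elim
          case (elim x)
          have "norm (B x *v v x) \<le> 3 * c * norm (v x)"
            using expansion_norm_le(1)[OF elim(3) \<eta>(2)]
            by (intro order_trans[OF norm_matrix_vector_mult_le] mult_right_mono) auto
          then have "norm (B x *v v x) * norm (A x *v e') \<le> (3 * c * norm (v x)) * c"
            using elim(1) c_ge(2) by (intro mult_mono) auto
          then have "\<bar>(B x *v v x) \<bullet> (A x *v e')\<bar> \<le> (3 * c * norm (v x)) * c"
            using Cauchy_Schwarz_ineq2 order_trans by blast
          then have "\<bar>r x\<bar> \<le> (3 * c) * ((3 * c * norm (v x)) * c)"
            unfolding r_def abs_mult
            using expansion_norm_le(1)[OF elim(2) \<eta>(2)] c_ge(2) by (intro mult_mono) auto
          then show ?case by (simp add: power3_eq_cube mult_ac)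
        qed
      qed (use I in auto)
      finally show "\<bar>\<integral>x. r x \<partial>\<mu>\<bar> \<le> (\<integral>x. 9 * c ^ 3 * norm (v x) \<partial>\<mu>)" .
    qed simp
    also have "\<dots> = 9 * c ^ 3 * avg (\<lambda>x. norm (v x))"
      by (simp add: avg_def)
    also have "\<dots> \<le> 9 * c ^ 3 * (\<eta>\<^sup>2 * (1 + remainder_bound c \<gamma>))"
    proof (rule mult_left_mono)
      show "avg (\<lambda>x. norm (v x)) \<le> \<eta>\<^sup>2 * (1 + remainder_bound c \<gamma>)"
        using corrector_remainder_bound[OF u u\<^sub>0 u\<^sub>1 e] \<eta>(1)
        by (intro avg_norm_le bv) (auto simp: v_def simp flip: power_mult)
    qed (use c_ge(2) in simp)
    finally show ?thesis by (simp add: mult_ac)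
  qed
  have numerator: "avg (\<lambda>x. D x * ((e + B x *v u x) \<bullet> (A x *v e'))) = avg f + avg r"
  proof -
    have "D x * ((e + B x *v u x) \<bullet> (A x *v e')) = f x + r x" for x
      unfolding f_def r_def v_def
      by (simp add: matrix_vector_right_distrib matrix_vector_mult_diff_distrib inner_add_left
          inner_diff_left algebra_simps)
    then show ?thesis using I by (simp add: avg_def scaleR_add_right distrib_left add_divide_distrib)
  qed
  have f_r: "expansion \<eta> (216 * c ^ 3 * (3 + energy_bound_0 c \<gamma> + energy_bound_1 c \<gamma>)
      + 9 * c ^ 3 * (1 + remainder_bound c \<gamma>)) (avg f + avg r) (avg f\<^sub>0) (avg f\<^sub>1)"
  proof -
    have "0 \<le> remainder_bound c \<gamma>"
      by (simp add: remainder_bound_def energy_bound_0_def energy_bound_1_def)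
    then have "0 \<le> 9 * c ^ 3 * (1 + remainder_bound c \<gamma>)" using c_ge(2) by simp
    then have "expansion \<eta> (9 * c ^ 3 * (1 + remainder_bound c \<gamma>)) (avg r) 0 0"
      using r by (simp add: expansion_def)
    from expansion_add[OF f this] show ?thesis by simp
  qed
  have inv_det: "expansion \<eta> c (inverse (det (avg F))) 1 (- trace (avg G))"
  proof -
    have "expansion \<eta> b (avg F) (mat 1) (avg G)"
      using expansion_average[of \<eta> "\<lambda>_. b" F "\<lambda>_. mat 1" G "1 / vol"] F_expansion I nontrivial
      by (simp add: avg_def)
    note det = expansion_det[OF \<eta>(2) this]
    have "4 * (fact CARD('n) * (6 * b) ^ CARD('n)) * \<bar>\<eta>\<bar> \<le> 4 * c * \<bar>\<eta>\<bar>"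
      using c_ge(3) by (intro mult_right_mono mult_left_mono) auto
    then have "4 * (fact CARD('n) * (6 * b) ^ CARD('n)) * \<bar>\<eta>\<bar> \<le> 1" using small by linarith
    from expansion_inverse(2)[OF \<eta>(2) det this] show ?thesis
      unfolding c_def coeff_bound_def .
  qed
  have "expansion \<eta> (entry_bound c \<gamma>) (entry_\<eta> u e e') (avg f\<^sub>0)
      (- trace (avg G) * avg f\<^sub>0 + avg f\<^sub>1)"
    using expansion_scaleR[OF \<eta>(2) inv_det f_r]
    unfolding entry_bound_def entry_\<eta>_def numerator by simp
  moreover have "avg f\<^sub>0 = entry_0 u\<^sub>0 e e'"
    by (simp add: f\<^sub>0_def [abs_def] entry_0_def)
  moreover have "avg f\<^sub>1 = avg (\<lambda>x. trace (G x) * ((e + u\<^sub>0 x) \<bullet> (A x *v e')))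
      + avg (\<lambda>x. (u\<^sub>1 x - G x *v u\<^sub>0 x) \<bullet> (A x *v e'))"
    using I unfolding f\<^sub>1_def avg_def by (simp add: add_divide_distrib)
  moreover have "trace (avg G) = avg (\<lambda>x. trace (G x))"
    using integral_bounded_linear[OF linear_trace[THEN linear_conv_bounded_linear[THEN iffD1]] I(12)]
    by (simp add: avg_def linear_scale[OF linear_trace])
  ultimately show ?thesis
    by (simp add: expansion_def entry_1_def algebra_simps)
qed

end

section \<open>Cubes and lattice translations\<close>

text \<open>The lattice vectors whose unit cubes tile \<open>cube N\<close>.\<close>

definition lattice_box :: "nat \<Rightarrow> (int^'n) set" where
  "lattice_box N = {k. \<forall>i. \<bar>k $ i\<bar> \<le> int N}"

lemma finite_lattice_box: "finite (lattice_box N :: (int^'n) set)"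
proof (rule finite_subset)
  show "lattice_box N \<subseteq> (\<lambda>f. \<chi> i. f i) ` (PiE UNIV (\<lambda>_ :: 'n. {- int N..int N}))"
  proof
    fix k :: "int^'n" assume "k \<in> lattice_box N"
    then have "(\<lambda>i. k $ i) \<in> PiE UNIV (\<lambda>_. {- int N..int N})"
      by (auto simp: lattice_box_def abs_le_iff minus_le_iff)
    then show "k \<in> (\<lambda>f. \<chi> i. f i) ` (PiE UNIV (\<lambda>_. {- int N..int N}))"
      by (rule rev_image_eqI) simp
  qed
qed (auto intro!: finite_PiE)

lemma lattice_vec_nth [simp]: "lattice_vec k $ i = real_of_int (k $ i)"
  by (simp add: lattice_vec_def)

lemma lattice_vec_add: "lattice_vec (k + l) = lattice_vec k + lattice_vec l"
  by (simp add: vec_eq_iff)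

lemma lattice_vec_minus: "lattice_vec (- k) = - lattice_vec k"
  by (simp add: vec_eq_iff)

lemma zero_in_lattice_box: "0 \<in> lattice_box N"
  by (simp add: lattice_box_def)

lemma mem_cube: "x \<in> cube N \<longleftrightarrow> (\<forall>i. - real N - 1 / 2 \<le> x $ i \<and> x $ i \<le> real N + 1 / 2)"
  by (simp add: cube_def mem_box_cart)

lemma compact_cube: "compact (cube N)"
  by (simp add: cube_def compact_cbox)

lemma lmeasurable_cube [simp]: "cube N \<in> lmeasurable"
  by (simp add: cube_def)

lemma sets_cube [simp]: "cube N \<in> sets lebesgue"
  by (simp add: cube_def)

lemma translate_cube_subset:
  assumes "k \<in> lattice_box N" "x \<in> cube 0"
  shows "lattice_vec k + x \<in> cube N"
  unfolding mem_cube
proof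
  fix i
  have "\<bar>k $ i\<bar> \<le> int N" using assms(1) by (simp add: lattice_box_def)
  then have "\<bar>real_of_int (k $ i)\<bar> \<le> real N" by linarith
  moreover have "- 1 / 2 \<le> x $ i \<and> x $ i \<le> 1 / 2" using assms(2) by (simp add: mem_cube)
  ultimately show "- real N - 1 / 2 \<le> (lattice_vec k + x) $ i \<and> (lattice_vec k + x) $ i \<le> real N + 1 / 2"
    by (simp add: abs_le_iff)
qed

lemma cube_eq_Union: "cube N = (\<Union>k\<in>lattice_box N. (+) (lattice_vec k) ` cube 0)"
proof (intro equalityI subsetI)
  fix x :: "real^'n" assume "x \<in> cube N"
  then have x: "- real N - 1 / 2 \<le> x $ i" "x $ i \<le> real N + 1 / 2" for i
    by (auto simp: mem_cube)
  \<comment> \<open>The minimum matters only on the upper faces of the cube.\<close>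
  define k :: "int^'n" where "k = (\<chi> i. min (int N) \<lfloor>x $ i + 1 / 2\<rfloor>)"
  have k: "\<bar>k $ i\<bar> \<le> int N" "- 1 / 2 \<le> x $ i - real_of_int (k $ i)" "x $ i - real_of_int (k $ i) \<le> 1 / 2" for i
    using x[of i] unfolding k_def by (auto simp: min_def) linarith+
  have "x = lattice_vec k + (x - lattice_vec k)" by simp
  moreover have "x - lattice_vec k \<in> cube 0" using k by (simp add: mem_cube)
  moreover have "k \<in> lattice_box N" using k by (simp add: lattice_box_def)
  ultimately show "x \<in> (\<Union>k\<in>lattice_box N. (+) (lattice_vec k) ` cube 0)" by blast
qed (auto simp: translate_cube_subset)

lemma measurable_translate [measurable]: "(+) a \<in> lebesgue \<rightarrow>\<^sub>M lebesgue" for a :: "'a::euclidean_space"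
proof (rule measurableI)
  fix S :: "'a set" assume "S \<in> sets lebesgue"
  moreover have "(+) a -` S \<inter> space lebesgue = (\<lambda>x. - a + x) ` S"
    by (auto intro!: image_eqI[of _ _ "a + _"])
  ultimately show "(+) a -` S \<inter> space lebesgue \<in> sets lebesgue"
    using lebesgue_sets_translation by metis
qed simp

lemma distr_lebesgue_translate: "distr lebesgue lebesgue ((+) a) = lebesgue" for a :: "'a::euclidean_space"
proof (rule measure_eqI)
  fix S assume "S \<in> sets (distr lebesgue lebesgue ((+) a))"
  then have S: "S \<in> sets lebesgue" by simp
  have "(+) a -` S \<inter> space lebesgue = (\<lambda>x. - a + x) ` S"
    by (auto intro!: image_eqI[of _ _ "a + _"])
  then show "emeasure (distr lebesgue lebesgue ((+) a)) S = emeasure lebesgue S"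
    using emeasure_lebesgue_affine[of 1 "- a" S] S
    by (simp add: emeasure_distr measurable_translate add.commute)
qed simp

lemma AE_lebesgue_translate:
  fixes a :: "'a::euclidean_space"
  assumes "AE x in lebesgue. P x"
  shows "AE x in lebesgue. P (a + x)"
  by (rule AE_distrD[OF measurable_translate]) (subst distr_lebesgue_translate, rule assms)

lemma set_integral_translate:
  fixes f :: "'a::euclidean_space \<Rightarrow> 'b::{banach, second_countable_topology}"
  assumes "set_integrable lebesgue ((+) a ` S) f"
  shows "set_integrable lebesgue S (\<lambda>x. f (a + x))"
    and "(LINT x:(+) a ` S|lebesgue. f x) = (LINT x:S|lebesgue. f (a + x))"
proof -
  let ?g = "\<lambda>x. indicator ((+) a ` S) x *\<^sub>R f x"
  have g: "?g (a + x) = indicator S x *\<^sub>R f (a + x)" for x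
    by (auto simp: indicator_def)
  have i: "integrable lebesgue ?g"
    using assms by (simp add: set_integrable_def)
  then have "integrable (distr lebesgue lebesgue ((+) a)) ?g"
    by (simp add: distr_lebesgue_translate)
  then have "integrable lebesgue (\<lambda>x. ?g (a + x))"
    by (rule integrable_distr[OF measurable_translate])
  then show "set_integrable lebesgue S (\<lambda>x. f (a + x))"
    by (simp add: g set_integrable_def)
  have "integral\<^sup>L lebesgue ?g = integral\<^sup>L (distr lebesgue lebesgue ((+) a)) ?g"
    by (simp add: distr_lebesgue_translate)
  also have "\<dots> = (\<integral>x. ?g (a + x) \<partial>lebesgue)"
    by (rule integral_distr[OF measurable_translate]) (use i in auto)
  finally show "(LINT x:(+) a ` S|lebesgue. f x) = (LINT x:S|lebesgue. f (a + x))"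
    by (simp add: g set_lebesgue_integral_def)
qed

lemma AE_translates_disjoint:
  fixes k l :: "int^'n"
  assumes "k \<noteq> l"
  shows "AE x in lebesgue. \<not> (x \<in> (+) (lattice_vec k) ` cube 0 \<and> x \<in> (+) (lattice_vec l) ` cube 0)"
proof -
  have *: "AE x in lebesgue. \<not> (x \<in> (+) (lattice_vec k) ` cube 0 \<and> x \<in> (+) (lattice_vec l) ` cube 0)"
    if "k $ i < l $ i" for k l :: "int^'n" and i
  proof -
    have "AE x in lebesgue. x \<notin> {x :: real^'n. x $ i = 0}"
      using negligible_standard_hyperplane_cart[of i]
      by (intro AE_not_in) (simp add: negligible_iff_null_sets)
    from AE_lebesgue_translate[OF this, of "\<chi> j. - (real_of_int (k $ i) + 1 / 2)"]
    have "AE x in lebesgue. x $ i \<noteq> real_of_int (k $ i) + 1 / 2"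
      by eventually_elim auto
    then show ?thesis
    proof eventually_elim
      case (elim x)
      show ?case
      proof
        assume "x \<in> (+) (lattice_vec k) ` cube 0 \<and> x \<in> (+) (lattice_vec l) ` cube 0"
        then obtain y z where "x = lattice_vec k + y" "x = lattice_vec l + z" "y \<in> cube 0" "z \<in> cube 0"
          by blast
        then have "x $ i = real_of_int (k $ i) + y $ i" "x $ i = real_of_int (l $ i) + z $ i"
          "y $ i \<le> 1 / 2" "- 1 / 2 \<le> z $ i"
          by (auto simp: mem_cube dest!: spec[of _ i] arg_cong[of _ _ "\<lambda>x. x $ i"])
        then have "x $ i \<le> real_of_int (k $ i) + 1 / 2" "x $ i \<ge> real_of_int (l $ i) - 1 / 2"
          by linarith+
        moreover have "real_of_int (k $ i) + 1 \<le> real_of_int (l $ i)" using that by linarith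
        ultimately show False using elim by linarith
      qed
    qed
  qed
  obtain i where "k $ i \<noteq> l $ i" using assms by (auto simp: vec_eq_iff)
  then consider "k $ i < l $ i" | "l $ i < k $ i" by linarith
  then show ?thesis
  proof cases
    case 1 then show ?thesis by (rule *)
  next
    case 2 from *[OF this] show ?thesis by eventually_elim blast
  qed
qed

lemma finite_measure_cube: "finite_measure (lebesgue_on (cube N))"
  by (rule finite_measure_lebesgue_on) simp

lemma integral_cube_eq:
  fixes f :: "real^'n \<Rightarrow> 'b::{banach, second_countable_topology}"
  shows "(LINT x:cube N|lebesgue. f x) = integral\<^sup>L (lebesgue_on (cube N)) f"
  unfolding set_lebesgue_integral_def by (subst integral_restrict_space) simp_all

lemma set_integrable_cube:
  fixes f :: "real^'n \<Rightarrow> 'b::{banach, second_countable_topology}"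
  assumes "ess_bounded (lebesgue_on (cube N)) f"
  shows "set_integrable lebesgue (cube N) f"
proof -
  interpret finite_measure "lebesgue_on (cube N :: (real^'n) set)" by (rule finite_measure_cube)
  show ?thesis
    using integrable_ess_bounded[OF assms] by (simp add: set_integrable_def integrable_restrict_space)
qed

lemma sets_translate_cube [simp]: "(+) (lattice_vec k) ` cube N \<in> sets lebesgue"
  using lebesgue_sets_translation[of "cube N" "lattice_vec k"] by simp

lemma set_integrable_translates:
  fixes f :: "real^'n \<Rightarrow> 'b::{banach, second_countable_topology}"
  assumes "ess_bounded (lebesgue_on (cube N)) f" "k \<in> lattice_box N"
  shows "set_integrable lebesgue ((+) (lattice_vec k) ` cube 0) f"
    and "set_integrable lebesgue (cube 0) (\<lambda>x. f (lattice_vec k + x))"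
proof -
  show *: "set_integrable lebesgue ((+) (lattice_vec k) ` cube 0) f"
    using assms(2) by (intro set_integrable_subset[OF set_integrable_cube[OF assms(1)]])
      (auto simp: translate_cube_subset)
  show "set_integrable lebesgue (cube 0) (\<lambda>x. f (lattice_vec k + x))"
    by (rule set_integral_translate(1)[OF *])
qed

lemma integral_cube_sum:
  fixes f :: "real^'n \<Rightarrow> 'b::{banach, second_countable_topology}"
  assumes "ess_bounded (lebesgue_on (cube N)) f"
  shows "(LINT x:cube N|lebesgue. f x) = (\<Sum>k\<in>lattice_box N. LINT x:cube 0|lebesgue. f (lattice_vec k + x))"
proof -
  have "(LINT x:cube N|lebesgue. f x)
      = (\<Sum>k\<in>lattice_box N. LINT x:(+) (lattice_vec k) ` cube 0|lebesgue. f x)"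
    unfolding cube_eq_Union[of N]
  proof (rule set_integral_finite_UN_AE)
    show "set_integrable lebesgue ((+) (lattice_vec k) ` cube 0) f" if "k \<in> lattice_box N" for k :: "int^'n"
      by (rule set_integrable_translates(1)[OF assms that])
    fix k l :: "int^'n"
    show "AE x in lebesgue. (x \<in> (+) (lattice_vec k) ` cube 0 \<and> x \<in> (+) (lattice_vec l) ` cube 0) \<longrightarrow> k = l"
      using AE_translates_disjoint[of k l] by (cases "k = l") (auto elim!: eventually_mono)
  qed (simp_all add: finite_lattice_box)
  also have "\<dots> = (\<Sum>k\<in>lattice_box N. LINT x:cube 0|lebesgue. f (lattice_vec k + x))"
    by (intro sum.cong refl set_integral_translate(2) set_integrable_translates(1)[OF assms])
  finally show ?thesis .
qed

lemma measure_cube_0: "measure lebesgue (cube 0 :: (real^'n) set) = 1"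
proof -
  have "(0 :: real^'n) \<in> cube 0" by (simp add: mem_cube)
  then have "cbox (vec (- 1 / 2) :: real^'n) (vec (1 / 2)) \<noteq> {}"
    by (auto simp: cube_def)
  from content_cbox_cart[OF this] show ?thesis
    by (simp add: cube_def)
qed

lemma measure_cube_eq_card: "measure lebesgue (cube N :: (real^'n) set) = real (card (lattice_box N :: (int^'n) set))"
proof -
  have "(LINT x:(cube N :: (real^'n) set)|lebesgue. (1::real))
      = (\<Sum>k\<in>(lattice_box N :: (int^'n) set). LINT x:(cube 0 :: (real^'n) set)|lebesgue. (1::real))"
    by (rule integral_cube_sum) (intro ess_bounded_intros)
  then show ?thesis
    by (simp add: set_lebesgue_integral_def measure_cube_0)
qed

lemma measure_cube_pos: "measure lebesgue (cube N :: (real^'n) set) > 0"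
  unfolding measure_cube_eq_card using zero_in_lattice_box finite_lattice_box
  by (auto simp: card_gt_0_iff)

text \<open>The average of a periodic function over any cube is its integral over the unit cube,
  which has volume one.\<close>

lemma cube_avg_periodic:
  fixes f :: "real^'n \<Rightarrow> 'b::{banach, second_countable_topology}"
  assumes f: "ess_bounded (lebesgue_on (cube N)) f"
    and per: "\<And>k. AE x in lebesgue. f (lattice_vec k + x) = f x"
  shows "cube_avg N f = (LINT x:cube 0|lebesgue. f x)"
proof -
  have "(LINT x:cube 0|lebesgue. f (lattice_vec k + x)) = (LINT x:cube 0|lebesgue. f x)"
    if k: "k \<in> lattice_box N" for k :: "int^'n"
    unfolding set_lebesgue_integral_def
  proof (rule integral_cong_AE)
    show "AE x in lebesgue. indicator (cube 0) x *\<^sub>R f (lattice_vec k + x) = indicator (cube 0) x *\<^sub>R f x"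
      using per[of k] by eventually_elim simp
    show "(\<lambda>x. indicator (cube 0) x *\<^sub>R f (lattice_vec k + x)) \<in> borel_measurable lebesgue"
      using set_integrable_translates(2)[OF f k] unfolding set_integrable_def
      by (rule borel_measurable_integrable)
    show "(\<lambda>x. indicator (cube 0) x *\<^sub>R f x) \<in> borel_measurable lebesgue"
      using set_integrable_translates(2)[OF f zero_in_lattice_box]
      unfolding set_integrable_def by (auto simp: lattice_vec_def zero_vec_def[symmetric])
  qed
  then have "(LINT x:cube N|lebesgue. f x) = real (card (lattice_box N :: (int^'n) set)) *\<^sub>R (LINT x:cube 0|lebesgue. f x)"
    unfolding integral_cube_sum[OF f] by (simp add: sum_constant_scaleR)
  then show ?thesis
    using measure_cube_pos[of N, where 'n='n] by (simp add: cube_avg_def measure_cube_eq_card)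
qed

text \<open>A bound on the unit cube and periodicity up to null sets control a field on every cube.\<close>

lemma ess_bounded_cube_periodic:
  fixes f :: "real^'n \<Rightarrow> real"
  assumes f: "f \<in> borel_measurable (lebesgue_on (cube 0))" "AE x in lebesgue_on (cube 0). \<bar>f x\<bar> \<le> M"
    and per: "\<And>k. AE x in lebesgue. f (x + lattice_vec k) = f x"
  shows "f \<in> borel_measurable (lebesgue_on (cube N))" and "AE x in lebesgue_on (cube N). \<bar>f x\<bar> \<le> M"
proof -
  have shift: "AE x in lebesgue. f (- lattice_vec k + x) = f x" for k
    using AE_lebesgue_translate[OF per[of k], of "- lattice_vec k"] by eventually_elim (simp add: add.commute)
  have piece: "f \<in> borel_measurable (lebesgue_on ((+) (lattice_vec k) ` cube 0))" for k :: "int^'n"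
  proof -
    have "(\<lambda>x. indicator (cube 0) x *\<^sub>R f x) \<in> borel_measurable lebesgue"
      using f(1) by (simp add: borel_measurable_restrict_space_iff)
    from measurable_compose[OF measurable_translate[of "- lattice_vec k"] this]
    have "(\<lambda>x. indicator (cube 0) (- lattice_vec k + x) *\<^sub>R f (- lattice_vec k + x)) \<in> borel_measurable lebesgue" .
    moreover have "indicator (cube 0) (- lattice_vec k + x) = (indicator ((+) (lattice_vec k) ` cube 0) x :: real)" for x
      by (auto simp: indicator_def intro!: image_eqI[of _ _ "- lattice_vec k + x"])
    ultimately have "(\<lambda>x. indicator ((+) (lattice_vec k) ` cube 0) x *\<^sub>R f (- lattice_vec k + x)) \<in> borel_measurable lebesgue"
      by simp
    moreover have "AE x in lebesgue. indicator ((+) (lattice_vec k) ` cube 0) x *\<^sub>R f (- lattice_vec k + x)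
        = indicator ((+) (lattice_vec k) ` cube 0) x *\<^sub>R f x"
      using shift[of k] by eventually_elim simp
    ultimately have "(\<lambda>x. indicator ((+) (lattice_vec k) ` cube 0) x *\<^sub>R f x) \<in> borel_measurable lebesgue"
      by (rule borel_measurable_AE)
    then show ?thesis by (simp add: borel_measurable_restrict_space_iff)
  qed
  show "f \<in> borel_measurable (lebesgue_on (cube N))"
  proof (rule measurable_piecewise_restrict[where C = "(\<lambda>k. (+) (lattice_vec k) ` cube 0) ` lattice_box N"])
    show "countable ((\<lambda>k. (+) (lattice_vec k) ` cube 0) ` (lattice_box N :: (int^'n) set))"
      by (intro countable_finite finite_imageI finite_lattice_box)
    show "space (lebesgue_on (cube N)) \<subseteq> \<Union> ((\<lambda>k. (+) (lattice_vec k) ` cube 0) ` (lattice_box N :: (int^'n) set))"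
      unfolding cube_eq_Union[of N] by (simp add: space_restrict_space)
    fix \<Omega> :: "(real^'n) set" assume "\<Omega> \<in> (\<lambda>k. (+) (lattice_vec k) ` cube 0) ` lattice_box N"
    then obtain k where k: "k \<in> lattice_box N" "\<Omega> = (+) (lattice_vec k) ` cube 0" by blast
    then have sub: "cube N \<inter> \<Omega> = \<Omega>" "\<Omega> \<inter> cube N = \<Omega>" "\<Omega> \<subseteq> cube N" using translate_cube_subset[OF k(1)] by auto
    have \<Omega>: "\<Omega> \<in> sets lebesgue" using k by simp
    show "\<Omega> \<inter> space (lebesgue_on (cube N)) \<in> sets (lebesgue_on (cube N))"
      using sub \<Omega> by (simp add: space_restrict_space sets_restrict_space_iff)
    show "f \<in> borel_measurable (restrict_space (lebesgue_on (cube N)) \<Omega>)"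
      using piece[of k] k(2) \<Omega> sub by (simp add: restrict_restrict_space)
  qed
  have "AE x in lebesgue. x \<in> cube 0 \<longrightarrow> \<bar>f x\<bar> \<le> M"
    using f(2) by (simp add: AE_restrict_space_iff)
  from AE_lebesgue_translate[OF this]
  have translated: "AE x in lebesgue. - lattice_vec k + x \<in> cube 0 \<longrightarrow> \<bar>f (- lattice_vec k + x)\<bar> \<le> M" for k :: "int^'n" .
  have "AE x in lebesgue. x \<in> (+) (lattice_vec k) ` cube 0 \<longrightarrow> \<bar>f x\<bar> \<le> M" for k :: "int^'n"
    using translated[of k] shift[of k] by eventually_elim auto
  then have "AE x in lebesgue. \<forall>k\<in>(lattice_box N :: (int^'n) set). x \<in> (+) (lattice_vec k) ` cube 0 \<longrightarrow> \<bar>f x\<bar> \<le> M"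
    by (intro AE_finite_allI finite_lattice_box)
  then have "AE x in lebesgue. x \<in> cube N \<longrightarrow> \<bar>f x\<bar> \<le> M"
    unfolding cube_eq_Union[of N] by eventually_elim blast
  then show "AE x in lebesgue_on (cube N). \<bar>f x\<bar> \<le> M"
    by (simp add: AE_restrict_space_iff)
qed

section \<open>Finite element functions\<close>

lemma has_derivative_translate:
  "(f has_derivative D) (at (a + x)) \<longleftrightarrow> ((\<lambda>y. f (a + y)) has_derivative D) (at x)"
  by (simp add: has_derivative_at add.assoc)

lemma grad_translate: "grad (\<lambda>y. f (a + y)) x = grad f (a + x)"
  by (simp add: grad_def frechet_derivative_def has_derivative_translate)

lemma grad_eqI:
  assumes "(f has_derivative (\<lambda>h. a \<bullet> h)) (at x)"
  shows "grad f x = a"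
  unfolding grad_def frechet_derivative_at[OF assms, symmetric]
  by (simp add: vec_eq_iff inner_axis)

lemma has_derivative_affine_on_open:
  fixes f :: "real^'n \<Rightarrow> real"
  assumes "open U" "x \<in> U" "\<And>y. y \<in> U \<Longrightarrow> f y = a \<bullet> y + b"
  shows "(f has_derivative (\<lambda>h. a \<bullet> h)) (at x)"
proof (rule has_derivative_transform_within_open)
  show "((\<lambda>y. a \<bullet> y + b) has_derivative (\<lambda>h. a \<bullet> h)) (at x)"
    by (auto intro!: derivative_eq_intros)
qed (use assms in auto)

text \<open>The translates of the simplices that fill \<open>cube N\<close>. They form a finite part of the mesh of
  the cube, and almost every point lies in the interior of one of them.\<close>

definition tiles :: "(real^'n) set set \<Rightarrow> nat \<Rightarrow> (real^'n) set set" where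
  "tiles T N = (\<lambda>(k, K). (+) (lattice_vec k) ` K) ` (lattice_box N \<times> T)"

lemma tiles_subset_mesh:
  assumes "periodic_triangulation T"
  shows "tiles T N \<subseteq> mesh_N T N"
proof
  fix L assume "L \<in> tiles T N"
  then obtain k K where L: "k \<in> lattice_box N" "K \<in> T" "L = (+) (lattice_vec k) ` K"
    by (auto simp: tiles_def)
  have "K \<subseteq> cube 0" using assms L(2) by (auto simp: periodic_triangulation_def)
  then have "L \<subseteq> cube N" using L translate_cube_subset by blast
  then show "L \<in> mesh_N T N"
    using L unfolding mesh_N_def periodic_mesh_def by blast
qed

lemma Union_tiles:
  assumes "periodic_triangulation T"
  shows "\<Union> (tiles T N) = cube N"
proof -
  have "\<Union> (tiles T N) = (\<Union>k\<in>lattice_box N. (+) (lattice_vec k) ` \<Union> T)"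
    by (auto simp: tiles_def)
  also have "\<Union> T = cube 0" using assms by (simp add: periodic_triangulation_def)
  finally show ?thesis by (simp add: cube_eq_Union[of N])
qed

lemma finite_tiles: "periodic_triangulation T \<Longrightarrow> finite (tiles T N)"
  unfolding tiles_def periodic_triangulation_def triangulation_def
  by (intro finite_imageI finite_cartesian_product finite_lattice_box) auto

lemma compact_convex_tile:
  assumes "periodic_triangulation T" "K \<in> tiles T N"
  shows "compact K" "convex K"
proof -
  obtain k L where L: "L \<in> T" "K = (+) (lattice_vec k) ` L"
    using assms(2) by (auto simp: tiles_def)
  then have "int CARD('a) simplex L" using assms(1) by (auto simp: periodic_triangulation_def)
  then have "compact L" "convex L"
    unfolding simplex by (auto intro: finite_imp_compact_convex_hull)
  then show "compact K" "convex K"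
    unfolding L by (simp_all add: compact_translation)
qed

lemma AE_interior_tile:
  assumes T: "periodic_triangulation T"
  shows "AE x in lebesgue. x \<in> cube N \<longrightarrow> (\<exists>K\<in>tiles T N. x \<in> interior K)"
proof -
  have "AE x in lebesgue. x \<notin> frontier K" if "K \<in> tiles T N" for K
    using negligible_convex_frontier[OF compact_convex_tile(2)[OF T that]]
    by (intro AE_not_in) (simp add: negligible_iff_null_sets)
  then have "AE x in lebesgue. \<forall>K\<in>tiles T N. x \<notin> frontier K"
    by (intro AE_finite_allI finite_tiles T)
  then show ?thesis
  proof eventually_elim
    case (elim x)
    show ?case
    proof
      assume "x \<in> cube N"
      then obtain K where K: "K \<in> tiles T N" "x \<in> K"
        using Union_tiles[OF T] by blast
      then have "x \<in> interior K"
        using elim closure_subset by (auto simp: frontier_def)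
      with K show "\<exists>K\<in>tiles T N. x \<in> interior K" by blast
    qed
  qed
qed

lemma V_per_has_derivative:
  assumes \<phi>: "\<phi> \<in> V_per T N" and K: "K \<in> mesh_N T N"
  obtains a where "\<And>x. x \<in> interior K \<Longrightarrow> (\<phi> has_derivative (\<lambda>h. a \<bullet> h)) (at x)"
proof -
  have "\<forall>K\<in>mesh_N T N. \<exists>a b. \<forall>x\<in>K. \<phi> x = a \<bullet> x + b"
    using \<phi> by (simp add: V_per_def)
  with K obtain a b where "\<forall>x\<in>K. \<phi> x = a \<bullet> x + b"
    by meson
  then have "(\<phi> has_derivative (\<lambda>h. a \<bullet> h)) (at x)" if "x \<in> interior K" for x
    using that interior_subset by (intro has_derivative_affine_on_open[OF open_interior]) auto
  then show thesis by (rule that)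
qed

lemma V_per_differentiable:
  assumes T: "periodic_triangulation T" and \<phi>: "\<phi> \<in> V_per T N"
    and K: "K \<in> tiles T N" "x \<in> interior K"
  shows "(\<phi> has_derivative (\<lambda>h. grad \<phi> x \<bullet> h)) (at x)"
proof -
  have "K \<in> mesh_N T N" using K tiles_subset_mesh[OF T] by blast
  then obtain a where a: "(\<phi> has_derivative (\<lambda>h. a \<bullet> h)) (at x)"
    using V_per_has_derivative[OF \<phi>] K(2) by metis
  with grad_eqI[OF a] show ?thesis by simp
qed

lemma V_per_grad_ess_bounded:
  assumes T: "periodic_triangulation T" and \<phi>: "\<phi> \<in> V_per T N"
  shows "ess_bounded (lebesgue_on (cube N)) (grad \<phi>)"
proof -
  define U where "U = (\<Union>K\<in>tiles T N. interior K)"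
  have const: "\<exists>a. \<forall>x\<in>interior K. grad \<phi> x = a" if "K \<in> tiles T N" for K
  proof -
    have "K \<in> mesh_N T N" using that tiles_subset_mesh[OF T] by blast
    then obtain a where a: "\<And>x. x \<in> interior K \<Longrightarrow> (\<phi> has_derivative (\<lambda>h. a \<bullet> h)) (at x)"
      using V_per_has_derivative[OF \<phi>] by metis
    show ?thesis by (rule exI[of _ a], rule ballI, rule grad_eqI, rule a)
  qed
  have "\<exists>a. \<forall>K\<in>tiles T N. \<forall>x\<in>interior K. grad \<phi> x = a K"
    by (rule bchoice, rule ballI, rule const)
  then obtain a where a: "\<And>K x. K \<in> tiles T N \<Longrightarrow> x \<in> interior K \<Longrightarrow> grad \<phi> x = a K"
    by (elim exE) (meson bspec)
  have U: "open U" by (auto simp: U_def)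
  have AE_U: "AE x in lebesgue. x \<in> cube N \<longrightarrow> x \<in> U"
    using AE_interior_tile[OF T, of N] by eventually_elim (auto simp: U_def)
  have "continuous_on U (grad \<phi>)"
    unfolding U_def
  proof (rule continuous_on_open_UN)
    fix K assume K: "K \<in> tiles T N"
    have "continuous_on (interior K) (\<lambda>_. a K)" by (rule continuous_on_const)
    then show "continuous_on (interior K) (grad \<phi>)"
      by (rule continuous_on_eq) (simp add: a[OF K])
  qed simp
  then have "grad \<phi> \<in> borel_measurable (lebesgue_on U)"
    using U by (intro continuous_imp_measurable_on_sets_lebesgue) auto
  then have "(\<lambda>x. indicator U x *\<^sub>R grad \<phi> x) \<in> borel_measurable lebesgue"
    using U by (subst (asm) borel_measurable_restrict_space_iff) auto
  then have "(\<lambda>x. indicator (cube N) x *\<^sub>R (indicator U x *\<^sub>R grad \<phi> x)) \<in> borel_measurable lebesgue"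
    by (rule borel_measurable_scaleR[OF borel_measurable_indicator, rotated]) simp
  moreover have "AE x in lebesgue. indicator (cube N) x *\<^sub>R (indicator U x *\<^sub>R grad \<phi> x)
      = indicator (cube N) x *\<^sub>R grad \<phi> x"
    using AE_U by eventually_elim (auto simp: indicator_def)
  ultimately have "(\<lambda>x. indicator (cube N) x *\<^sub>R grad \<phi> x) \<in> borel_measurable lebesgue"
    by (rule borel_measurable_AE)
  then have "grad \<phi> \<in> borel_measurable (lebesgue_on (cube N))"
    by (subst borel_measurable_restrict_space_iff) auto
  moreover have "AE x in lebesgue_on (cube N). norm (grad \<phi> x) \<le> (\<Sum>K\<in>tiles T N. norm (a K))"
  proof -
    have "norm (grad \<phi> x) \<le> (\<Sum>K\<in>tiles T N. norm (a K))" if x: "x \<in> U" for x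
    proof -
      obtain K where K: "K \<in> tiles T N" "x \<in> interior K" using x unfolding U_def by blast
      then show ?thesis
        using a[OF K] member_le_sum[OF K(1), of "\<lambda>K. norm (a K)"] finite_tiles[OF T] by simp
    qed
    then show ?thesis
      using AE_U by (subst AE_restrict_space_iff) (auto elim!: eventually_mono)
  qed
  ultimately show ?thesis by (rule ess_boundedI)
qed

lemma ess_bounded_continuous_on_cube:
  fixes f :: "real^'n \<Rightarrow> 'b::euclidean_space"
  assumes "continuous_on (cube N) f"
  shows "ess_bounded (lebesgue_on (cube N)) f"
proof -
  have "bounded (f ` cube N)"
    using assms compact_cube by (intro compact_imp_bounded compact_continuous_image)
  then obtain C where "\<forall>x\<in>cube N. norm (f x) \<le> C"
    by (auto simp: bounded_iff)
  then have "AE x in lebesgue_on (cube N). norm (f x) \<le> C"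
    by (intro AE_I2) (simp add: space_restrict_space)
  then show ?thesis
    using assms by (intro ess_boundedI continuous_imp_measurable_on_sets_lebesgue) auto
qed

lemma lattice_vec_scale: "real_of_int m *\<^sub>R lattice_vec k = lattice_vec (\<chi> i. m * k $ i)"
  by (simp add: vec_eq_iff)

lemma V_per_0_periodic: "\<phi> \<in> V_per T 0 \<Longrightarrow> \<phi> (lattice_vec k + x) = \<phi> x"
  by (simp add: V_per_def add.commute)

text \<open>The finite element space of the unit cube is contained in that of every larger cube.\<close>

lemma V_per_0_subset:
  assumes T: "periodic_triangulation T" and \<phi>: "\<phi> \<in> V_per T 0"
  shows "\<phi> \<in> V_per T N"
proof -
  have cont: "continuous_on (cube N) \<phi>"
    unfolding cube_eq_Union[of N]
  proof (rule continuous_on_closed_Union[OF finite_lattice_box])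
    fix k :: "int^'a"
    show "closed ((+) (lattice_vec k) ` cube 0)"
      by (intro compact_imp_closed compact_translation compact_cube)
    have "continuous_on (cube 0) \<phi>" using \<phi> by (simp add: V_per_def)
    then have "continuous_on ((+) (lattice_vec k) ` cube 0) (\<lambda>x. \<phi> (- lattice_vec k + x))"
      by (rule continuous_on_compose2) (auto intro!: continuous_intros)
    then show "continuous_on ((+) (lattice_vec k) ` cube 0) \<phi>"
      using V_per_0_periodic[OF \<phi>, of "- k"] by (simp add: lattice_vec_minus)
  qed
  have "\<phi> (x + (2 * real N + 1) *\<^sub>R lattice_vec k) = \<phi> x" for x k
    using V_per_0_periodic[OF \<phi>, of "\<chi> i. (2 * int N + 1) * k $ i" x]
      lattice_vec_scale[of "2 * int N + 1" k] by (simp add: add.commute)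
  moreover have "\<exists>a b. \<forall>x\<in>K. \<phi> x = a \<bullet> x + b" if K: "K \<in> mesh_N T N" for K
  proof -
    obtain k L where L: "L \<in> T" "K = (+) (lattice_vec k) ` L"
      using K by (auto simp: mesh_N_def periodic_mesh_def)
    then have "L \<in> tiles T 0"
      unfolding tiles_def using zero_in_lattice_box[of 0]
      by (intro image_eqI[of _ _ "(0, L)"]) (auto simp: lattice_vec_def zero_vec_def[symmetric])
    then obtain a b where ab: "\<forall>x\<in>L. \<phi> x = a \<bullet> x + b"
      using \<phi> tiles_subset_mesh[OF T] by (force simp: V_per_def)
    have "\<phi> x = a \<bullet> x + (b - a \<bullet> lattice_vec k)" if "x \<in> K" for x
      using that ab V_per_0_periodic[OF \<phi>, of k] L by (auto simp: inner_add_right)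
    then show ?thesis by blast
  qed
  moreover have "(LINT x:cube N|lebesgue. \<phi> x) = 0"
    using integral_cube_sum[OF ess_bounded_continuous_on_cube[OF cont]] \<phi>
    by (simp add: V_per_0_periodic[OF \<phi>]) (simp add: V_per_def)
  ultimately show ?thesis using cont by (simp add: V_per_def)
qed

text \<open>The sum of the translates over one period cell: it turns a test function of the large
  cube into a test function of the unit cube.\<close>

definition cell_sum :: "nat \<Rightarrow> (real^'n \<Rightarrow> real) \<Rightarrow> real^'n \<Rightarrow> real" where
  "cell_sum N \<phi> x = (\<Sum>k\<in>lattice_box N. \<phi> (lattice_vec k + x))"

text \<open>A lattice translation permutes the summands, since the cell is a set of representatives
  modulo the period.\<close>

lemma cell_sum_periodic:
  fixes \<phi> :: "real^'n \<Rightarrow> real"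
  assumes per: "\<And>x k. \<phi> (x + (2 * real N + 1) *\<^sub>R lattice_vec k) = \<phi> x"
  shows "cell_sum N \<phi> (x + lattice_vec l) = cell_sum N \<phi> x"
proof -
  define m where "m = 2 * int N + 1"
  define r :: "int^'n \<Rightarrow> int^'n" where "r k = (\<chi> i. (k $ i + l $ i + int N) mod m - int N)" for k
  define q :: "int^'n \<Rightarrow> int^'n" where "q k = (\<chi> i. (k $ i + l $ i + int N) div m)" for k
  have m: "m > 0" by (simp add: m_def)
  have r_in: "r ` lattice_box N \<subseteq> lattice_box N"
  proof (clarsimp simp: lattice_box_def r_def)
    fix k :: "int^'n" and i
    have "0 \<le> (k $ i + l $ i + int N) mod m" "(k $ i + l $ i + int N) mod m < m"
      using m by auto
    then show "\<bar>(k $ i + l $ i + int N) mod m - int N\<bar> \<le> int N" unfolding m_def by linarith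
  qed
  have inj: "inj_on r (lattice_box N)"
  proof (rule inj_onI)
    fix k k' assume k: "k \<in> lattice_box N" "k' \<in> lattice_box N" and eq: "r k = r k'"
    have "k $ i = k' $ i" for i
    proof -
      have "(k $ i + l $ i + int N) mod m = (k' $ i + l $ i + int N) mod m"
        using arg_cong[OF eq, of "\<lambda>k. k $ i"] by (simp add: r_def)
      then have "m dvd (k $ i + l $ i + int N) - (k' $ i + l $ i + int N)"
        by (simp add: mod_eq_dvd_iff)
      then have "m dvd k $ i - k' $ i" by simp
      moreover have "\<bar>k $ i\<bar> \<le> int N" "\<bar>k' $ i\<bar> \<le> int N"
        using k by (auto simp: lattice_box_def)
      then have "\<bar>k $ i - k' $ i\<bar> < m" unfolding m_def by linarith
      ultimately show ?thesis
        using dvd_imp_le_int[of "k $ i - k' $ i" m] m by fastforce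
    qed
    then show "k = k'" by (simp add: vec_eq_iff)
  qed
  have "r ` lattice_box N = lattice_box N"
    using r_in inj finite_lattice_box by (intro endo_inj_surj) auto
  with inj have bij: "bij_betw r (lattice_box N) (lattice_box N)"
    by (simp add: bij_betw_def)
  have "\<phi> (lattice_vec k + (x + lattice_vec l)) = \<phi> (lattice_vec (r k) + x)" for k
  proof -
    have "lattice_vec k + lattice_vec l = lattice_vec (r k) + (2 * real N + 1) *\<^sub>R lattice_vec (q k)"
    proof -
      have "k $ i + l $ i = r k $ i + m * q k $ i" for i
        by (simp add: r_def q_def) (use mult_div_mod_eq[of m "k $ i + l $ i + int N"] in linarith)
      then have "k + l = r k + (\<chi> i. m * q k $ i)"
        by (simp add: vec_eq_iff)
      then have "lattice_vec k + lattice_vec l = lattice_vec (r k) + real_of_int m *\<^sub>R lattice_vec (q k)"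
        by (simp only: lattice_vec_scale flip: lattice_vec_add)
      then show ?thesis by (simp add: m_def)
    qed
    then have "lattice_vec k + (x + lattice_vec l)
        = (lattice_vec (r k) + x) + (2 * real N + 1) *\<^sub>R lattice_vec (q k)"
      by (simp add: algebra_simps)
    then show ?thesis by (simp only: per)
  qed
  then have "cell_sum N \<phi> (x + lattice_vec l) = (\<Sum>k\<in>lattice_box N. \<phi> (lattice_vec (r k) + x))"
    by (simp add: cell_sum_def)
  also have "\<dots> = cell_sum N \<phi> x"
    unfolding cell_sum_def by (rule sum.reindex_bij_betw[OF bij])
  finally show ?thesis .
qed

lemma cell_sum_in_V_per:
  assumes T: "periodic_triangulation T" and \<phi>: "\<phi> \<in> V_per T N"
  shows "cell_sum N \<phi> \<in> V_per T 0"
proof -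
  have cont_N: "continuous_on (cube N) \<phi>" using \<phi> by (simp add: V_per_def)
  have "cell_sum N \<phi> (x + lattice_vec l) = cell_sum N \<phi> x" for x l
    using \<phi> by (intro cell_sum_periodic) (simp add: V_per_def)
  moreover have "continuous_on (cube 0) (cell_sum N \<phi>)"
    unfolding cell_sum_def
    by (intro continuous_on_sum continuous_on_compose2[OF cont_N])
      (auto intro!: continuous_intros simp: translate_cube_subset)
  moreover have "\<exists>a b. \<forall>x\<in>K. cell_sum N \<phi> x = a \<bullet> x + b" if K: "K \<in> mesh_N T 0" for K
  proof -
    have "\<exists>a b. \<forall>x\<in>K. \<phi> (lattice_vec k + x) = a \<bullet> x + b" if k: "k \<in> lattice_box N" for k
    proof -
      obtain l L where L: "L \<in> T" "K = (\<lambda>x. lattice_vec l + x) ` L"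
        using K by (auto simp: mesh_N_def periodic_mesh_def)
      have "(+) (lattice_vec k) ` K = (\<lambda>x. lattice_vec (k + l) + x) ` L"
        unfolding L by (simp add: image_image lattice_vec_add add.assoc)
      then have "(+) (lattice_vec k) ` K \<in> periodic_mesh T"
        using L(1) unfolding periodic_mesh_def by blast
      moreover have "(+) (lattice_vec k) ` K \<subseteq> cube N"
        using K k translate_cube_subset by (auto simp: mesh_N_def)
      ultimately have "(+) (lattice_vec k) ` K \<in> mesh_N T N" by (simp add: mesh_N_def)
      then obtain a b where "\<forall>x\<in>(+) (lattice_vec k) ` K. \<phi> x = a \<bullet> x + b"
        using \<phi> by (force simp: V_per_def)
      then have "\<forall>x\<in>K. \<phi> (lattice_vec k + x) = a \<bullet> x + (a \<bullet> lattice_vec k + b)"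
        by (simp add: inner_add_right)
      then show ?thesis by blast
    qed
    then obtain a b where ab: "\<And>k x. k \<in> lattice_box N \<Longrightarrow> x \<in> K \<Longrightarrow> \<phi> (lattice_vec k + x) = a k \<bullet> x + b k"
      by metis
    then have "\<forall>x\<in>K. cell_sum N \<phi> x = (\<Sum>k\<in>lattice_box N. a k) \<bullet> x + (\<Sum>k\<in>lattice_box N. b k)"
      by (simp add: cell_sum_def sum.distrib inner_sum_left)
    then show ?thesis by blast
  qed
  moreover have "(LINT x:cube 0|lebesgue. cell_sum N \<phi> x) = 0"
  proof -
    have b: "ess_bounded (lebesgue_on (cube N)) \<phi>"
      by (rule ess_bounded_continuous_on_cube[OF cont_N])
    have "(LINT x:cube 0|lebesgue. cell_sum N \<phi> x)
        = (\<Sum>k\<in>lattice_box N. LINT x:cube 0|lebesgue. \<phi> (lattice_vec k + x))"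
      unfolding cell_sum_def set_lebesgue_integral_def scaleR_sum_right
      using set_integrable_translates(2)[OF b]
      by (intro Bochner_Integration.integral_sum) (simp add: set_integrable_def)
    also have "\<dots> = 0"
      using integral_cube_sum[OF b] \<phi> by (simp add: V_per_def)
    finally show ?thesis .
  qed
  ultimately show ?thesis by (simp add: V_per_def)
qed

lemma AE_grad_cell_sum:
  assumes T: "periodic_triangulation T" and \<phi>: "\<phi> \<in> V_per T N"
  shows "AE x in lebesgue. x \<in> cube 0 \<longrightarrow>
    grad (cell_sum N \<phi>) x = (\<Sum>k\<in>lattice_box N. grad \<phi> (lattice_vec k + x))"
  using AE_interior_tile[OF T, of 0]
proof eventually_elim
  case (elim x)
  show ?case
  proof
    assume "x \<in> cube 0"
    then obtain L where L: "L \<in> tiles T 0" "x \<in> interior L" using elim by blast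
    have "((\<lambda>y. \<phi> (lattice_vec k + y)) has_derivative (\<lambda>h. grad \<phi> (lattice_vec k + x) \<bullet> h)) (at x)"
      if k: "k \<in> lattice_box N" for k
    proof -
      obtain K where K: "K \<in> T" "L = (+) (lattice_vec 0) ` K"
        using L(1) by (auto simp: tiles_def lattice_box_def vec_eq_iff)
          (metis vec_eq_iff zero_index)
      then have "L = K" by (simp add: lattice_vec_def zero_vec_def[symmetric])
      with K k have "(+) (lattice_vec k) ` L \<in> tiles T N"
        by (auto simp: tiles_def)
      moreover have "lattice_vec k + x \<in> interior ((+) (lattice_vec k) ` L)"
        using L(2) by (simp add: interior_translation)
      ultimately show ?thesis
        using V_per_differentiable[OF T \<phi>] has_derivative_translate by blast
    qed
    then have "(cell_sum N \<phi> has_derivative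
        (\<lambda>h. \<Sum>k\<in>lattice_box N. grad \<phi> (lattice_vec k + x) \<bullet> h)) (at x)"
      unfolding cell_sum_def by (intro has_derivative_sum)
    then show "grad (cell_sum N \<phi>) x = (\<Sum>k\<in>lattice_box N. grad \<phi> (lattice_vec k + x))"
      by (intro grad_eqI) (simp add: inner_sum_left)
  qed
qed

text \<open>The unperturbed corrector, which is defined by a problem on the unit cube, solves the
  same problem on every larger cube: for a periodic flux, testing with \<open>\<phi>\<close> on the large cube is
  testing with \<open>cell_sum N \<phi>\<close> on the unit cube.\<close>

lemma corrector_0_on_cube:
  fixes A :: "real^'n \<Rightarrow> real^'n^'n"
  assumes T: "periodic_triangulation T" and w: "corrector_0 T A p w" and \<phi>: "\<phi> \<in> V_per T N"
    and A: "ess_bounded (lebesgue_on (cube N)) A"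
    and per: "\<And>k. AE x in lebesgue. A (x + lattice_vec k) = A x"
  shows "(LINT x:cube N|lebesgue. (A x *v (p + grad w x)) \<bullet> grad \<phi> x) = 0"
proof -
  have w0: "w \<in> V_per T 0" using w by (simp add: corrector_0_def)
  have grad_w: "grad w (lattice_vec k + x) = grad w x" for k x
    using grad_translate[of w "lattice_vec k" x] by (simp add: V_per_0_periodic[OF w0])
  have grad_w': "grad w (x + lattice_vec k) = grad w x" for k x
    using grad_w[of k x] by (simp add: add.commute)
  note [ess_bounded_intros] = A V_per_grad_ess_bounded[OF T \<phi>]
    V_per_grad_ess_bounded[OF T V_per_0_subset[OF T w0]]
  let ?F = "\<lambda>x. A x *v (p + grad w x)"
  have b: "ess_bounded (lebesgue_on (cube N)) (\<lambda>x. ?F x \<bullet> grad \<phi> x)"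
    by (intro ess_bounded_intros)
  have F_per: "AE x in lebesgue. \<forall>k\<in>lattice_box N. ?F (lattice_vec k + x) = ?F x"
  proof (intro AE_finite_allI finite_lattice_box)
    fix k :: "int^'n"
    show "AE x in lebesgue. ?F (lattice_vec k + x) = ?F x"
      using per[of k] by eventually_elim (simp add: grad_w add.commute[of "lattice_vec k"] grad_w')
  qed
  have "(LINT x:cube N|lebesgue. ?F x \<bullet> grad \<phi> x)
      = (\<Sum>k\<in>lattice_box N. LINT x:cube 0|lebesgue. ?F (lattice_vec k + x) \<bullet> grad \<phi> (lattice_vec k + x))"
    by (rule integral_cube_sum[OF b])
  also have "\<dots> = (LINT x:cube 0|lebesgue. (\<Sum>k\<in>lattice_box N. ?F (lattice_vec k + x) \<bullet> grad \<phi> (lattice_vec k + x)))"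
    unfolding set_lebesgue_integral_def scaleR_sum_right
    using set_integrable_translates(2)[OF b]
    by (intro Bochner_Integration.integral_sum[symmetric]) (simp add: set_integrable_def)
  also have "\<dots> = (LINT x:cube 0|lebesgue. ?F x \<bullet> grad (cell_sum N \<phi>) x)"
    unfolding set_lebesgue_integral_def
  proof (rule integral_cong_AE)
    have "set_integrable lebesgue (cube 0)
        (\<lambda>x. \<Sum>k\<in>lattice_box N. ?F (lattice_vec k + x) \<bullet> grad \<phi> (lattice_vec k + x))"
      unfolding set_integrable_def scaleR_sum_right
      using set_integrable_translates(2)[OF b]
      by (intro Bochner_Integration.integrable_sum) (simp add: set_integrable_def)
    then show meas: "(\<lambda>x. indicator (cube 0) x *\<^sub>R
        (\<Sum>k\<in>lattice_box N. ?F (lattice_vec k + x) \<bullet> grad \<phi> (lattice_vec k + x))) \<in> borel_measurable lebesgue"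
      unfolding set_integrable_def by (rule borel_measurable_integrable)
    show AE: "AE x in lebesgue. indicator (cube 0) x *\<^sub>R
        (\<Sum>k\<in>lattice_box N. ?F (lattice_vec k + x) \<bullet> grad \<phi> (lattice_vec k + x))
        = indicator (cube 0) x *\<^sub>R (?F x \<bullet> grad (cell_sum N \<phi>) x)"
      using F_per AE_grad_cell_sum[OF T \<phi>]
      by eventually_elim (auto simp: inner_sum_right indicator_def)
    show "(\<lambda>x. indicator (cube 0) x *\<^sub>R (?F x \<bullet> grad (cell_sum N \<phi>) x)) \<in> borel_measurable lebesgue"
      by (rule borel_measurable_AE[OF meas AE])
  qed
  also have "\<dots> = 0"
    using w cell_sum_in_V_per[OF T \<phi>] by (simp add: corrector_0_def)
  finally show ?thesis .
qed

section \<open>The cell problem on the cube\<close>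

lemma avg_cube:
  "(1 / measure (lebesgue_on (cube N)) (space (lebesgue_on (cube N :: (real^'n) set))))
      *\<^sub>R integral\<^sup>L (lebesgue_on (cube N)) f = cube_avg N f"
  for f :: "real^'n \<Rightarrow> 'b::{banach, second_countable_topology}"
  by (simp add: cube_avg_def integral_cube_eq measure_restrict_space space_restrict_space)

lemma perturbed_cell_cube:
  fixes A :: "real^'n \<Rightarrow> real^'n^'n"
  assumes T: "periodic_triangulation T"
    and A: "A \<in> borel_measurable (lebesgue_on (cube N))"
      "AE x in lebesgue_on (cube N). norm (A x) \<le> b"
    and sym: "AE x in lebesgue. transpose (A x) = A x"
    and coercive: "AE x in lebesgue. \<forall>\<xi>. \<xi> \<bullet> (A x *v \<xi>) \<ge> \<gamma> * (norm \<xi>)\<^sup>2"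
    and \<Phi>: "continuous_on UNIV (gradm \<Phi>)" and \<Psi>: "continuous_on UNIV (gradm \<Psi>)"
    and ex: "\<And>x. expansion \<eta> b (gradm \<Phi> x) (mat 1) (gradm \<Psi> x)"
    and \<gamma>: "\<gamma> > 0" and b: "1 \<le> b" and \<eta>: "\<eta> \<noteq> 0" "\<bar>\<eta>\<bar> \<le> 1"
    and small: "4 * coeff_bound CARD('n) b * \<bar>\<eta>\<bar> \<le> 1"
  shows "perturbed_cell (lebesgue_on (cube N)) A (gradm \<Phi>) (gradm \<Psi>) (grad ` V_per T N) \<eta> b
    (coeff_bound CARD('n) b) \<gamma>"
proof -
  interpret finite_measure "lebesgue_on (cube N :: (real^'n) set)" by (rule finite_measure_cube)
  have cont: "ess_bounded (lebesgue_on (cube N)) f" if "continuous_on UNIV f"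
    for f :: "real^'n \<Rightarrow> 'b::euclidean_space"
    using that by (intro ess_bounded_continuous_on_cube) (rule continuous_on_subset, auto)
  have "4 * b * \<bar>\<eta>\<bar> \<le> 4 * coeff_bound CARD('n) b * \<bar>\<eta>\<bar>"
    using coeff_bound_ge[OF b, of "CARD('n)"] by (intro mult_right_mono mult_left_mono) auto
  then have "4 * b * \<bar>\<eta>\<bar> \<le> 1" using small by linarith
  then have inv: "continuous_on UNIV (\<lambda>x. matrix_inv (gradm \<Phi> x))"
    using expansion_matrix_inv(1)[OF \<eta>(2) ex] by (intro continuous_on_matrix_inv \<Phi>) auto
  have det: "continuous_on UNIV (\<lambda>x. det (gradm \<Phi> x))"
    unfolding det_def by (intro continuous_intros continuous_on_component \<Phi>)
  show ?thesis
  proof unfold_locales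
    show "0 < measure (lebesgue_on (cube N :: (real^'n) set)) (space (lebesgue_on (cube N)))"
      by (simp add: measure_restrict_space space_restrict_space measure_cube_pos)
    show "ess_bounded (lebesgue_on (cube N)) A" using A by (rule ess_boundedI)
    show "AE x in lebesgue_on (cube N). transpose (A x) = A x"
      using sym by (subst AE_restrict_space_iff) (auto elim!: eventually_mono)
    show "AE x in lebesgue_on (cube N). \<forall>\<xi>. \<gamma> * (norm \<xi>)\<^sup>2 \<le> \<xi> \<bullet> (A x *v \<xi>)"
      using coercive by (subst AE_restrict_space_iff) (auto elim!: eventually_mono)
    show "AE x in lebesgue_on (cube N). expansion \<eta> b (gradm \<Phi> x) (mat 1) (gradm \<Psi> x)"
      using ex by simp
  qed (use assms V_per_grad_ess_bounded[OF T] in \<open>auto intro: cont inv det\<close>)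
qed

text \<open>The two estimates at a fixed event, for the finite element correctors on a cube.\<close>

lemma corrector_expansion:
  fixes A :: "real^'n \<Rightarrow> real^'n^'n"
  assumes "perturbed_cell (lebesgue_on (cube N)) A (gradm \<Phi>) (gradm \<Psi>) (grad ` V_per T N) \<eta> b c \<gamma>"
    and T: "periodic_triangulation T"
    and per: "\<And>k. AE x in lebesgue. A (x + lattice_vec k) = A x"
  shows corrector_L2_bound: "norm p \<le> 1 \<Longrightarrow> corrector_eta T N A \<Phi> p w \<Longrightarrow> corrector_0 T A p w0 \<Longrightarrow>
      corrector_1 T N A \<Psi> p w0 w1 \<Longrightarrow>
      inverse (\<eta>\<^sup>2) * cube_L2_norm N (\<lambda>x. grad w x - grad w0 x - \<eta> *\<^sub>R grad w1 x)
        \<le> sqrt (remainder_bound c \<gamma>) * sqrt (measure lebesgue (cube N :: (real^'n) set))" (is "PROP ?L2")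
    and Astar_bound: "(\<And>i. corrector_eta T N A \<Phi> (axis i 1) (v (axis i 1))) \<Longrightarrow>
      (\<And>i. corrector_0 T A (axis i 1) (v0 (axis i 1))) \<Longrightarrow>
      (\<And>i. corrector_1 T N A \<Psi> (axis i 1) (v0 (axis i 1)) (v1 (axis i 1))) \<Longrightarrow>
      inverse (\<eta>\<^sup>2) * norm (Astar_eta N A \<Phi> v - Astar_per A v0 - \<eta> *\<^sub>R Astar_1 N A \<Psi> v0 v1)
        \<le> (real CARD('n))\<^sup>2 * entry_bound c \<gamma>" (is "PROP ?Astar")
proof -
  interpret perturbed_cell "lebesgue_on (cube N)" A "gradm \<Phi>" "gradm \<Psi>" "grad ` V_per T N" \<eta> b c \<gamma>
    by (rule assms(1))
  have s\<eta>: "solves_\<eta> p (grad w)" if w: "corrector_eta T N A \<Phi> p w" for p w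
  proof -
    note w' = w[unfolded corrector_eta_def integral_cube_eq]
    have "(LINT x|lebesgue_on (cube N). flux p (grad w) x \<bullet> grad \<phi> x) = 0" if "\<phi> \<in> V_per T N" for \<phi>
      unfolding flux_def by (rule bspec[OF conjunct2[OF w'] that])
    then show ?thesis
      unfolding solves_\<eta>_def using conjunct1[OF w'] by (intro conjI ballI imageI) auto
  qed
  have s0: "solves_0 p (grad w0)" if w0: "corrector_0 T A p w0" for p w0
  proof -
    have "w0 \<in> V_per T 0" using w0 by (simp add: corrector_0_def)
    then have "w0 \<in> V_per T N" by (rule V_per_0_subset[OF T])
    moreover have "(LINT x|lebesgue_on (cube N). (A x *v (p + grad w0 x)) \<bullet> grad \<phi> x) = 0"
      if "\<phi> \<in> V_per T N" for \<phi>
      using corrector_0_on_cube[OF T w0 that bdd(1) per] by (simp add: integral_cube_eq)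
    ultimately show ?thesis unfolding solves_0_def by (intro conjI ballI imageI) auto
  qed
  have s1: "solves_1 p (grad w0) (grad w1)" if w1: "corrector_1 T N A \<Psi> p w0 w1" for p w0 w1
  proof -
    note w' = w1[unfolded corrector_1_def integral_cube_eq divergence_def]
    show ?thesis
      unfolding solves_1_def
      by (intro conjI ballI, rule imageI[OF conjunct1[OF w']], elim imageE, hypsubst,
          erule bspec[OF conjunct2[OF w']])
  qed
  have vol_eq: "vol = measure lebesgue (cube N :: (real^'n) set)"
    by (simp add: measure_restrict_space space_restrict_space)
  have avg_eq: "avg f = cube_avg N f" for f :: "real^'n \<Rightarrow> 'c::{banach, second_countable_topology}"
    unfolding avg_def by (rule avg_cube)
  show "PROP ?L2"
  proof -
    assume p: "norm p \<le> 1" and w: "corrector_eta T N A \<Phi> p w" and w0: "corrector_0 T A p w0"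
      and w1: "corrector_1 T N A \<Psi> p w0 w1"
    have "cube_L2_norm N (\<lambda>x. grad w x - grad w0 x - \<eta> *\<^sub>R grad w1 x)
        \<le> sqrt (\<eta> ^ 4 * (remainder_bound c \<gamma> * vol))"
      unfolding cube_L2_norm_def integral_cube_eq
      by (intro real_sqrt_le_mono corrector_remainder_bound[OF s\<eta>[OF w] s0[OF w0] s1[OF w1] p])
    also have "\<dots> = \<eta>\<^sup>2 * (sqrt (remainder_bound c \<gamma>) * sqrt vol)"
    proof -
      have "\<eta> ^ 4 = (\<eta>\<^sup>2)\<^sup>2" by simp
      then show ?thesis by (simp only: real_sqrt_mult real_sqrt_abs) simp
    qed
    finally show ?thesis
      unfolding vol_eq using \<eta>(1) by (simp add: field_simps)
  qed
  show "PROP ?Astar"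
  proof -
    assume v: "\<And>i. corrector_eta T N A \<Phi> (axis i 1) (v (axis i 1))"
      and v0: "\<And>i. corrector_0 T A (axis i 1) (v0 (axis i 1))"
      and v1: "\<And>i. corrector_1 T N A \<Psi> (axis i 1) (v0 (axis i 1)) (v1 (axis i 1))"
    let ?e = "\<lambda>i. axis i 1 :: real^'n"
    let ?R = "Astar_eta N A \<Phi> v - Astar_per A v0 - \<eta> *\<^sub>R Astar_1 N A \<Psi> v0 v1"
    have "\<bar>?R $ i $ j\<bar> \<le> entry_bound c \<gamma> * \<eta>\<^sup>2" for i j
    proof -
      have per0: "Astar_per A v0 $ i $ j = entry_0 (grad (v0 (?e i))) (?e i) (?e j)"
      proof -
        have V: "v0 (?e j) \<in> V_per T 0" using v0 by (simp add: corrector_0_def)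
        have g: "grad (v0 (?e j)) (lattice_vec k + x) = grad (v0 (?e j)) x" for k x
          using grad_translate[of "v0 (?e j)" "lattice_vec k" x] by (simp add: V_per_0_periodic[OF V])
        have g': "grad (v0 (?e j)) (x + lattice_vec k) = grad (v0 (?e j)) x" for k x
          using g[of k x] by (simp only: add.commute)
        note [ess_bounded_intros] = V_per_grad_ess_bounded[OF T V_per_0_subset[OF T V]]
        have "entry_0 (grad (v0 (?e i))) (?e i) (?e j)
            = cube_avg N (\<lambda>x. ?e i \<bullet> (A x *v (?e j + grad (v0 (?e j)) x)))"
          unfolding avg_eq[symmetric] by (rule entry_0_symmetric[OF s0[OF v0] s0[OF v0]])
        also have "\<dots> = (LINT x:cube 0|lebesgue. ?e i \<bullet> (A x *v (?e j + grad (v0 (?e j)) x)))"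
        proof (rule cube_avg_periodic)
          show "ess_bounded (lebesgue_on (cube N)) (\<lambda>x. ?e i \<bullet> (A x *v (?e j + grad (v0 (?e j)) x)))"
            by (intro ess_bounded_intros)
          show "AE x in lebesgue. ?e i \<bullet> (A (lattice_vec k + x) *v (?e j + grad (v0 (?e j)) (lattice_vec k + x)))
              = ?e i \<bullet> (A x *v (?e j + grad (v0 (?e j)) x))" for k
            using per[of k] by eventually_elim (simp only: g' add.commute[of "lattice_vec k"])
        qed
        finally show ?thesis by (simp add: Astar_per_def)
      qed
      have "Astar_eta N A \<Phi> v $ i $ j = entry_\<eta> (grad (v (?e i))) (?e i) (?e j)"
        by (simp add: Astar_eta_def entry_\<eta>_def avg_eq)
      moreover have "Astar_1 N A \<Psi> v0 v1 $ i $ j = entry_1 (grad (v0 (?e i))) (grad (v1 (?e i))) (?e i) (?e j)"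
        by (simp add: Astar_1_def entry_1_def avg_eq per0 divergence_def [abs_def])
      ultimately show ?thesis
        using entry_remainder_bound[OF s\<eta>[OF v] s0[OF v0] s1[OF v1], of i "?e j"]
        by (simp add: per0 norm_axis_1)
    qed
    then have "(\<Sum>i\<in>UNIV. \<Sum>j\<in>UNIV. \<bar>?R $ i $ j\<bar>) \<le> (\<Sum>i\<in>(UNIV :: 'n set). \<Sum>j\<in>(UNIV :: 'n set). entry_bound c \<gamma> * \<eta>\<^sup>2)"
      by (intro sum_mono)
    then have "norm ?R \<le> (real CARD('n))\<^sup>2 * entry_bound c \<gamma> * \<eta>\<^sup>2"
      using norm_matrix_le_sum_abs[of ?R] by (simp add: power2_eq_square)
    then show ?thesis using \<eta>(1) by (simp add: field_simps)
  qed
qed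

section \<open>Random fields\<close>

lemma has_derivative_gradm:
  "F differentiable at x \<Longrightarrow> (F has_derivative (\<lambda>h. transpose (gradm F x) *v h)) (at x)"
  unfolding gradm_def transpose_transpose by (rule jacobian_works[THEN iffD1])

lemma gradm_eqI:
  assumes "(F has_derivative (\<lambda>h. transpose J *v h)) (at x)"
  shows "gradm F x = J"
  unfolding gradm_def jacobian_def frechet_derivative_at[OF assms, symmetric]
  by (simp add: matrix_of_matrix_vector_mul transpose_transpose del: transpose_matrix_vector)

lemma gradm_combination:
  fixes F G :: "real^'n \<Rightarrow> real^'n"
  assumes "F differentiable at x" "G differentiable at x"
  shows "gradm (\<lambda>y. r *\<^sub>R y + s *\<^sub>R F y + t *\<^sub>R G y) x = r *\<^sub>R mat 1 + s *\<^sub>R gradm F x + t *\<^sub>R gradm G x"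
proof (rule gradm_eqI)
  have tr: "transpose (r *\<^sub>R mat 1 + s *\<^sub>R gradm F x + t *\<^sub>R gradm G x) *v h
      = r *\<^sub>R h + s *\<^sub>R (transpose (gradm F x) *v h) + t *\<^sub>R (transpose (gradm G x) *v h)" for h
  proof -
    have "transpose (r *\<^sub>R mat 1 + s *\<^sub>R gradm F x + t *\<^sub>R gradm G x)
        = r *\<^sub>R mat 1 + s *\<^sub>R transpose (gradm F x) + t *\<^sub>R transpose (gradm G x)"
      by (simp add: transpose_def vec_eq_iff mat_def)
    then show ?thesis
      by (simp add: matrix_vector_mult_add_rdistrib scaleR_matrix_vector_assoc[symmetric] del: transpose_matrix_vector)
  qed
  show "((\<lambda>y. r *\<^sub>R y + s *\<^sub>R F y + t *\<^sub>R G y) has_derivative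
      (\<lambda>h. transpose (r *\<^sub>R mat 1 + s *\<^sub>R gradm F x + t *\<^sub>R gradm G x) *v h)) (at x)"
    unfolding tr
    by (intro has_derivative_add has_derivative_scaleR_right has_derivative_ident has_derivative_gradm assms)
qed

lemma C1_map_combination:
  fixes F G :: "real^'n \<Rightarrow> real^'n"
  assumes "C1_map F" "C1_map G"
  shows "C1_map (\<lambda>y. r *\<^sub>R y + s *\<^sub>R F y + t *\<^sub>R G y)"
    and "gradm (\<lambda>y. r *\<^sub>R y + s *\<^sub>R F y + t *\<^sub>R G y) x = r *\<^sub>R mat 1 + s *\<^sub>R gradm F x + t *\<^sub>R gradm G x"
proof -
  have d: "F differentiable at x" "G differentiable at x" for x
    using assms by (auto simp: C1_map_def)
  show g: "gradm (\<lambda>y. r *\<^sub>R y + s *\<^sub>R F y + t *\<^sub>R G y) x = r *\<^sub>R mat 1 + s *\<^sub>R gradm F x + t *\<^sub>R gradm G x" for x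
    by (rule gradm_combination[OF d])
  have "continuous_on UNIV (\<lambda>x. r *\<^sub>R mat 1 + s *\<^sub>R gradm F x + t *\<^sub>R gradm G x)"
    using assms by (intro continuous_intros) (auto simp: C1_map_def)
  then show "C1_map (\<lambda>y. r *\<^sub>R y + s *\<^sub>R F y + t *\<^sub>R G y)"
    using d unfolding C1_map_def g[abs_def]
    by (auto intro!: differentiable_add differentiable_scaleR differentiable_const differentiable_ident)
qed

text \<open>The bounds at the points of a countable dense set hold simultaneously for almost every
  event, and continuity of the paths extends them to all points.\<close>

lemma C1_Linf_norm_bound:
  fixes F :: "real^'n \<Rightarrow> 'w \<Rightarrow> real^'n"
  assumes le: "C1_Linf_norm P F \<le> ereal c"
  shows "AE \<omega> in P. C1_map (\<lambda>x. F x \<omega>) \<and> (\<forall>x. norm (gradm (\<lambda>y. F y \<omega>) x) \<le> c)"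
proof -
  have C1: "C1_Linf P F"
    using le by (auto simp: C1_Linf_norm_def split: if_splits)
  then have C1_AE: "AE \<omega> in P. C1_map (\<lambda>x. F x \<omega>)" by (simp add: C1_Linf_def)
  have pointwise: "AE \<omega> in P. norm (gradm (\<lambda>y. F y \<omega>) x) \<le> c" for x
  proof -
    let ?g = "\<lambda>\<omega>. gradm (\<lambda>y. F y \<omega>) x"
    have "Linf_norm (completion P) ?g \<le> max (Linf_norm (completion P) (F x)) (Linf_norm (completion P) ?g)"
      by simp
    also have "\<dots> \<le> C1_Linf_norm P F"
      unfolding C1_Linf_norm_def using C1
      by (auto intro!: SUP_upper2[of x])
    finally have Linf: "Linf_norm (completion P) ?g \<le> ereal c" using le by simp
    then have "esssup (completion P) (\<lambda>\<omega>. ereal (norm (?g \<omega>))) \<le> ereal c"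
      by (auto simp: Linf_norm_def split: if_splits)
    moreover have "AE \<omega> in completion P. ereal (norm (?g \<omega>)) \<le> esssup (completion P) (\<lambda>\<omega>. ereal (norm (?g \<omega>)))"
      by (rule esssup_AE)
    ultimately have "AE \<omega> in completion P. norm (?g \<omega>) \<le> c"
      by (auto elim!: eventually_mono dest: order_trans)
    then show ?thesis by (simp add: AE_completion_iff)
  qed
  obtain D :: "(real^'n) set" where D: "countable D" "\<And>X. open X \<Longrightarrow> X \<noteq> {} \<Longrightarrow> \<exists>d\<in>D. d \<in> X"
    using countable_dense_exists by blast
  have "AE \<omega> in P. \<forall>x\<in>D. norm (gradm (\<lambda>y. F y \<omega>) x) \<le> c"
    using pointwise D(1) by (simp add: AE_ball_countable)
  with C1_AE show ?thesis
  proof eventually_elim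
    case (elim \<omega>)
    let ?X = "{x. c < norm (gradm (\<lambda>y. F y \<omega>) x)}"
    have "open ?X"
      using elim(1) by (intro open_Collect_less continuous_intros) (auto simp: C1_map_def)
    then have "?X = {}" using D(2)[of ?X] elim(2) by force
    then show ?case using elim(1) by (auto simp: not_less)
  qed
qed

text \<open>The gradient of \<open>\<Psi>\<close> is bounded for almost every event at all points at once, because \<open>\<Psi>\<close>
  is a combination of \<open>\<Phi> \<eta> - Id\<close> and \<open>\<Theta> \<eta>\<close> for a single small \<open>\<eta>\<close>.\<close>

lemma gradient_fields_bounded:
  fixes \<Phi> \<Theta> :: "real \<Rightarrow> real^'n \<Rightarrow> 'w \<Rightarrow> real^'n" and \<Psi> :: "real^'n \<Rightarrow> 'w \<Rightarrow> real^'n"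
  assumes split: "\<And>\<eta>. AE \<omega> in P. \<forall>x. \<Phi> \<eta> x \<omega> = x + \<eta> *\<^sub>R \<Psi> x \<omega> + \<Theta> \<eta> x \<omega>"
    and lim: "((\<lambda>\<eta>. C1_Linf_norm P (\<lambda>x \<omega>. \<Phi> \<eta> x \<omega> - x)) \<longlongrightarrow> 0) (at 0)"
    and \<Theta>: "\<And>\<eta>. \<eta> \<noteq> 0 \<Longrightarrow> \<bar>\<eta>\<bar> \<le> 1 \<Longrightarrow>
      C1_Linf_norm P (\<lambda>x \<omega>. inverse (\<eta>\<^sup>2) *\<^sub>R \<Theta> \<eta> x \<omega>) \<le> ereal C"
  obtains L where "0 \<le> L" and
    "AE \<omega> in P. C1_map (\<lambda>x. \<Psi> x \<omega>) \<and> (\<forall>x. norm (gradm (\<lambda>y. \<Psi> y \<omega>) x) \<le> L)"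
proof -
  have "eventually (\<lambda>\<eta>. C1_Linf_norm P (\<lambda>x \<omega>. \<Phi> \<eta> x \<omega> - x) < 1) (at 0)"
    using lim by (rule order_tendstoD) simp
  moreover have "eventually (\<lambda>\<eta>::real. \<eta> \<noteq> 0 \<and> \<bar>\<eta>\<bar> \<le> 1) (at 0)"
    by (auto simp: eventually_at intro!: exI[of _ 1])
  ultimately have "eventually (\<lambda>\<eta>. C1_Linf_norm P (\<lambda>x \<omega>. \<Phi> \<eta> x \<omega> - x) < 1 \<and> \<eta> \<noteq> 0 \<and> \<bar>\<eta>\<bar> \<le> 1) (at 0)"
    by (rule eventually_conj)
  then obtain \<eta> where \<eta>: "C1_Linf_norm P (\<lambda>x \<omega>. \<Phi> \<eta> x \<omega> - x) < 1" "\<eta> \<noteq> 0" "\<bar>\<eta>\<bar> \<le> 1"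
    using eventually_happens'[OF at_neq_bot] by blast
  define L where "L = \<bar>inverse \<eta>\<bar> + \<bar>\<eta>\<bar> * \<bar>C\<bar>"
  have "C1_Linf_norm P (\<lambda>x \<omega>. \<Phi> \<eta> x \<omega> - x) \<le> ereal 1"
    using \<eta>(1) by (simp add: one_ereal_def less_imp_le)
  note C1_Linf_norm_bound[OF this] C1_Linf_norm_bound[OF \<Theta>[OF \<eta>(2,3)]] split[of \<eta>]
  then have "AE \<omega> in P. C1_map (\<lambda>x. \<Psi> x \<omega>) \<and> (\<forall>x. norm (gradm (\<lambda>y. \<Psi> y \<omega>) x) \<le> L)"
  proof eventually_elim
    case (elim \<omega>)
    let ?E = "\<lambda>x. \<Phi> \<eta> x \<omega> - x" and ?R = "\<lambda>x. inverse (\<eta>\<^sup>2) *\<^sub>R \<Theta> \<eta> x \<omega>"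
    have \<Psi>: "(\<lambda>x. \<Psi> x \<omega>) = (\<lambda>x. 0 *\<^sub>R x + inverse \<eta> *\<^sub>R ?E x + (- \<eta>) *\<^sub>R ?R x)"
      using elim(3) \<eta>(2) by (auto simp: scaleR_add_right power2_eq_square)
    have "norm (gradm (\<lambda>x. \<Psi> x \<omega>) x) \<le> L" for x
    proof -
      have "gradm (\<lambda>x. \<Psi> x \<omega>) x = inverse \<eta> *\<^sub>R gradm ?E x + (- \<eta>) *\<^sub>R gradm ?R x"
        unfolding \<Psi> using C1_map_combination(2)[of ?E ?R 0 "inverse \<eta>" "- \<eta>" x] elim by simp
      moreover have "norm (inverse \<eta> *\<^sub>R gradm ?E x) \<le> \<bar>inverse \<eta>\<bar> * 1"
        unfolding norm_scaleR using elim(1) by (intro mult_left_mono) auto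
      moreover have "norm ((- \<eta>) *\<^sub>R gradm ?R x) \<le> \<bar>\<eta>\<bar> * \<bar>C\<bar>"
        unfolding norm_scaleR abs_minus_cancel
        using elim(2) by (intro mult_left_mono) (auto intro: order_trans[OF _ abs_ge_self])
      ultimately show ?thesis
        unfolding L_def using norm_triangle_mono[of _ _ _ _] by fastforce
    qed
    moreover have "C1_map (\<lambda>x. \<Psi> x \<omega>)"
      unfolding \<Psi> using elim by (intro C1_map_combination(1)) auto
    ultimately show ?case by blast
  qed
  moreover have "0 \<le> L" by (simp add: L_def)
  ultimately show thesis using that by blast
qed

lemma gradient_expansion:
  fixes \<Phi> \<Theta> :: "real \<Rightarrow> real^'n \<Rightarrow> 'w \<Rightarrow> real^'n" and \<Psi> :: "real^'n \<Rightarrow> 'w \<Rightarrow> real^'n"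
  assumes split: "AE \<omega> in P. \<forall>x. \<Phi> \<eta> x \<omega> = x + \<eta> *\<^sub>R \<Psi> x \<omega> + \<Theta> \<eta> x \<omega>"
    and \<Psi>: "AE \<omega> in P. C1_map (\<lambda>x. \<Psi> x \<omega>) \<and> (\<forall>x. norm (gradm (\<lambda>y. \<Psi> y \<omega>) x) \<le> b)"
    and \<Theta>: "C1_Linf_norm P (\<lambda>x \<omega>. inverse (\<eta>\<^sup>2) *\<^sub>R \<Theta> \<eta> x \<omega>) \<le> ereal b"
    and b: "norm (mat 1 :: real^'n^'n) \<le> b" and \<eta>: "\<eta> \<noteq> 0"
  shows "AE \<omega> in P. continuous_on UNIV (gradm (\<lambda>x. \<Phi> \<eta> x \<omega>)) \<and> continuous_on UNIV (gradm (\<lambda>x. \<Psi> x \<omega>)) \<and>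
    (\<forall>x. expansion \<eta> b (gradm (\<lambda>x. \<Phi> \<eta> x \<omega>) x) (mat 1) (gradm (\<lambda>x. \<Psi> x \<omega>) x))"
  using split \<Psi> C1_Linf_norm_bound[OF \<Theta>]
proof eventually_elim
  case (elim \<omega>)
  let ?R = "\<lambda>x. inverse (\<eta>\<^sup>2) *\<^sub>R \<Theta> \<eta> x \<omega>"
  have \<Phi>: "(\<lambda>x. \<Phi> \<eta> x \<omega>) = (\<lambda>x. 1 *\<^sub>R x + \<eta> *\<^sub>R \<Psi> x \<omega> + \<eta>\<^sup>2 *\<^sub>R ?R x)"
    using elim(1) \<eta> by auto
  have "C1_map (\<lambda>x. \<Phi> \<eta> x \<omega>)"
    unfolding \<Phi> using elim by (intro C1_map_combination(1)) auto
  moreover have "expansion \<eta> b (gradm (\<lambda>x. \<Phi> \<eta> x \<omega>) x) (mat 1) (gradm (\<lambda>x. \<Psi> x \<omega>) x)" for x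
  proof -
    have "gradm (\<lambda>x. \<Phi> \<eta> x \<omega>) x = mat 1 + \<eta> *\<^sub>R gradm (\<lambda>x. \<Psi> x \<omega>) x + \<eta>\<^sup>2 *\<^sub>R gradm ?R x"
      unfolding \<Phi> using C1_map_combination(2)[of "\<lambda>x. \<Psi> x \<omega>" ?R 1 \<eta> "\<eta>\<^sup>2" x] elim by simp
    then have "gradm (\<lambda>x. \<Phi> \<eta> x \<omega>) x - mat 1 - \<eta> *\<^sub>R gradm (\<lambda>x. \<Psi> x \<omega>) x = \<eta>\<^sup>2 *\<^sub>R gradm ?R x"
      by simp
    moreover have "norm (\<eta>\<^sup>2 *\<^sub>R gradm ?R x) \<le> b * \<eta>\<^sup>2"
      using elim(3) by (simp add: mult.commute[of b] mult_left_mono)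
    ultimately show ?thesis
      using b elim(2) by (simp add: expansion_def)
  qed
  ultimately show ?case using elim(2) by (simp add: C1_map_def)
qed

lemma periodic_matrix_field_bounded:
  fixes A :: "real^'n \<Rightarrow> real^'n^'n"
  assumes per: "\<And>k. AE x in lebesgue. A (x + lattice_vec k) = A x"
    and bound: "\<And>i j. Linf_norm (lebesgue_on (cube 0)) (\<lambda>x. A x $ i $ j) \<le> ereal M"
  shows "A \<in> borel_measurable (lebesgue_on (cube N))"
    and "AE x in lebesgue_on (cube N). norm (A x) \<le> (real CARD('n))\<^sup>2 * M"
proof -
  have entry: "(\<lambda>x. A x $ i $ j) \<in> borel_measurable (lebesgue_on (cube N))"
    "AE x in lebesgue_on (cube N). \<bar>A x $ i $ j\<bar> \<le> M" for i j
  proof -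
    have m: "(\<lambda>x. A x $ i $ j) \<in> borel_measurable (lebesgue_on (cube 0))"
      and e: "esssup (lebesgue_on (cube 0)) (\<lambda>x. ereal (norm (A x $ i $ j))) \<le> ereal M"
      using bound[of i j] by (auto simp: Linf_norm_def split: if_splits)
    have "AE x in lebesgue_on (cube 0). ereal (norm (A x $ i $ j))
        \<le> esssup (lebesgue_on (cube 0)) (\<lambda>x. ereal (norm (A x $ i $ j)))"
      by (rule esssup_AE)
    then have "AE x in lebesgue_on (cube 0). \<bar>A x $ i $ j\<bar> \<le> M"
      using e by (auto elim!: eventually_mono dest: order_trans)
    note * = ess_bounded_cube_periodic[OF m this, of N]
    have p: "AE x in lebesgue. A (x + lattice_vec k) $ i $ j = A x $ i $ j" for k
      using per[of k] by eventually_elim simp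
    show "(\<lambda>x. A x $ i $ j) \<in> borel_measurable (lebesgue_on (cube N))"
      "AE x in lebesgue_on (cube N). \<bar>A x $ i $ j\<bar> \<le> M"
      by (rule *[OF p])+
  qed
  show "A \<in> borel_measurable (lebesgue_on (cube N))"
    by (rule borel_measurable_euclidean_space[THEN iffD2])
      (auto simp: Basis_vec_def inner_axis intro!: entry(1))
  have "AE x in lebesgue_on (cube N). \<forall>i\<in>UNIV. \<forall>j\<in>UNIV. \<bar>A x $ i $ j\<bar> \<le> M"
    by (intro AE_finite_allI finite entry)
  then show "AE x in lebesgue_on (cube N). norm (A x) \<le> (real CARD('n))\<^sup>2 * M"
  proof eventually_elim
    case (elim x)
    have "norm (A x) \<le> (\<Sum>i\<in>UNIV. \<Sum>j\<in>UNIV. \<bar>A x $ i $ j\<bar>)" by (rule norm_matrix_le_sum_abs)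
    also have "\<dots> \<le> (\<Sum>i\<in>(UNIV :: 'n set). \<Sum>j\<in>(UNIV :: 'n set). M)"
      using elim by (intro sum_mono) auto
    finally show ?case by (simp add: power2_eq_square mult_ac)
  qed
qed

section \<open>Second-order accuracy of the expansion\<close>

theorem proposition3p1:
  fixes P :: "'w measure"
    and \<tau> :: "int^'n \<Rightarrow> 'w \<Rightarrow> 'w"
    and \<Phi> \<Theta> :: "real \<Rightarrow> real^'n \<Rightarrow> 'w \<Rightarrow> real^'n"
    and \<Psi> :: "real^'n \<Rightarrow> 'w \<Rightarrow> real^'n"
    and C\<^sub>\<Theta> :: real
    and A :: "real^'n \<Rightarrow> real^'n^'n"
    and \<gamma> M :: real
    and H :: "real set"
    and T :: "real \<Rightarrow> (real^'n) set set"
    and w :: "real \<Rightarrow> real \<Rightarrow> nat \<Rightarrow> 'w \<Rightarrow> real^'n \<Rightarrow> real^'n \<Rightarrow> real"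
    and w0 :: "real \<Rightarrow> real^'n \<Rightarrow> real^'n \<Rightarrow> real"
    and w1 :: "real \<Rightarrow> nat \<Rightarrow> 'w \<Rightarrow> real^'n \<Rightarrow> real^'n \<Rightarrow> real"
    and p :: "real^'n"
  assumes "prob_space P" and "ergodic_action P \<tau>"
    and "\<And>\<eta>. stochastic_diffeomorphism P \<tau> (\<Phi> \<eta>)"
    and "\<And>\<eta>. AE \<omega> in P. \<forall>x. \<Phi> \<eta> x \<omega> = x + \<eta> *\<^sub>R \<Psi> x \<omega> + \<Theta> \<eta> x \<omega>"
    and "stationary P \<tau> (\<lambda>x \<omega>. gradm (\<lambda>y. \<Psi> y \<omega>) x)"
    and "esssup (space_prob P) (\<lambda>(x, \<omega>). ereal (norm (gradm (\<lambda>y. \<Psi> y \<omega>) x))) < \<infinity>"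
    and "((\<lambda>\<eta>. C1_Linf_norm P (\<lambda>x \<omega>. \<Phi> \<eta> x \<omega> - x)) \<longlongrightarrow> 0) (at 0)"
    and "((\<lambda>\<eta>. C1_Linf_norm P (\<lambda>x \<omega>. inverse \<eta> *\<^sub>R (\<Phi> \<eta> x \<omega> - x) - \<Psi> x \<omega>)) \<longlongrightarrow> 0) (at 0)"
    and "\<And>\<eta>. \<eta> \<noteq> 0 \<Longrightarrow> \<bar>\<eta>\<bar> \<le> 1 \<Longrightarrow>
           C1_Linf_norm P (\<lambda>x \<omega>. inverse (\<eta>\<^sup>2) *\<^sub>R \<Theta> \<eta> x \<omega>) \<le> ereal C\<^sub>\<Theta>"
    and "AE x in lebesgue. transpose (A x) = A x"
    and "\<And>k. AE x in lebesgue. A (x + lattice_vec k) = A x"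
    and "\<gamma> > 0" and "AE x in lebesgue. \<forall>\<xi>. \<xi> \<bullet> (A x *v \<xi>) \<ge> \<gamma> * (norm \<xi>)\<^sup>2"
    and "M > 0" and "\<And>i j. Linf_norm (lebesgue_on (cube 0)) (\<lambda>x. A x $ i $ j) \<le> ereal M"
    and "\<And>h. h \<in> H \<Longrightarrow> periodic_triangulation (T h) \<and> mesh_size (T h) = h"
    and "\<And>\<eta> h N q. h \<in> H \<Longrightarrow>
           AE \<omega> in P. corrector_eta (T h) N A (\<lambda>x. \<Phi> \<eta> x \<omega>) q (w \<eta> h N \<omega> q)"
    and "\<And>h q. h \<in> H \<Longrightarrow> corrector_0 (T h) A q (w0 h q)"
    and "\<And>h N q. h \<in> H \<Longrightarrow>
           AE \<omega> in P. corrector_1 (T h) N A (\<lambda>x. \<Psi> x \<omega>) q (w0 h q) (w1 h N \<omega> q)"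
    and "norm p = 1"
  shows "\<exists>C. \<forall>\<^sub>F \<eta> in at 0. \<forall>h\<in>H. \<forall>N.
           (AE \<omega> in P.
              inverse (\<eta>\<^sup>2) *
                cube_L2_norm N (\<lambda>x. grad (w \<eta> h N \<omega> p) x - grad (w0 h p) x
                                     - \<eta> *\<^sub>R grad (w1 h N \<omega> p) x)
              \<le> C * sqrt (measure lebesgue (cube N :: (real^'n) set))) \<and>
           (AE \<omega> in P.
              inverse (\<eta>\<^sup>2) *
                norm (Astar_eta N A (\<lambda>x. \<Phi> \<eta> x \<omega>) (w \<eta> h N \<omega>) - Astar_per A (w0 h)
                      - \<eta> *\<^sub>R Astar_1 N A (\<lambda>x. \<Psi> x \<omega>) (w0 h) (w1 h N \<omega>))
              \<le> C)"
proof -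
  note split = assms(4) and lim = assms(7) and \<Theta> = assms(9) and sym = assms(10) and per = assms(11)
    and \<gamma> = assms(12) and coercive = assms(13) and A_bound = assms(15) and mesh = assms(16)
    and w = assms(17) and w0 = assms(18) and w1 = assms(19)
  obtain L where L: "0 \<le> L"
    "AE \<omega> in P. C1_map (\<lambda>x. \<Psi> x \<omega>) \<and> (\<forall>x. norm (gradm (\<lambda>y. \<Psi> y \<omega>) x) \<le> L)"
    using gradient_fields_bounded[OF split lim \<Theta>] by blast
  \<comment> \<open>One bound for the coefficient and for both coefficients and the remainder of the expanded gradient.\<close>
  define b where "b = norm (mat 1 :: real^'n^'n) + L + \<bar>C\<^sub>\<Theta>\<bar> + (real CARD('n))\<^sup>2 * M"
  have b: "norm (mat 1 :: real^'n^'n) \<le> b" "L \<le> b" "C\<^sub>\<Theta> \<le> b" "(real CARD('n))\<^sup>2 * M \<le> b"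
    using L(1) \<open>M > 0\<close> unfolding b_def by (simp_all add: add_increasing add_increasing2)
  have b1: "1 \<le> b" using b(1) norm_mat_1_ge_1 order_trans by blast
  define c where "c = coeff_bound CARD('n) b"
  have c: "1 \<le> c" using coeff_bound_ge[OF b1, of "CARD('n)"] b1 by (simp add: c_def)
  have A: "A \<in> borel_measurable (lebesgue_on (cube N))" "AE x in lebesgue_on (cube N). norm (A x) \<le> b" for N
  proof -
    show "A \<in> borel_measurable (lebesgue_on (cube N))"
      by (rule periodic_matrix_field_bounded(1)[OF per A_bound])
    show "AE x in lebesgue_on (cube N). norm (A x) \<le> b"
      using periodic_matrix_field_bounded(2)[OF per A_bound] by eventually_elim (use b(4) in linarith)
  qed
  have \<Psi>: "AE \<omega> in P. C1_map (\<lambda>x. \<Psi> x \<omega>) \<and> (\<forall>x. norm (gradm (\<lambda>y. \<Psi> y \<omega>) x) \<le> b)"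
    using L(2) by eventually_elim (use b(2) order_trans in blast)
  define C where "C = max (sqrt (remainder_bound c \<gamma>)) ((real CARD('n))\<^sup>2 * entry_bound c \<gamma>)"
  have "\<forall>\<^sub>F \<eta> in at (0::real). \<eta> \<noteq> 0 \<and> \<bar>\<eta>\<bar> < 1 / (4 * c)"
    using c by (auto simp: eventually_at intro!: exI[of _ "1 / (4 * c)"])
  then have "\<forall>\<^sub>F \<eta> in at 0. \<forall>h\<in>H. \<forall>N.
     (AE \<omega> in P. inverse (\<eta>\<^sup>2) *
         cube_L2_norm N (\<lambda>x. grad (w \<eta> h N \<omega> p) x - grad (w0 h p) x - \<eta> *\<^sub>R grad (w1 h N \<omega> p) x)
       \<le> C * sqrt (measure lebesgue (cube N :: (real^'n) set))) \<and>
     (AE \<omega> in P. inverse (\<eta>\<^sup>2) *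
         norm (Astar_eta N A (\<lambda>x. \<Phi> \<eta> x \<omega>) (w \<eta> h N \<omega>) - Astar_per A (w0 h)
           - \<eta> *\<^sub>R Astar_1 N A (\<lambda>x. \<Psi> x \<omega>) (w0 h) (w1 h N \<omega>)) \<le> C)"
  proof eventually_elim
    case (elim \<eta>)
    then have \<eta>: "\<eta> \<noteq> 0" and "\<bar>\<eta>\<bar> < 1 / (4 * c)" by auto
    then have small: "4 * c * \<bar>\<eta>\<bar> \<le> 1" using c by (simp add: field_simps)
    have "1 * \<bar>\<eta>\<bar> \<le> 4 * c * \<bar>\<eta>\<bar>" using c by (intro mult_right_mono) auto
    then have \<eta>1: "\<bar>\<eta>\<bar> \<le> 1" using small by linarith
    have "C1_Linf_norm P (\<lambda>x \<omega>. inverse (\<eta>\<^sup>2) *\<^sub>R \<Theta> \<eta> x \<omega>) \<le> ereal b"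
      using \<Theta>[OF \<eta> \<eta>1] b(3) by (meson ereal_less_eq(3) order_trans)
    note fields = gradient_expansion[where \<Phi> = \<Phi> and \<Psi> = \<Psi> and \<Theta> = \<Theta> and \<eta> = \<eta>, OF split \<Psi> this b(1) \<eta>]
    show ?case
    proof (intro ballI allI conjI)
      fix h N assume h: "h \<in> H"
      then have T: "periodic_triangulation (T h)" using mesh by blast
      have cell: "perturbed_cell (lebesgue_on (cube N)) A (gradm (\<lambda>x. \<Phi> \<eta> x \<omega>)) (gradm (\<lambda>x. \<Psi> x \<omega>))
          (grad ` V_per (T h) N) \<eta> b c \<gamma>"
        if "continuous_on UNIV (gradm (\<lambda>x. \<Phi> \<eta> x \<omega>)) \<and> continuous_on UNIV (gradm (\<lambda>x. \<Psi> x \<omega>)) \<and>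
          (\<forall>x. expansion \<eta> b (gradm (\<lambda>x. \<Phi> \<eta> x \<omega>) x) (mat 1) (gradm (\<lambda>x. \<Psi> x \<omega>) x))" for \<omega>
        unfolding c_def using that small[unfolded c_def]
        by (intro perturbed_cell_cube T A sym coercive \<gamma> b1 \<eta> \<eta>1) auto
      show "AE \<omega> in P. inverse (\<eta>\<^sup>2) *
          cube_L2_norm N (\<lambda>x. grad (w \<eta> h N \<omega> p) x - grad (w0 h p) x - \<eta> *\<^sub>R grad (w1 h N \<omega> p) x)
          \<le> C * sqrt (measure lebesgue (cube N :: (real^'n) set))"
        using fields w[OF h, of N \<eta> p] w1[OF h, of N p]
      proof eventually_elim
        case (elim \<omega>)
        have "norm p \<le> 1" using \<open>norm p = 1\<close> by simp
        note corrector_L2_bound[OF cell[OF elim(1)] T per this elim(2) w0[OF h] elim(3)]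
        also have "sqrt (remainder_bound c \<gamma>) * sqrt (measure lebesgue (cube N :: (real^'n) set))
            \<le> C * sqrt (measure lebesgue (cube N :: (real^'n) set))"
          by (intro mult_right_mono) (auto simp: C_def)
        finally show ?case .
      qed
      have w_axis: "AE \<omega> in P. \<forall>i\<in>UNIV. corrector_eta (T h) N A (\<lambda>x. \<Phi> \<eta> x \<omega>) (axis i 1) (w \<eta> h N \<omega> (axis i 1))"
        by (intro AE_finite_allI finite w h)
      have w1_axis: "AE \<omega> in P. \<forall>i\<in>UNIV.
          corrector_1 (T h) N A (\<lambda>x. \<Psi> x \<omega>) (axis i 1) (w0 h (axis i 1)) (w1 h N \<omega> (axis i 1))"
        by (intro AE_finite_allI finite w1 h)
      show "AE \<omega> in P. inverse (\<eta>\<^sup>2) *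
          norm (Astar_eta N A (\<lambda>x. \<Phi> \<eta> x \<omega>) (w \<eta> h N \<omega>) - Astar_per A (w0 h)
            - \<eta> *\<^sub>R Astar_1 N A (\<lambda>x. \<Psi> x \<omega>) (w0 h) (w1 h N \<omega>)) \<le> C"
        using fields w_axis w1_axis
      proof eventually_elim
        case (elim \<omega>)
        have "inverse (\<eta>\<^sup>2) *
            norm (Astar_eta N A (\<lambda>x. \<Phi> \<eta> x \<omega>) (w \<eta> h N \<omega>) - Astar_per A (w0 h)
              - \<eta> *\<^sub>R Astar_1 N A (\<lambda>x. \<Psi> x \<omega>) (w0 h) (w1 h N \<omega>))
            \<le> (real CARD('n))\<^sup>2 * entry_bound c \<gamma>"
          using elim(2,3) by (intro Astar_bound[OF cell[OF elim(1)] T per] w0[OF h]) auto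
        then show ?case by (simp add: C_def le_max_iff_disj)
      qed
    qed
  qed
  then show ?thesis by blast
qed

end
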